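(* Let $k\ge 3$ be an integer and let $\gamma\subset\mathbb{R}^2$ be a $C^2$-smooth, planar, strictly convex closed curve which is invariant under the rotation $R_{2\pi/k}$. Suppose that the Birkhoff billiard map inside $\gamma$ admits a rotational invariant curve of rotation number $\frac{r}{k}$, with $r$ coprime to $k$. Suppose that this curve has a neighborhood $U$ in which the Birkhoff billiard map is totally integrable. Then $\gamma$ is a circle.
   Context: $R_\theta$ denotes the rotation of $\mathbb{R}^2$ by angle $\theta$ about the origin. Birkhoff billiard map: a point moves along straight lines inside $\gamma$ and reflects at $\gamma$ by the law "angle of incidence equals angle of reflection". The phase space is the open cylinder of oriented lines intersecting the interior of $\gamma$, with coordinates $(s,\alpha)$, where $s$ is the arc length parameter of the first intersection point of the line with $\gamma$ and $\alpha\in(0,\pi)$ is the angle between the line and $\dot\gamma(s)$. The billiard map $T$ sends an oriented line to the oriented line obtained after reflection at its second intersection point with $\gamma$; it is the twist map with generating function $L(s,s')=|\gamma(s)-\gamma(s')|$. A rotational invariant curve is a simple closed curve in the phase cylinder, homotopically non-trivial (winding once around the cylinder), that is mapped to itself by $T$. Its rotation number is the rotation number of the circle map $T$ induces on it, where one full turn around $\gamma$ counts as $1$ and each step advances the base point by a positive amount less than one turn. $T$ is totally integrable in an open subset $U$ of the phase cylinder if $U$ admits a $C^1$ foliation by rotational invariant curves of $T$. *)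

theory Defs
  imports "HOL-Complex_Analysis.Complex_Analysis"
begin

text \<open>
  The plane is identified with \<^typ>\<open>complex\<close>. A closed curve is given by its
  periodic arc-length parametrization \<open>\<gamma>\<close> with perimeter \<open>l\<close>, oriented counterclockwise.
\<close>

definition rotation :: "real \<Rightarrow> complex \<Rightarrow> complex" where
  "rotation \<theta> z = cis \<theta> * z"

abbreviation tangent :: "(real \<Rightarrow> complex) \<Rightarrow> real \<Rightarrow> complex" where
  "tangent \<gamma> s \<equiv> vector_derivative \<gamma> (at s)"

definition C2_closed_curve :: "(real \<Rightarrow> complex) \<Rightarrow> real \<Rightarrow> bool" where
  "C2_closed_curve \<gamma> l \<longleftrightarrow>
     0 < l \<and> (\<forall>s. \<gamma> (s + l) = \<gamma> s) \<and> inj_on \<gamma> {0..<l} \<and>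
     \<gamma> C1_differentiable_on UNIV \<and> tangent \<gamma> C1_differentiable_on UNIV \<and>
     (\<forall>s. norm (tangent \<gamma> s) = 1) \<and>
     (\<forall>z\<in>inside (range \<gamma>). winding_number (\<lambda>t. \<gamma> (l * t)) z = 1)"

text \<open>
  The closed domain bounded by the curve is strictly convex. Positive curvature is not required.
\<close>

definition strictly_convex_curve :: "(real \<Rightarrow> complex) \<Rightarrow> bool" where
  "strictly_convex_curve \<gamma> \<longleftrightarrow>
     (\<forall>x \<in> range \<gamma> \<union> inside (range \<gamma>). \<forall>y \<in> range \<gamma> \<union> inside (range \<gamma>).
        x \<noteq> y \<longrightarrow> open_segment x y \<subseteq> inside (range \<gamma>))"

text \<open>
  The point \<open>(\<gamma> s, \<alpha>)\<close> stands for the oriented line entering the domain at \<open>\<gamma> s\<close> with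
  direction \<open>tangent \<gamma> s * cis \<alpha>\<close>. Since \<open>\<gamma>\<close> embeds the circle of length \<open>l\<close> in the plane, this
  subspace of \<^typ>\<open>complex \<times> real\<close> is the cylinder with coordinates \<open>(s, \<alpha>)\<close>, \<open>s\<close> modulo \<open>l\<close>.
\<close>

definition phase_cylinder :: "(real \<Rightarrow> complex) \<Rightarrow> (complex \<times> real) set" where
  "phase_cylinder \<gamma> = range \<gamma> \<times> {0<..<pi}"

text \<open>
  The line through \<open>\<gamma> s\<close> with unit direction \<open>v\<close> meets the curve again at \<open>\<gamma> s'\<close>. There it crosses
  the curve outwards, so \<open>v = tangent \<gamma> s' * cis (- \<alpha>')\<close> with \<open>\<alpha>'\<close> in \<open>(0, \<pi>)\<close>; the mirror image
  of \<open>v\<close> in the tangent line is \<open>tangent \<gamma> s' * cis \<alpha>'\<close>.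
\<close>

definition billiard_step :: "(real \<Rightarrow> complex) \<Rightarrow> complex \<times> real \<Rightarrow> complex \<times> real \<Rightarrow> bool" where
  "billiard_step \<gamma> x y \<longleftrightarrow>
     (\<exists>s \<alpha> s' \<alpha>' v t. x = (\<gamma> s, \<alpha>) \<and> y = (\<gamma> s', \<alpha>') \<and> \<alpha> \<in> {0<..<pi} \<and> \<alpha>' \<in> {0<..<pi} \<and>
        v = tangent \<gamma> s * cis \<alpha> \<and> 0 < t \<and> \<gamma> s' = \<gamma> s + t *\<^sub>R v \<and>
        v = tangent \<gamma> s' * cis (- \<alpha>'))"

definition billiard_map :: "(real \<Rightarrow> complex) \<Rightarrow> complex \<times> real \<Rightarrow> complex \<times> real" where
  "billiard_map \<gamma> x = (THE y. billiard_step \<gamma> x y)"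

definition rotational_invariant_curve ::
    "(real \<Rightarrow> complex) \<Rightarrow> (complex \<times> real) set \<Rightarrow> bool" where
  "rotational_invariant_curve \<gamma> \<Lambda> \<longleftrightarrow>
     (\<exists>c. simple_path c \<and> pathfinish c = pathstart c \<and> path_image c = \<Lambda> \<and>
          \<Lambda> \<subseteq> phase_cylinder \<gamma> \<and>
          \<not> (\<exists>a. homotopic_loops (phase_cylinder \<gamma>) c (\<lambda>t. a))) \<and>
     billiard_map \<gamma> ` \<Lambda> = \<Lambda>"

text \<open>
  The sequence \<open>\<sigma>\<close> lifts the base points of the orbit of \<open>x\<close> to the arc-length parameter.
  Because \<open>\<Lambda>\<close> winds once around the cylinder, this computes the rotation number of the circle
  map induced on \<open>\<Lambda>\<close>, for the lift fixed by the condition on consecutive terms of \<open>\<sigma>\<close>.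
\<close>

definition has_rotation_number ::
    "(real \<Rightarrow> complex) \<Rightarrow> real \<Rightarrow> (complex \<times> real) set \<Rightarrow> real \<Rightarrow> bool" where
  "has_rotation_number \<gamma> l \<Lambda> \<rho> \<longleftrightarrow>
     (\<forall>x\<in>\<Lambda>. \<exists>\<sigma> :: nat \<Rightarrow> real.
        (\<forall>n. \<gamma> (\<sigma> n) = fst ((billiard_map \<gamma> ^^ n) x) \<and>
             \<sigma> n < \<sigma> (Suc n) \<and> \<sigma> (Suc n) < \<sigma> n + l) \<and>
        (\<lambda>n. (\<sigma> n - \<sigma> 0) / (real n * l)) \<longlonglongrightarrow> \<rho>)"

text \<open>
  A homeomorphism onto an open square that is \<open>C\<^sup>1\<close> with invertible derivative in the coordinates
  \<open>(s, \<alpha>)\<close>; by the inverse function theorem its inverse is \<open>C\<^sup>1\<close> too.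
\<close>

definition C1_chart ::
    "(real \<Rightarrow> complex) \<Rightarrow> (complex \<times> real) set \<Rightarrow> (complex \<times> real \<Rightarrow> real \<times> real) \<Rightarrow> bool" where
  "C1_chart \<gamma> V \<phi> \<longleftrightarrow>
     openin (top_of_set (phase_cylinder \<gamma>)) V \<and>
     (\<exists>\<psi>. homeomorphism V ({0<..<1} \<times> {0<..<1}) \<phi> \<psi>) \<and>
     (\<exists>D :: real \<times> real \<Rightarrow> (real \<times> real) \<Rightarrow>\<^sub>L (real \<times> real).
        continuous_on {(s, \<alpha>). (\<gamma> s, \<alpha>) \<in> V} D \<and>
        (\<forall>p \<in> {(s, \<alpha>). (\<gamma> s, \<alpha>) \<in> V}.
           ((\<lambda>(s, \<alpha>). \<phi> (\<gamma> s, \<alpha>)) has_derivative blinfun_apply (D p)) (at p) \<and>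
           bij (blinfun_apply (D p))))"

text \<open>
  \<open>F\<close> is the set of leaves. In each chart the connected components of the trace of a leaf
  (its plaques) are level sets of the second coordinate.
\<close>

definition C1_foliation ::
    "(real \<Rightarrow> complex) \<Rightarrow> (complex \<times> real) set \<Rightarrow> (complex \<times> real) set set \<Rightarrow> bool" where
  "C1_foliation \<gamma> U F \<longleftrightarrow>
     \<Union>F = U \<and> pairwise disjnt F \<and> (\<forall>L\<in>F. L \<noteq> {} \<and> connected L) \<and>
     (\<forall>x\<in>U. \<exists>V \<phi>. x \<in> V \<and> V \<subseteq> U \<and> C1_chart \<gamma> V \<phi> \<and>
        (\<forall>L\<in>F. \<forall>P\<in>components (L \<inter> V). \<exists>c. P = {z\<in>V. snd (\<phi> z) = c}))"

definition totally_integrable :: "(real \<Rightarrow> complex) \<Rightarrow> (complex \<times> real) set \<Rightarrow> bool" where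
  "totally_integrable \<gamma> U \<longleftrightarrow>
     openin (top_of_set (phase_cylinder \<gamma>)) U \<and>
     (\<exists>F. C1_foliation \<gamma> U F \<and> (\<forall>L\<in>F. rotational_invariant_curve \<gamma> L))"

end

theory Submission
  imports Defs
begin

text \<open>
  Lift the billiard map to the universal cover of the phase cylinder, a strip of pairs
  \<open>(s, \<alpha>)\<close>, so that the next base point lies ahead by less than one turn; call the lift
  \<open>step\<close>, and let \<open>a = r l / k\<close>. By the symmetry, the shift of arc length by \<open>a\<close> is the restriction
  to the curve of a rotation \<open>\<zeta>\<close> about the origin (\<open>symmetry_shift\<close>); hence it commutes
  with \<open>step\<close>. The theorem follows once every orbit on \<open>\<Lambda>\<close> is known to be an orbit of this shift:
  \<open>step z = z + (a, 0)\<close>. Then through every point of the curve there is a chord from \<open>\<gamma> s\<close> to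
  \<open>\<zeta> * \<gamma> s\<close> which makes equal angles with the curve at its two ends. The reflection that exchanges
  these ends fixes the origin and carries the oriented tangent at one end to the reverse of the
  tangent at the other end, which is its image under \<open>\<zeta>\<close>. So the reflection in the radius
  reverses the tangent. The tangent is perpendicular to the radius, and \<open>\<gamma>\<close> is a circle
  (\<open>regular_orbits_imp_circle\<close>).

  Total integrability enters through the fact that all points of \<open>\<Lambda>\<close> are periodic,
  \<open>(step ^^ k) z = z + (r * l, 0)\<close> (\<open>leaf_periodic\<close>). A leaf through a point of \<open>\<Lambda>\<close> inherits its
  rotation number, so the map \<open>f z = (step ^^ k) z - (r * l, 0)\<close> has a fixed point on this leaf. The
  fixed points form a closed subset of the leaf; the point is that they also form an open one
  (\<open>fixed_leaf_points_open\<close>). In a foliation chart at a fixed point, \<open>f\<close> has the form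
  \<open>(u, v) \<mapsto> (g u v, h v)\<close>. A leaf is compact, so it meets a short transversal only finitely
  often; as \<open>f\<close> maps each leaf to itself, \<open>h\<close> preserves these finite sets, and being
  increasing it is the identity on one side. So its derivative there is 1, and invariance of the
  area \<open>sin \<alpha> d\<alpha> ds\<close> says that \<open>g\<close> preserves a positive density on the leaf. It also has a
  fixed point, so it is the identity on the leaf (\<open>leafwise_area_preserving_fixed\<close>).

  Finally, periodic orbits on \<open>\<Lambda>\<close> are compared with arbitrary periodic orbits of the same type, as in
  Aubry's theory. Two orbits that share a base point at one time and are weakly ordered at the two
  neighbouring times coincide, by the twist condition (\<open>tangent_orbits_coincide\<close>). Let \<open>c t\<close> move
  backwards along the lift of \<open>\<Lambda>\<close>, starting from far ahead of a given orbit: it stays strictly ahead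
  at all times until it meets the orbit. So any periodic orbit of the same type belongs to
  \<open>\<Lambda>\<close>, and these orbits are strictly ordered along \<open>\<Lambda>\<close>
  (\<open>periodic_orbit_meets_periodic_curve\<close>). This applies to \<open>z = step (c t) - (a, 0)\<close>, whose orbit is,
  by the symmetry, again of this type. It is strictly ahead of the orbit of \<open>c t\<close>, strictly behind
  it, or equal to it; but the differences of their base points over one period add up to zero, so
  \<open>z = c t\<close> (\<open>periodic_curve_orbits_regular\<close>).
\<close>

section \<open>Determinants and arguments in the plane\<close>

definition det2 :: "(real \<times> real \<Rightarrow> real \<times> real) \<Rightarrow> real" where
  "det2 D = fst (D (1, 0)) * snd (D (0, 1)) - fst (D (0, 1)) * snd (D (1, 0))"

lemma linear_pair:
  assumes "linear (D :: real \<times> real \<Rightarrow> real \<times> real)"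
  shows "D (x, y) = x *\<^sub>R D (1, 0) + y *\<^sub>R D (0, 1)"
proof -
  have "D (x, y) = D (x *\<^sub>R (1, 0) + y *\<^sub>R (0, 1))" by simp
  also have "\<dots> = x *\<^sub>R D (1, 0) + y *\<^sub>R D (0, 1)"
    by (simp only: linear_add[OF assms] linear_scale[OF assms])
  finally show ?thesis .
qed

lemma det2_compose:
  assumes "linear D" "linear E"
  shows "det2 (D \<circ> E) = det2 D * det2 E"
proof -
  obtain a b c d where E: "E (1, 0) = (a, b)" "E (0, 1) = (c, d)" by fastforce
  show ?thesis unfolding det2_def o_def E linear_pair[OF assms(1), of a b] linear_pair[OF assms(1), of c d]
    by (simp add: algebra_simps)
qed

lemma det2_id: "det2 id = 1"
  by (simp add: det2_def)

lemma det2_inverse: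
  assumes "linear D" "bij D" shows "det2 (inv D) = 1 / det2 D" "det2 D \<noteq> 0"
proof -
  have "linear (inv D)" using assms inj_linear_imp_inv_linear bij_is_inj by blast
  moreover have "D \<circ> inv D = id" using bij_is_surj[OF assms(2)] unfolding surj_iff .
  ultimately have "det2 D * det2 (inv D) = 1" using det2_compose[OF assms(1)] det2_id by metis
  moreover from this show "det2 D \<noteq> 0" by auto
  ultimately show "det2 (inv D) = 1 / det2 D" by (simp add: eq_divide_eq mult.commute)
qed

lemma Im_divide_chord:
  assumes "u \<noteq> 0"
  shows "Im (v / c) = Im (v * cnj c) / (cmod c)\<^sup>2" "Im (u * v / (u * cnj c)) = Im (v * c) / (cmod c)\<^sup>2"
proof -
  show *: "Im (v / c) = Im (v * cnj c) / (cmod c)\<^sup>2" for v c :: complex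
    by (subst complex_div_cnj) (simp flip: of_real_power)
  have "u * v / (u * cnj c) = v / cnj c" using assms by simp
  then show "Im (u * v / (u * cnj c)) = Im (v * c) / (cmod c)\<^sup>2" using *[of v "cnj c"] by simp
qed

text \<open>
  For a chord \<open>c\<close> whose ends move with velocities \<open>x *\<^sub>R t\<close> and \<open>y *\<^sub>R u\<close>, the next two identities
  separate the derivatives of its angles with the end tangents \<open>t\<close> and \<open>u\<close> into the parts due to
  each end.
\<close>

lemma departure_algebra:
  fixes x y :: real
  assumes "t \<noteq> 0" "c \<noteq> 0"
  shows "Im ((cnj t * (y *\<^sub>R u - x *\<^sub>R t) + cnj (x *\<^sub>R t') * c) / (cnj t * c))
      = Im ((cnj t' * c - t * cnj t) / (cnj t * c)) * x + Im (u / c) * y"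
proof -
  have "(cnj t * (y *\<^sub>R u - x *\<^sub>R t) + cnj (x *\<^sub>R t') * c) / (cnj t * c)
    = x *\<^sub>R ((cnj t' * c - t * cnj t) / (cnj t * c)) + y *\<^sub>R (u / c)"
    using assms by (simp add: field_simps scaleR_conv_of_real)
  then show ?thesis by simp
qed

lemma arrival_algebra:
  fixes x y :: real
  assumes "u \<noteq> 0" "c \<noteq> 0"
  shows "Im ((u * cnj (y *\<^sub>R u - x *\<^sub>R t) + (y *\<^sub>R u') * cnj c) / (u * cnj c))
      = - Im (u * cnj t / (u * cnj c)) * x + Im ((u' * cnj c + u * cnj u) / (u * cnj c)) * y"
proof -
  have "(u * cnj (y *\<^sub>R u - x *\<^sub>R t) + (y *\<^sub>R u') * cnj c) / (u * cnj c)
    = y *\<^sub>R ((u' * cnj c + u * cnj u) / (u * cnj c)) - x *\<^sub>R (u * cnj t / (u * cnj c))"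
    using assms by (simp add: field_simps scaleR_conv_of_real)
  then show ?thesis by simp
qed

lemma has_derivative_Arg:
  assumes "(w has_derivative w') (at p)" "0 < Im (w p)"
  shows "((\<lambda>x. Arg (w x)) has_derivative (\<lambda>h. Im (w' h / w p))) (at p)"
proof -
  have nz: "w p \<notin> \<real>\<^sub>\<le>\<^sub>0" using assms(2) by (auto simp: complex_nonpos_Reals_iff)
  have "(Ln has_derivative (*) (inverse (w p))) (at (w p))"
    using has_field_derivative_Ln[OF nz] by (simp add: has_field_derivative_def)
  from has_derivative_Im[OF has_derivative_compose[OF assms(1) this]]
  have "((\<lambda>x. Im (Ln (w x))) has_derivative (\<lambda>h. Im (w' h / w p))) (at p)"
    by (simp only: divide_inverse mult.commute)
  moreover have "\<forall>\<^sub>F x in nhds p. Im (Ln (w x)) = Arg (w x)"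
  proof -
    have "\<forall>\<^sub>F x in at p. 0 < Im (w x)"
      using tendsto_Im[of w "w p" "at p"] has_derivative_continuous[OF assms(1)] assms(2)
      unfolding isCont_def continuous_at by (intro order_tendstoD(1)[of _ "Im (w p)"]) auto
    then have "\<forall>\<^sub>F x in nhds p. 0 < Im (w x)" using assms(2) by (simp add: eventually_nhds_conv_at)
    then show ?thesis by eventually_elim (metis Arg_eq_Im_Ln less_irrefl zero_complex.sel(2))
  qed
  ultimately show ?thesis
    by (auto intro: has_derivative_transform_eventually simp: eventually_nhds_conv_at)
qed

section \<open>Area-preserving maps that keep every leaf\<close>

lemma inj_on_if_deriv_nonzero:
  fixes f :: "real \<Rightarrow> real"
  assumes "\<And>x. x \<in> {a<..<b} \<Longrightarrow> \<exists>d. (f has_real_derivative d) (at x) \<and> d \<noteq> 0"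
  shows "inj_on f {a<..<b}"
proof (rule linorder_inj_onI)
  fix x y assume xy: "x < y" "x \<in> {a<..<b}" "y \<in> {a<..<b}"
  have cont: "continuous_on {x..y} f"
  proof (rule continuous_at_imp_continuous_on, rule ballI)
    fix z assume "z \<in> {x..y}"
    then have "z \<in> {a<..<b}" using xy by auto
    then show "isCont f z" using assms DERIV_isCont by blast
  qed
  show "f x \<noteq> f y"
  proof
    assume "f x = f y"
    moreover have "f differentiable (at z)" if "x < z" "z < y" for z
      using assms[of z] that xy real_differentiable_def by auto
    ultimately obtain z where "x < z" "z < y" "(f has_real_derivative 0) (at z)"
      using Rolle[OF xy(1) _ cont] by blast
    then show False using assms[of z] xy DERIV_unique by fastforce
  qed
qed auto

text \<open>
  Among the finitely many points with the label of \<open>v\<close> in \<open>(a, v]\<close>, an increasing map that moves \<open>v\<close>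
  down would be injective into the points below \<open>v\<close>; one that moves \<open>v\<close> up would, by the
  intermediate value theorem, cover all of them from the points below \<open>v\<close>. Both contradict finiteness.
\<close>

lemma label_preserving_increasing_map_is_id:
  fixes h :: "real \<Rightarrow> real" and lab :: "real \<Rightarrow> 'a"
  assumes mono: "\<And>v w. a \<le> v \<Longrightarrow> v < w \<Longrightarrow> w \<le> b \<Longrightarrow> h v < h w"
    and cont: "continuous_on {a..b} h" and fixed: "h a = a"
    and lab: "\<And>v. v \<in> {a..b} \<Longrightarrow> h v \<in> {a..b} \<Longrightarrow> lab (h v) = lab v"
    and fin: "\<And>x. finite {v \<in> {a..b}. lab v = x}"
    and v: "v \<in> {a..b}"
  shows "h v = v"
proof (rule ccontr)
  assume ne: "h v \<noteq> v"
  then have av: "a < v" using fixed v by (cases "a = v") auto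
  define C where "C = {w \<in> {a<..v}. lab w = lab v}"
  have finC: "finite C" by (rule finite_subset[OF _ fin[of "lab v"]]) (use v in \<open>auto simp: C_def\<close>)
  have vC: "v \<in> C" using av by (simp add: C_def)
  show False
  proof (cases "h v < v")
    case True
    have le: "h w \<le> h v" if "w \<in> C" for w using mono[of w v] that v by (cases "w = v") (auto simp: C_def)
    have "h ` C \<subseteq> C"
    proof clarify
      fix w assume w: "w \<in> C"
      then have "a < h w" "h w < v" using mono[of a w] fixed v le[OF w] True by (auto simp: C_def)
      then show "h w \<in> C" using w v lab[of w] by (auto simp: C_def)
    qed
    moreover have "inj_on h C"
    proof (rule linorder_inj_onI)
      fix x y assume "x < y" "x \<in> C" "y \<in> C"
      then have "h x < h y" using mono[of x y] v by (auto simp: C_def)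
      then show "h x \<noteq> h y" by simp
    qed auto
    ultimately have "h ` C = C" using finC endo_inj_surj by blast
    then obtain w where "w \<in> C" "h w = v" using vC by (metis imageE)
    then show False using le True by fastforce
  next
    case False
    then have gt: "v < h v" using ne by simp
    have "C \<subseteq> h ` (C - {v})"
    proof
      fix w assume w: "w \<in> C"
      have "continuous_on {a..v} h" by (rule continuous_on_subset[OF cont]) (use v in auto)
      then obtain w' where w': "a \<le> w'" "w' \<le> v" "h w' = w"
        using IVT'[of h a w v] w gt fixed av by (auto simp: C_def)
      then have "w' \<noteq> a" "w' \<noteq> v" using w gt fixed by (auto simp: C_def)
      moreover have "lab w' = lab w" using lab[of w'] w w' v by (auto simp: C_def)
      ultimately have "w' \<in> C - {v}" using w w' by (auto simp: C_def)
      then show "w \<in> h ` (C - {v})" using w'(3) by blast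
    qed
    then have "card C \<le> card (C - {v})" using finC by (meson card_image_le card_mono finite_Diff finite_imageI le_trans)
    then show False using card_Diff1_less[OF finC vC] by simp
  qed
qed

text \<open>
  The leaves are the horizontal lines, \<open>lab\<close> names the global leaf to which a line belongs, and
  \<open>\<rho> du dv\<close> is the invariant area. Preservation of labels makes \<open>h\<close> the identity just above \<open>v0\<close>, so
  the transverse derivative at \<open>v0\<close> is 1, and the Jacobian identity becomes
  \<open>\<rho> (g u) * g' u = \<rho> u\<close> on the line through the fixed point. A primitive of \<open>\<rho>\<close> is then invariant
  under \<open>g\<close>, and it is injective.
\<close>

lemma leafwise_area_preserving_fixed:
  fixes H :: "real \<times> real \<Rightarrow> real \<times> real" and \<rho> :: "real \<times> real \<Rightarrow> real" and lab :: "real \<Rightarrow> 'a"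
  assumes e: "e > 0"
    and deriv: "\<And>u v. \<bar>u - u0\<bar> < e \<Longrightarrow> \<bar>v - v0\<bar> < e \<Longrightarrow>
       \<exists>D. (H has_derivative D) (at (u, v)) \<and> det2 D = \<rho> (u, v) / \<rho> (H (u, v)) \<and> det2 D \<noteq> 0"
    and \<rho>: "\<And>u. \<bar>u - u0\<bar> < e \<Longrightarrow> \<rho> (u, v0) \<noteq> 0" "continuous_on {u0 - e<..<u0 + e} (\<lambda>u. \<rho> (u, v0))"
    and leaf: "\<And>u v. \<bar>u - u0\<bar> < e \<Longrightarrow> \<bar>v - v0\<bar> < e \<Longrightarrow> snd (H (u, v)) = h v"
    and fixed: "H (u0, v0) = (u0, v0)"
    and lab: "\<And>v. \<bar>v - v0\<bar> < e \<Longrightarrow> \<bar>h v - v0\<bar> < e \<Longrightarrow> lab (h v) = lab v"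
    and fin: "\<And>b x. b < v0 + e \<Longrightarrow> finite {v \<in> {v0..b}. lab v = x}"
    and orient: "\<And>d. d > 0 \<Longrightarrow> \<exists>u. u \<noteq> u0 \<and> \<bar>u - u0\<bar> < d \<and> 0 < (fst (H (u, v0)) - u0) * (u - u0)"
  obtains d where "d > 0" "\<And>u. \<bar>u - u0\<bar> < d \<Longrightarrow> H (u, v0) = (u, v0)"
proof -
  \<comment> \<open>The derivative of \<open>H\<close> is triangular, as \<open>H\<close> maps horizontal lines to horizontal lines.\<close>
  have partial: "\<exists>p q. ((\<lambda>u. fst (H (u, v))) has_real_derivative p) (at u) \<and> (h has_real_derivative q) (at v)
      \<and> p * q = \<rho> (u, v) / \<rho> (H (u, v)) \<and> p * q \<noteq> 0" if uv: "\<bar>u - u0\<bar> < e" "\<bar>v - v0\<bar> < e" for u v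
  proof -
    obtain D where D: "(H has_derivative D) (at (u, v))" "det2 D = \<rho> (u, v) / \<rho> (H (u, v))" "det2 D \<noteq> 0"
      using deriv[OF uv] by blast
    have lin: "linear D" using D(1) has_derivative_linear by blast
    have hor: "((\<lambda>u. H (u, v)) has_derivative (\<lambda>x. D (x, 0))) (at u)"
      by (rule has_derivative_compose[of "\<lambda>u. (u, v)" "\<lambda>x. (x, 0)", OF _ D(1)]) (auto intro!: derivative_eq_intros)
    have ver: "((\<lambda>v. H (u, v)) has_derivative (\<lambda>x. D (0, x))) (at v)"
      by (rule has_derivative_compose[of "\<lambda>v. (u, v)" "\<lambda>x. (0, x)", OF _ D(1)]) (auto intro!: derivative_eq_intros)
    define P Q where "P = D (1, 0)" and "Q = D (0, 1)"
    have Dx: "D (x, 0) = x *\<^sub>R P" "D (0, x) = x *\<^sub>R Q" for x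
      using linear_pair[OF lin, of x 0] linear_pair[OF lin, of 0 x] by (simp_all add: P_def Q_def)
    have p: "((\<lambda>u. fst (H (u, v))) has_real_derivative fst P) (at u)"
      using has_derivative_fst[OF hor] unfolding Dx has_field_derivative_def by (simp add: mult_commute_abs)
    have "((\<lambda>u. snd (H (u, v))) has_real_derivative snd P) (at u)"
      using has_derivative_snd[OF hor] unfolding Dx has_field_derivative_def by (simp add: mult_commute_abs)
    moreover have ev: "\<forall>\<^sub>F u in nhds u. snd (H (u, v)) = h v"
    proof -
      have "\<forall>\<^sub>F x in nhds u. x \<in> {u0 - e<..<u0 + e}" using uv(1) by (intro eventually_nhds_in_open) auto
      then show ?thesis by eventually_elim (use leaf uv in auto)
    qed
    ultimately have "((\<lambda>u. h v) has_real_derivative snd P) (at u)"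
      using DERIV_cong_ev[OF refl ev refl] by blast
    then have D10: "snd P = 0" using DERIV_const DERIV_unique by blast
    have "((\<lambda>v. snd (H (u, v))) has_real_derivative snd Q) (at v)"
      using has_derivative_snd[OF ver] unfolding Dx has_field_derivative_def by (simp add: mult_commute_abs)
    moreover have ev: "\<forall>\<^sub>F v in nhds v. snd (H (u, v)) = h v"
    proof -
      have "\<forall>\<^sub>F x in nhds v. x \<in> {v0 - e<..<v0 + e}" using uv(2) by (intro eventually_nhds_in_open) auto
      then show ?thesis by eventually_elim (use leaf uv in auto)
    qed
    ultimately have q: "(h has_real_derivative snd Q) (at v)"
      using DERIV_cong_ev[OF refl ev refl] by blast
    have "det2 D = fst P * snd Q" unfolding det2_def P_def[symmetric] Q_def[symmetric] D10 by simp
    then show ?thesis using p q D(2,3) by metis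
  qed
  have h0: "h v0 = v0" using leaf[of u0 v0] fixed e by simp
  have h_deriv: "\<exists>q. (h has_real_derivative q) (at v) \<and> q \<noteq> 0" if "v \<in> {v0 - e<..<v0 + e}" for v
    using partial[of u0 v] e that by fastforce
  have h_inj: "inj_on h {v0 - e<..<v0 + e}" by (rule inj_on_if_deriv_nonzero[OF h_deriv])
  obtain p0 q0 where pq0: "((\<lambda>u. fst (H (u, v0))) has_real_derivative p0) (at u0)" "(h has_real_derivative q0) (at v0)"
    "p0 * q0 = 1"
    using partial[of u0 v0] e fixed \<rho>(1)[of u0] by auto
  have "\<not> p0 < 0"
  proof
    assume "p0 < 0"
    then obtain d where d: "d > 0" "\<And>t. t > 0 \<Longrightarrow> t < d \<Longrightarrow> fst (H (u0, v0)) < fst (H (u0 - t, v0))"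
      using DERIV_neg_dec_left[OF pq0(1)] by blast
    obtain d' where d': "d' > 0" "\<And>t. t > 0 \<Longrightarrow> t < d' \<Longrightarrow> fst (H (u0 + t, v0)) < fst (H (u0, v0))"
      using DERIV_neg_dec_right[OF pq0(1)] \<open>p0 < 0\<close> by blast
    obtain u where u: "u \<noteq> u0" "\<bar>u - u0\<bar> < min d d'" "0 < (fst (H (u, v0)) - u0) * (u - u0)"
      using orient[of "min d d'"] d(1) d'(1) by auto
    show False
    proof (cases "u < u0")
      case True
      then show False using d(2)[of "u0 - u"] u fixed by (simp add: zero_less_mult_iff)
    next
      case False
      then show False using d'(2)[of "u - u0"] u fixed by (simp add: zero_less_mult_iff)
    qed
  qed
  then have q0: "q0 > 0" using pq0(3) by (smt (verit) mult_nonneg_nonpos)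
  have h_cont: "continuous_on {v0 - e<..<v0 + e} h"
    using h_deriv DERIV_isCont by (intro continuous_at_imp_continuous_on) blast
  define b where "b = v0 + e / 2"
  have b: "v0 < b" "b < v0 + e" "{v0..b} \<subseteq> {v0 - e<..<v0 + e}" using e by (auto simp: b_def)
  have above: "v0 < h v" if v: "v \<in> {v0<..b}" for v
  proof (rule ccontr)
    assume "\<not> v0 < h v"
    moreover have "h v \<noteq> h v0" using inj_onD[OF h_inj, of v v0] v b by auto
    ultimately have "h v < v0" using h0 by simp
    obtain d where d: "d > 0" "\<And>t. t > 0 \<Longrightarrow> t < d \<Longrightarrow> h v0 < h (v0 + t)"
      using DERIV_pos_inc_right[OF pq0(2) q0] by blast
    define \<eta> where "\<eta> = min (d / 2) ((v - v0) / 2)"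
    have "v0 < v" using v by simp
    have "\<eta> \<le> d / 2" "\<eta> \<le> (v - v0) / 2" unfolding \<eta>_def by (rule min.cobounded1 min.cobounded2)+
    moreover have "0 < \<eta>" unfolding \<eta>_def using d(1) \<open>v0 < v\<close> by simp
    moreover have "(v - v0) / 2 < v - v0" "d / 2 < d" using d(1) \<open>v0 < v\<close> by simp_all
    ultimately have \<eta>: "0 < \<eta>" "\<eta> < d" "\<eta> < v - v0" by (simp_all only: le_less_trans)
    define w where "w = v0 + \<eta>"
    have w: "v0 < w" "w < v" unfolding w_def using \<eta> by linarith+
    have "v0 < h w" using d(2)[of \<eta>] d(1) \<eta> h0 by (simp add: w_def)
    moreover have "continuous_on {w..v} h" by (rule continuous_on_subset[OF h_cont]) (use w v b in auto)
    ultimately obtain x where "w \<le> x" "x \<le> v" "h x = v0"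
      using IVT2'[of h v v0 w] \<open>h v < v0\<close> w by auto
    then show False using inj_onD[OF h_inj, of x v0] h0 w v b by auto
  qed
  have mono: "h v < h w" if vw: "v0 \<le> v" "v < w" "w \<le> b" for v w
  proof (cases "v = v0")
    case True
    then show ?thesis using above[of w] vw h0 by simp
  next
    case False
    have "continuous_on {v0..w} h" "inj_on h {v0..w}"
      using vw b by (auto intro: continuous_on_subset[OF h_cont] inj_on_subset[OF h_inj])
    then show ?thesis
      using continuous_inj_imp_mono[of v0 v w h] False vw above[of v] h0 by force
  qed
  have h_id: "h v = v" if "v \<in> {v0..b}" for v
  proof (rule label_preserving_increasing_map_is_id[where a = v0 and b = b and h = h and lab = lab])
    show "h v < h w" if "v0 \<le> v" "v < w" "w \<le> b" for v w by (rule mono[OF that])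
    show "h v0 = v0" "v \<in> {v0..b}" by fact+
    show "continuous_on {v0..b} h" using h_cont b(3) continuous_on_subset by blast
    show "lab (h v) = lab v" if "v \<in> {v0..b}" "h v \<in> {v0..b}" for v
      using lab[of v] that b e by auto
    show "finite {v \<in> {v0..b}. lab v = x}" for x using fin b(2) by blast
  qed
  \<comment> \<open>The two-sided derivative at \<open>v0\<close> can be computed from the right, where \<open>h\<close> is the identity.\<close>
  have "q0 = 1"
  proof (rule tendsto_unique[of "at_right v0"])
    show "((\<lambda>v. (h v - h v0) / (v - v0)) \<longlongrightarrow> q0) (at_right v0)"
      using pq0(2) unfolding has_field_derivative_iff by (rule tendsto_within_subset) simp
    have "\<forall>\<^sub>F v in at_right v0. 1 = (h v - h v0) / (v - v0)"
      using eventually_at_right_real[OF b(1)] by eventually_elim (use h_id h0 in auto)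
    then show "((\<lambda>v. (h v - h v0) / (v - v0)) \<longlongrightarrow> 1) (at_right v0)"
      by (rule Lim_transform_eventually[OF tendsto_const])
  qed simp
  define g where "g u = fst (H (u, v0))" for u
  have Hg: "H (u, v0) = (g u, v0)" if "\<bar>u - u0\<bar> < e" for u
    using leaf[of u v0] that e h0 by (simp add: g_def prod_eq_iff)
  have g_deriv: "(g has_real_derivative \<rho> (u, v0) / \<rho> (g u, v0)) (at u)" if u: "\<bar>u - u0\<bar> < e" for u
  proof -
    obtain p q where pq: "(g has_real_derivative p) (at u)" "(h has_real_derivative q) (at v0)"
      "p * q = \<rho> (u, v0) / \<rho> (H (u, v0))"
      using partial[OF u, of v0] e unfolding g_def[abs_def] by auto
    then have "q = 1" using DERIV_unique pq0(2) \<open>q0 = 1\<close> by blast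
    then show ?thesis using pq Hg[OF u] by simp
  qed
  \<comment> \<open>A compact subinterval, on which the density has a primitive.\<close>
  define a1 b1 where "a1 = u0 - e / 2" and "b1 = u0 + e / 2"
  have near: "\<bar>u - u0\<bar> < e" if "u \<in> {a1<..<b1}" for u
  proof -
    have "u0 - e / 2 < u" "u < u0 + e / 2" using that by (simp_all add: a1_def b1_def)
    then show ?thesis using e by linarith
  qed
  have ab: "a1 < u0" "u0 < b1" "{a1..b1} \<subseteq> {u0 - e<..<u0 + e}" using e by (auto simp: a1_def b1_def)
  have in_ab: "u \<in> {a1<..<b1}" if "\<bar>u - u0\<bar> < e / 2" for u
    unfolding a1_def b1_def greaterThanLessThan_iff using that by linarith
  obtain R where "\<And>u. u \<in> {a1..b1} \<Longrightarrow> (R has_vector_derivative \<rho> (u, v0)) (at u within {a1..b1})"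
    using antiderivative_continuous[OF continuous_on_subset[OF \<rho>(2) ab(3)]] by blast
  then have R: "(R has_real_derivative \<rho> (u, v0)) (at u)" if "u \<in> {a1<..<b1}" for u
    using that by (metis at_within_Icc_at atLeastAtMost_iff greaterThanLessThan_iff has_real_derivative_iff_has_vector_derivative less_imp_le)
  have R_inj: "inj_on R {a1<..<b1}"
  proof (rule inj_on_if_deriv_nonzero)
    fix u assume "u \<in> {a1<..<b1}"
    then have "(R has_real_derivative \<rho> (u, v0)) (at u)" "\<rho> (u, v0) \<noteq> 0" using R \<rho>(1) near by blast+
    then show "\<exists>d. (R has_real_derivative d) (at u) \<and> d \<noteq> 0" by blast
  qed
  have "isCont g u0" using g_deriv[of u0] e DERIV_isCont by auto
  then have "\<forall>\<epsilon>>0. \<exists>d>0. \<forall>u. \<bar>u - u0\<bar> < d \<longrightarrow> \<bar>g u - g u0\<bar> < \<epsilon>"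
    unfolding continuous_at_eps_delta dist_real_def .
  moreover have g0: "g u0 = u0" using fixed by (simp add: g_def)
  moreover have "e / 2 > 0" using e by simp
  ultimately obtain d where d: "d > 0" "\<And>u. \<bar>u - u0\<bar> < d \<Longrightarrow> \<bar>g u - u0\<bar> < e / 2" by metis
  then have d: "d > 0" "\<And>u. \<bar>u - u0\<bar> < d \<Longrightarrow> g u \<in> {a1<..<b1}" using in_ab by blast+
  define d' where "d' = min d (e / 2)"
  have d': "d' > 0" "d' \<le> d" "d' \<le> e / 2" using d(1) e by (auto simp: d'_def)
  show ?thesis
  proof (rule that[OF d'(1)])
    fix u assume u: "\<bar>u - u0\<bar> < d'"
    have "((\<lambda>x. R (g x) - R x) has_real_derivative 0) (at x)" if "x \<in> {u0 - d'<..<u0 + d'}" for x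
    proof -
      have x0: "\<bar>x - u0\<bar> < d'" using that by (auto simp: abs_less_iff)
      then have x: "g x \<in> {a1<..<b1}" "x \<in> {a1<..<b1}" using d' d(2)[of x] in_ab by simp_all
      have "\<bar>g x - u0\<bar> < e" by (rule near[OF x(1)])
      then have "\<rho> (g x, v0) \<noteq> 0" by (rule \<rho>(1))
      then show ?thesis
        using DERIV_diff[OF DERIV_chain2[OF R[OF x(1)] g_deriv[OF near[OF x(2)]]] R[OF x(2)]] by simp
    qed
    then have "R (g u) - R u = R (g u0) - R u0"
      using DERIV_isconst3[of "u0 - d'" "u0 + d'" u u0 "\<lambda>x. R (g x) - R x"] d' u by (auto simp: abs_less_iff)
    then have "R (g u) = R u" using g0 by simp
    moreover have "g u \<in> {a1<..<b1}" "u \<in> {a1<..<b1}"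
      using d(2)[of u] u d' in_ab by simp_all
    ultimately have "g u = u" using R_inj by (meson inj_onD)
    then show "H (u, v0) = (u, v0)" using Hg[of u] u d' e by simp
  qed
qed

section \<open>Circles and real functions\<close>

lemma int_translates:
  fixes f :: "real \<Rightarrow> 'a::real_vector"
  assumes "\<And>t. f (t + a) = f t + b"
  shows "f (t + of_int n * a) = f t + of_int n *\<^sub>R b"
proof (induction n rule: int_induct[where k = 0])
  case (step1 i)
  have "t + of_int (i + 1) * a = (t + of_int i * a) + a" by (simp add: algebra_simps)
  then have "f (t + of_int (i + 1) * a) = f (t + of_int i * a) + b" by (simp only: assms)
  then show ?case using step1 by (simp add: scaleR_left_distrib)
next
  case (step2 i)
  have "t + of_int i * a = (t + of_int (i - 1) * a) + a" by (simp add: algebra_simps)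
  then have "f (t + of_int i * a) = f (t + of_int (i - 1) * a) + b" by (simp only: assms)
  then show ?case using step2 by (simp add: scaleR_left_diff_distrib algebra_simps)
qed simp

lemma cis_eq_cis_iff: "cis x = cis y \<longleftrightarrow> (\<exists>n::int. x = y + 2 * pi * of_int n)"
  using sin_cos_eq_iff[of x y] by (auto simp: complex_eq_iff)

text \<open>
  A loop factors through the unit circle, so its periodic extension is a composition with
  \<open>cis (2 * pi * t)\<close>.
\<close>

lemma loop_periodic_extension:
  fixes c :: "real \<Rightarrow> 'a::topological_space"
  assumes "path c" "pathfinish c = pathstart c"
  obtains p where "continuous_on UNIV p" "\<And>t. p (t + 1) = p t" "\<And>t. t \<in> {0..1} \<Longrightarrow> p t = c t"
proof
  let ?u = "c \<circ> (\<lambda>z. Arg2pi z / (2 * pi))"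
  define p where "p t = ?u (cis (2 * pi * t))" for t
  have "homotopic_loops (path_image c) c c" using assms by (simp add: homotopic_loops_refl)
  from homotopic_with_imp_continuous[OF homotopic_loops_imp_homotopic_circlemaps[OF this]]
  have "continuous_on (sphere 0 1) ?u" by blast
  then show "continuous_on UNIV p" unfolding p_def
    by (rule continuous_on_compose2) (auto intro!: continuous_intros)
  have "cis (2 * pi * (t + 1)) = cis (2 * pi * t)" for t
    by (simp add: distrib_left flip: cis_mult)
  then show "p (t + 1) = p t" for t by (simp only: p_def)
  show "p t = c t" if "t \<in> {0..1}" for t
  proof (cases "t = 1")
    case True
    then have "p t = c 0" using Arg2pi_of_real[of 1] by (simp add: p_def)
    then show ?thesis using True assms(2) by (simp add: pathfinish_def pathstart_def)
  next
    case False
    then have "Arg2pi (cis (2 * pi * t)) = 2 * pi * t"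
      using that by (intro Arg2pi_unique[of 1]) (auto simp: cis_conv_exp)
    then show ?thesis by (simp add: p_def)
  qed
qed

lemma monotone_side:
  fixes w :: "real \<Rightarrow> real"
  assumes "continuous_on {t..t'} w" "inj_on w {t..t'}" "t < x" "x \<le> t'" "t < y" "y \<le> t'"
  shows "0 < (w x - w t) * (w y - w t)"
proof -
  have pos: "0 < (w a - w t) * (w b - w t)" if ab: "t < a" "a < b" "b \<le> t'" for a b
  proof -
    have "continuous_on {t..b} w" "inj_on w {t..b}"
      using assms(1,2) ab by (auto intro: continuous_on_subset inj_on_subset)
    then have "(w t < w a \<and> w a < w b) \<or> (w b < w a \<and> w a < w t)"
      using continuous_inj_imp_mono[OF ab(1,2)] by blast
    then show ?thesis by (auto simp: zero_less_mult_iff)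
  qed
  have "w x \<noteq> w t" using inj_onD[OF assms(2), of x t] assms by auto
  consider "x = y" | "x < y" | "y < x" by linarith
  then show ?thesis
  proof cases
    case 1
    then show ?thesis using \<open>w x \<noteq> w t\<close> by (simp add: zero_less_mult_iff) linarith
  next
    case 2
    then show ?thesis using pos assms by blast
  next
    case 3
    then show ?thesis using pos[of y x] assms by (simp add: mult.commute)
  qed
qed

section \<open>The boundary curve\<close>

locale billiard_table =
  fixes \<gamma> :: "real \<Rightarrow> complex" and l :: real
  assumes closed_curve: "C2_closed_curve \<gamma> l" and strictly_convex: "strictly_convex_curve \<gamma>"
begin


abbreviation T where "T \<equiv> tangent \<gamma>"

lemma l_pos: "0 < l"
  using closed_curve by (simp add: C2_closed_curve_def)

lemma periodic: "\<gamma> (s + l) = \<gamma> s"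
  using closed_curve by (simp add: C2_closed_curve_def)

lemma norm_T: "norm (T s) = 1"
  using closed_curve by (simp add: C2_closed_curve_def)

lemma curve_deriv: "(\<gamma> has_vector_derivative T s) (at s)"
  using closed_curve unfolding C2_closed_curve_def C1_differentiable_on_def
  by (metis UNIV_I vector_derivative_at)

lemma tangent_deriv: obtains D where "\<And>s. (T has_vector_derivative D s) (at s)"
  using closed_curve unfolding C2_closed_curve_def C1_differentiable_on_def by auto

lemma continuous_curve: "continuous_on S \<gamma>"
  using curve_deriv by (meson continuous_at_imp_continuous_on has_vector_derivative_continuous)

lemma continuous_T: "continuous_on S T"
  using tangent_deriv by (meson continuous_at_imp_continuous_on has_vector_derivative_continuous)

lemma periodic_int: "\<gamma> (s + of_int n * l) = \<gamma> s"
  using int_translates[of \<gamma> l 0 s n] periodic by simp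

lemma T_shift:
  assumes "\<And>x. \<gamma> (x + a) = \<zeta> * \<gamma> x"
  shows "T (s + a) = \<zeta> * T s"
proof -
  have "((\<lambda>x. \<gamma> (x + a)) has_vector_derivative T (s + a)) (at s)"
    by (rule vector_diff_chain_at[of "\<lambda>x. x + a" 1 s \<gamma> "T (s + a)", simplified o_def scaleR_one])
       (auto intro!: derivative_eq_intros curve_deriv)
  moreover have "((\<lambda>x. \<gamma> (x + a)) has_vector_derivative \<zeta> * T s) (at s)"
    unfolding assms by (intro has_vector_derivative_mult_right curve_deriv)
  ultimately show ?thesis by (rule vector_derivative_unique_at)
qed

lemma reduce_mod:
  obtains n where "a \<le> s + of_int n * l" "s + of_int n * l < a + l"
proof
  let ?n = "- \<lfloor>(s - a) / l\<rfloor>"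
  have "of_int \<lfloor>(s - a) / l\<rfloor> * l \<le> s - a" "s - a < (of_int \<lfloor>(s - a) / l\<rfloor> + 1) * l"
    using l_pos floor_divide_lower floor_divide_upper by blast+
  then show "a \<le> s + of_int ?n * l" "s + of_int ?n * l < a + l"
    by (simp_all add: algebra_simps)
qed

lemma curve_eq_iff: "\<gamma> s = \<gamma> s' \<longleftrightarrow> (\<exists>n::int. s' = s + of_int n * l)"
proof
  assume eq: "\<gamma> s = \<gamma> s'"
  obtain n where n: "0 \<le> s + of_int n * l" "s + of_int n * l < 0 + l" by (rule reduce_mod)
  obtain m where m: "0 \<le> s' + of_int m * l" "s' + of_int m * l < 0 + l" by (rule reduce_mod)
  have "inj_on \<gamma> {0..<l}" using closed_curve by (simp add: C2_closed_curve_def)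
  moreover have "\<gamma> (s + of_int n * l) = \<gamma> (s' + of_int m * l)"
    using eq by (simp add: periodic_int)
  ultimately have "s + of_int n * l = s' + of_int m * l"
    using n m by (intro inj_onD[of \<gamma> "{0..<l}"]) auto
  then have "s' = s + of_int (n - m) * l" by (simp add: algebra_simps)
  then show "\<exists>n::int. s' = s + of_int n * l" by blast
qed (auto simp: periodic_int)

lemma T_periodic_int: "T (s + of_int n * l) = T s"
  using T_shift[of "of_int n * l" 1 s] by (simp add: periodic_int)

lemma curve_distinct: "0 < s' - s \<Longrightarrow> s' - s < l \<Longrightarrow> \<gamma> s \<noteq> \<gamma> s'"
proof
  assume *: "0 < s' - s" "s' - s < l" "\<gamma> s = \<gamma> s'"
  then obtain n::int where "s' = s + of_int n * l" using curve_eq_iff by blast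
  then have "0 < of_int n * l" "of_int n * l < l" using * by auto
  then have "0 < n" "n < 1" using l_pos
    by (simp add: zero_less_mult_iff) (use \<open>of_int n * l < l\<close> l_pos in simp)
  then show False by simp
qed

lemma boundary_loop:
  defines "g \<equiv> \<lambda>t. \<gamma> (l * t)"
  shows "simple_path g" "pathfinish g = pathstart g" "path_image g = range \<gamma>" "valid_path g"
    "(g has_vector_derivative l *\<^sub>R T (l * t)) (at t)"
proof -
  have g': "(g has_vector_derivative l *\<^sub>R T (l * t)) (at t)" for t
  proof -
    have "((*) l has_vector_derivative l) (at t)"
      by (rule derivative_eq_intros | simp)+
    from vector_diff_chain_at[OF this curve_deriv] show ?thesis by (simp add: o_def g_def)
  qed
  then show "(g has_vector_derivative l *\<^sub>R T (l * t)) (at t)" .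
  have "continuous_on {0..1} (\<lambda>t. l *\<^sub>R T (l * t))"
    by (rule continuous_on_scaleR[OF continuous_on_const])
       (rule continuous_on_compose2[OF continuous_T[of UNIV]], auto intro: continuous_intros)
  then have "g C1_differentiable_on {0..1}"
    unfolding C1_differentiable_on_def using g' by (intro exI[of _ "\<lambda>t. l *\<^sub>R T (l * t)"]) simp
  then show "valid_path g" unfolding valid_path_def
    by (rule C1_differentiable_imp_piecewise)
  have "x = y \<or> x = 0 \<and> y = 1" if "0 \<le> x" "x \<le> y" "y \<le> 1" "g x = g y" for x y
  proof (rule ccontr)
    assume "\<not> ?thesis"
    then have "0 < l * y - l * x" "y - x < 1" using l_pos that by auto
    moreover have "l * y - l * x < l" using l_pos \<open>y - x < 1\<close>
      by (metis mult.right_neutral mult_strict_left_mono right_diff_distrib)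
    ultimately show False using curve_distinct that(4) by (simp add: g_def)
  qed
  then have "loop_free g" unfolding loop_free_def by (smt (verit) atLeastAtMost_iff)
  moreover have "continuous_on {0..1} g" unfolding g_def
    by (rule continuous_on_compose2[OF continuous_curve[of UNIV]]) (auto intro: continuous_intros)
  ultimately show "simple_path g" by (simp add: simple_path_def path_def)
  show "pathfinish g = pathstart g"
    using periodic[of 0] by (simp add: pathfinish_def pathstart_def g_def)
  have "\<gamma> s \<in> path_image g" for s
  proof -
    obtain n where n: "0 \<le> s + of_int n * l" "s + of_int n * l < 0 + l" by (rule reduce_mod)
    have "\<gamma> s = g ((s + of_int n * l) / l)" using l_pos by (simp add: g_def periodic_int)
    moreover have "(s + of_int n * l) / l \<in> {0..1}" using n l_pos by simp
    ultimately show ?thesis unfolding path_image_def by blast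
  qed
  moreover have "path_image g \<subseteq> range \<gamma>" unfolding path_image_def g_def by blast
  ultimately show "path_image g = range \<gamma>" by blast
qed

lemma Im_cnj_mult: "Im (cnj a * b) = (\<i> * a) \<bullet> b"
  by (simp add: inner_complex_def algebra_simps)

lemma inside_open_convex: "inside (range \<gamma>) \<noteq> {}" "open (inside (range \<gamma>))" "convex (inside (range \<gamma>))"
proof -
  show "inside (range \<gamma>) \<noteq> {}" "open (inside (range \<gamma>))"
    using Jordan_inside_outside[OF boundary_loop(1,2)] boundary_loop(3) by auto
  have "open_segment x y \<subseteq> inside (range \<gamma>)" if "x \<in> inside (range \<gamma>)" "y \<in> inside (range \<gamma>)" for x y
    using strictly_convex that unfolding strictly_convex_curve_def
    by (cases "x = y") auto
  then show "convex (inside (range \<gamma>))"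
    unfolding convex_contains_open_segment by blast
qed

text \<open>
  The curve is differentiable, so a line separating \<open>\<gamma> s\<close> from the open convex interior must be
  the tangent line. Strict convexity makes the inequality strict off the point of contact. The sign
  of \<open>\<epsilon>\<close> tells on which side of the oriented tangent the domain lies.
\<close>

lemma one_sided_support:
  obtains \<epsilon> :: real where "\<epsilon> \<noteq> 0" "\<And>z. z \<in> inside (range \<gamma>) \<Longrightarrow> 0 < \<epsilon> * Im (cnj (T s) * (z - \<gamma> s))"
     "\<And>s'. \<gamma> s' \<noteq> \<gamma> s \<Longrightarrow> 0 < \<epsilon> * Im (cnj (T s) * (\<gamma> s' - \<gamma> s))"
proof -
  let ?I = "inside (range \<gamma>)"
  have "\<gamma> s \<notin> ?I" using inside_no_overlap[of "range \<gamma>"] by blast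
  then obtain a b where a: "a \<noteq> 0" "a \<bullet> \<gamma> s \<le> b" "\<And>z. z \<in> ?I \<Longrightarrow> b \<le> a \<bullet> z"
    using separating_hyperplane_sets[of "{\<gamma> s}" ?I] inside_open_convex by auto
  have I: "a \<bullet> \<gamma> s < a \<bullet> z" if z: "z \<in> ?I" for z
  proof -
    obtain e where e: "e > 0" "cball z e \<subseteq> ?I" using z inside_open_convex(2) open_contains_cball by blast
    then have "z - (e / norm a) *\<^sub>R a \<in> ?I" using a(1) by (auto simp: dist_norm)
    then have "a \<bullet> \<gamma> s \<le> a \<bullet> (z - (e / norm a) *\<^sub>R a)" using a(2) a(3)[of "z - (e / norm a) *\<^sub>R a"] by linarith
    moreover have "(e / norm a) * (a \<bullet> a) > 0" using a(1) e(1) by simp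
    ultimately show ?thesis by (simp add: inner_diff_right)
  qed
  have R: "a \<bullet> \<gamma> s < a \<bullet> \<gamma> s'" if "\<gamma> s' \<noteq> \<gamma> s" for s'
  proof -
    have "open_segment (\<gamma> s) (\<gamma> s') \<subseteq> ?I"
      using strictly_convex that unfolding strictly_convex_curve_def by auto
    then have "midpoint (\<gamma> s) (\<gamma> s') \<in> ?I" using that by auto
    from I[OF this] show ?thesis by (simp add: midpoint_def inner_add_right)
  qed
  have "((\<lambda>x. a \<bullet> \<gamma> x) has_real_derivative a \<bullet> T s) (at s)"
    using bounded_linear.has_vector_derivative[OF bounded_linear_inner_right curve_deriv]
    by (simp add: has_real_derivative_iff_has_vector_derivative)
  moreover have "a \<bullet> \<gamma> s \<le> a \<bullet> \<gamma> x" for x using R by (cases "\<gamma> x = \<gamma> s") (auto simp: less_imp_le)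
  ultimately have perp: "a \<bullet> T s = 0"
    by (intro DERIV_local_min[of _ _ s 1]) auto
  define \<epsilon> where "\<epsilon> = Im (cnj (T s) * a)"
  have "cnj (T s) * a = Complex 0 \<epsilon>"
    using perp by (simp add: complex_eq_iff \<epsilon>_def inner_complex_def algebra_simps)
  moreover have "T s * cnj (T s) = 1" using norm_T by (simp add: complex_norm_square[symmetric])
  ultimately have "a = T s * Complex 0 \<epsilon>" by (metis mult.assoc mult_1)
  then have a_eq: "a = \<epsilon> *\<^sub>R (\<i> * T s)" by (simp add: complex_eq_iff)
  have *: "\<epsilon> * Im (cnj (T s) * (z - \<gamma> s)) = a \<bullet> z - a \<bullet> \<gamma> s" for z
    unfolding Im_cnj_mult by (simp add: a_eq inner_diff_right algebra_simps)
  show ?thesis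
  proof
    show "\<epsilon> \<noteq> 0" using a(1) a_eq by auto
  qed (use I R * in auto)
qed

text \<open>
  The side of the tangent on which the domain lies can be read off from a fixed interior point, so by
  continuity it is the same for all tangents. If it were the right side, the argument of
  \<open>\<gamma> s\<close> seen from that interior point would decrease, against the winding number 1.
\<close>

lemma support:
  assumes "\<gamma> s' \<noteq> \<gamma> s"
  shows "0 < Im (cnj (T s) * (\<gamma> s' - \<gamma> s))"
proof -
  obtain z where z: "z \<in> inside (range \<gamma>)" using inside_open_convex by blast
  define f where "f s = Im (cnj (T s) * (z - \<gamma> s))" for s
  have nz: "f s \<noteq> 0" for s
  proof -
    obtain \<epsilon> where "0 < \<epsilon> * f s" using one_sided_support[of s] z unfolding f_def by metis
    then show ?thesis by auto
  qed
  have cont: "continuous_on UNIV f" unfolding f_def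
    by (auto intro!: continuous_intros continuous_T continuous_curve)
  have "0 < f s"
  proof (rule ccontr)
    assume "\<not> 0 < f s"
    then have "f s < 0" using nz[of s] by linarith
    then have neg: "f x < 0" for x
    proof -
      have "connected (range f)" using cont connected_continuous_image by blast
      then have "0 \<in> range f" if "0 < f x"
        using \<open>f s < 0\<close> that unfolding connected_iff_interval by (meson less_imp_le rangeI)
      then show ?thesis using nz[of x] nz by (metis linorder_neqE_linordered_idom rangeE)
    qed
    let ?g = "reversepath (\<lambda>t. \<gamma> (l * t))"
    have nin: "z \<notin> path_image (\<lambda>t. \<gamma> (l * t))" using z boundary_loop(3) inside_no_overlap by blast
    have "0 \<le> Re (winding_number ?g z)"
    proof (rule winding_number_pos_le)
      show "valid_path ?g" by (simp add: boundary_loop(4) valid_path_imp_reverse)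
      show "z \<notin> path_image ?g" using nin by simp
      fix x :: real
      have "(?g has_vector_derivative - (l *\<^sub>R T (l * (1 - x)))) (at x)"
      proof -
        have "((-) 1 has_vector_derivative - 1) (at x)"
          by (rule derivative_eq_intros | simp)+
        from vector_diff_chain_at[OF this boundary_loop(5)] show ?thesis by (simp add: reversepath_def o_def)
      qed
      then have "vector_derivative ?g (at x) = - (l *\<^sub>R T (l * (1 - x)))"
        by (rule vector_derivative_at)
      moreover have "Im (- (l *\<^sub>R T (l * (1 - x))) * cnj (\<gamma> (l * (1 - x)) - z)) = - l * f (l * (1 - x))"
        by (simp add: f_def algebra_simps)
      ultimately show "0 \<le> Im (vector_derivative ?g (at x) * cnj (?g x - z))"
        using neg[of "l * (1 - x)"] l_pos by (simp add: reversepath_def mult_pos_neg less_imp_le mult_nonneg_nonpos)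
    qed
    moreover have "winding_number (\<lambda>t. \<gamma> (l * t)) z = 1"
      using closed_curve z by (simp add: C2_closed_curve_def)
    ultimately show False
      using winding_number_reversepath[OF valid_path_imp_path[OF boundary_loop(4)] nin] by simp
  qed
  moreover obtain \<epsilon> where "0 < \<epsilon> * f s" "0 < \<epsilon> * Im (cnj (T s) * (\<gamma> s' - \<gamma> s))"
    using one_sided_support[of s] z assms unfolding f_def by metis
  ultimately show ?thesis by (metis zero_less_mult_pos zero_less_mult_pos2)
qed

section \<open>Chords and the twist condition\<close>

definition departure :: "real \<Rightarrow> real \<Rightarrow> real" where
  "departure s s' = Arg (cnj (T s) * (\<gamma> s' - \<gamma> s))"

definition arrival :: "real \<Rightarrow> real \<Rightarrow> real" where
  "arrival s s' = Arg (T s' * cnj (\<gamma> s' - \<gamma> s))"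

lemma chord_pos:
  assumes "s < s'" "s' < s + l"
  shows "\<gamma> s' - \<gamma> s \<noteq> 0" "0 < Im (cnj (T s) * (\<gamma> s' - \<gamma> s))" "0 < Im (T s' * cnj (\<gamma> s' - \<gamma> s))"
proof -
  have ne: "\<gamma> s \<noteq> \<gamma> s'" using curve_distinct assms by simp
  then show "\<gamma> s' - \<gamma> s \<noteq> 0" by simp
  show "0 < Im (cnj (T s) * (\<gamma> s' - \<gamma> s))" using support ne by metis
  have "0 < Im (cnj (T s') * (\<gamma> s - \<gamma> s'))" using support ne by metis
  then show "0 < Im (T s' * cnj (\<gamma> s' - \<gamma> s))" by (simp add: algebra_simps)
qed

lemma angles_in:
  assumes "s < s'" "s' < s + l"
  shows "departure s s' \<in> {0<..<pi}" "arrival s s' \<in> {0<..<pi}"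
  using chord_pos[OF assms] Arg_lt_pi unfolding departure_def arrival_def by auto

lemma T_cnj: "T s * cnj (T s) = 1"
  using norm_T by (simp add: complex_norm_square[symmetric])

lemma chord_cis:
  assumes "s < s'" "s' < s + l"
  shows "\<gamma> s' - \<gamma> s = cmod (\<gamma> s' - \<gamma> s) *\<^sub>R (T s * cis (departure s s'))"
    "\<gamma> s' - \<gamma> s = cmod (\<gamma> s' - \<gamma> s) *\<^sub>R (T s' * cis (- arrival s s'))"
proof -
  let ?c = "\<gamma> s' - \<gamma> s"
  have "cnj (T s) * ?c = cmod ?c *\<^sub>R cis (departure s s')"
    using rcis_cmod_Arg[of "cnj (T s) * ?c"] norm_T
    by (simp add: departure_def rcis_def norm_mult scaleR_conv_of_real)
  then have "(T s * cnj (T s)) * ?c = cmod ?c *\<^sub>R (T s * cis (departure s s'))"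
    by (simp add: mult.assoc)
  then show "?c = cmod ?c *\<^sub>R (T s * cis (departure s s'))" unfolding T_cnj by simp
  have "T s' * cnj ?c = cmod ?c *\<^sub>R cis (arrival s s')"
    using rcis_cmod_Arg[of "T s' * cnj ?c"] norm_T
    by (simp add: arrival_def rcis_def norm_mult scaleR_conv_of_real del: complex_cnj_diff)
  then have "cnj (T s' * cnj ?c) = cnj (cmod ?c *\<^sub>R cis (arrival s s'))" by simp
  then have "cnj (T s') * ?c = cmod ?c *\<^sub>R cis (- arrival s s')"
    by (simp add: cis_cnj scaleR_conv_of_real)
  then have "(T s' * cnj (T s')) * ?c = cmod ?c *\<^sub>R (T s' * cis (- arrival s s'))"
    by (simp add: mult.assoc)
  then show "?c = cmod ?c *\<^sub>R (T s' * cis (- arrival s s'))" unfolding T_cnj by simp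
qed

lemma polar_unique:
  assumes "0 < t" "0 < t'" "\<alpha> \<in> {0<..<pi}" "\<beta> \<in> {0<..<pi}" "u \<noteq> 0"
    "t *\<^sub>R (u * cis \<alpha>) = t' *\<^sub>R (u * cis \<beta>)"
  shows "\<alpha> = \<beta>"
proof -
  have eq: "of_real t * cis \<alpha> = of_real t' * cis \<beta>"
    using assms(5,6) by (simp add: scaleR_conv_of_real)
  have "Arg (of_real t * cis \<alpha>) = \<alpha>" "Arg (of_real t' * cis \<beta>) = \<beta>"
    using assms(1-4) by (auto simp: Arg_times_of_real Arg_cis)
  then show ?thesis using eq by simp
qed

lemma sin_angles:
  assumes "s < s'" "s' < s + l"
  shows "sin (departure s s') = Im (cnj (T s) * (\<gamma> s' - \<gamma> s)) / cmod (\<gamma> s' - \<gamma> s)"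
    "sin (arrival s s') = Im (T s' * cnj (\<gamma> s' - \<gamma> s)) / cmod (\<gamma> s' - \<gamma> s)"
proof -
  have "cnj (T s) * (\<gamma> s' - \<gamma> s) \<noteq> 0" "T s' * cnj (\<gamma> s' - \<gamma> s) \<noteq> 0"
    using chord_pos[OF assms] by (metis less_irrefl zero_complex.sel(2))+
  then show "sin (departure s s') = Im (cnj (T s) * (\<gamma> s' - \<gamma> s)) / cmod (\<gamma> s' - \<gamma> s)"
    "sin (arrival s s') = Im (T s' * cnj (\<gamma> s' - \<gamma> s)) / cmod (\<gamma> s' - \<gamma> s)"
    unfolding departure_def arrival_def
    by (simp_all only: sin_Arg norm_mult norm_T complex_mod_cnj mult_1 simp_thms)
qed

text \<open>
  Only one partial derivative of each angle is made explicit. Their signs are the twist condition: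
  the departure angle increases with the far end of the chord, and the arrival angle decreases with
  its near end. Up to the sign, both are the mixed second derivative of the chord length,
  divided by the sine of the angle in question; this is why the area below is preserved.
\<close>

lemma angle_derivatives:
  assumes "s < s'" "s' < s + l"
  shows "\<exists>a. ((\<lambda>(s, s'). departure s s') has_derivative
           (\<lambda>(h, h'). a * h + sin (arrival s s') / cmod (\<gamma> s' - \<gamma> s) * h')) (at (s, s'))" (is ?dep)
    "\<exists>b. ((\<lambda>(s, s'). arrival s s') has_derivative
           (\<lambda>(h, h'). - (sin (departure s s') / cmod (\<gamma> s' - \<gamma> s)) * h + b * h')) (at (s, s'))" (is ?arr)
proof -
  let ?c = "\<gamma> s' - \<gamma> s"
  obtain T' where T': "\<And>s. (T has_vector_derivative T' s) (at s)" using tangent_deriv by blast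
  have fst_snd: "(f \<circ> fst has_derivative (\<lambda>h. fst h *\<^sub>R f')) (at (s, s'))"
       if "(f has_vector_derivative f') (at s)" for f :: "real \<Rightarrow> complex" and f'
    using has_derivative_compose[OF has_derivative_fst[OF has_derivative_ident], of f "\<lambda>h. h *\<^sub>R f'" "(s, s')"] that
    unfolding has_vector_derivative_def o_def by simp
  have snd: "(f \<circ> snd has_derivative (\<lambda>h. snd h *\<^sub>R f')) (at (s, s'))"
       if "(f has_vector_derivative f') (at s')" for f :: "real \<Rightarrow> complex" and f'
    using has_derivative_compose[OF has_derivative_snd[OF has_derivative_ident], of f "\<lambda>h. h *\<^sub>R f'" "(s, s')"] that
    unfolding has_vector_derivative_def o_def by simp
  note c1 = fst_snd[OF curve_deriv, unfolded o_def] and c2 = snd[OF curve_deriv, unfolded o_def]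
    and t1 = fst_snd[OF T', unfolded o_def] and t2 = snd[OF T', unfolded o_def]
  have c: "((\<lambda>p. \<gamma> (snd p) - \<gamma> (fst p)) has_derivative (\<lambda>h. snd h *\<^sub>R T s' - fst h *\<^sub>R T s)) (at (s, s'))"
    by (intro has_derivative_diff c1 c2)
  note w1 = has_derivative_mult[OF has_derivative_cnj[OF t1] c]
  note w2 = has_derivative_mult[OF t2 has_derivative_cnj[OF c]]
  have nz: "?c \<noteq> 0" "T s \<noteq> 0" "T s' \<noteq> 0" using chord_pos(1)[OF assms] norm_T norm_zero zero_neq_one by metis+
  have A: "((\<lambda>p. departure (fst p) (snd p)) has_derivative
      (\<lambda>h. Im ((cnj (T s) * (snd h *\<^sub>R T s' - fst h *\<^sub>R T s) + cnj (fst h *\<^sub>R T' s) * ?c) / (cnj (T s) * ?c)))) (at (s, s'))"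
    using has_derivative_Arg[OF w1] chord_pos(2)[OF assms] by (simp add: departure_def)
  have d1: "Im (T s' / ?c) = sin (arrival s s') / cmod ?c"
    unfolding sin_angles[OF assms] Im_divide_chord(1)[OF nz(2)] by (simp add: power2_eq_square del: complex_cnj_diff)
  have d2: "Im (T s' * cnj (T s) / (T s' * cnj ?c)) = sin (departure s s') / cmod ?c"
    unfolding sin_angles[OF assms] Im_divide_chord(2)[OF nz(3)] by (simp add: power2_eq_square)
  show ?dep
    using A unfolding departure_algebra[OF nz(2,1)] d1 case_prod_beta' by blast
  have B: "((\<lambda>p. arrival (fst p) (snd p)) has_derivative
      (\<lambda>h. Im ((T s' * cnj (snd h *\<^sub>R T s' - fst h *\<^sub>R T s) + (snd h *\<^sub>R T' s') * cnj ?c) / (T s' * cnj ?c)))) (at (s, s'))"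
    using has_derivative_Arg[OF w2] chord_pos(3)[OF assms] by (simp add: arrival_def)
  show ?arr
    using B unfolding arrival_algebra[OF nz(3,1)] d2 case_prod_beta' by blast
qed

lemma departure_mono:
  assumes "s < x" "x < y" "y < s + l"
  shows "departure s x < departure s y"
proof (rule DERIV_pos_imp_increasing[OF assms(2)])
  fix z assume z: "x \<le> z" "z \<le> y"
  then have sz: "s < z" "z < s + l" using assms by auto
  obtain a where a: "((\<lambda>(s, s'). departure s s') has_derivative
           (\<lambda>(h, h'). a * h + sin (arrival s z) / cmod (\<gamma> z - \<gamma> s) * h')) (at (s, z))"
    using angle_derivatives(1)[OF sz] by blast
  have "((\<lambda>z. (s, z)) has_derivative (\<lambda>h. (0, h))) (at z)"
    by (auto intro!: derivative_eq_intros)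
  from has_derivative_compose[OF this a]
  have "(departure s has_derivative (\<lambda>h. a * 0 + sin (arrival s z) / cmod (\<gamma> z - \<gamma> s) * h)) (at z)"
    by (simp only: prod.case)
  then have "(departure s has_real_derivative sin (arrival s z) / cmod (\<gamma> z - \<gamma> s)) (at z)"
    unfolding has_field_derivative_def by (simp only: mult_zero_right add_0)
  moreover have "sin (arrival s z) / cmod (\<gamma> z - \<gamma> s) > 0"
    using angles_in(2)[OF sz] chord_pos(1)[OF sz] by (simp add: sin_gt_zero)
  ultimately show "\<exists>d. (departure s has_real_derivative d) (at z) \<and> 0 < d" by blast
qed

lemma arrival_antimono:
  assumes "s - l < x" "x < y" "y < s"
  shows "arrival y s < arrival x s"
proof (rule DERIV_neg_imp_decreasing[OF assms(2)])
  fix z assume z: "x \<le> z" "z \<le> y"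
  then have sz: "z < s" "s < z + l" using assms by auto
  obtain b where b: "((\<lambda>(s, s'). arrival s s') has_derivative
           (\<lambda>(h, h'). - (sin (departure z s) / cmod (\<gamma> s - \<gamma> z)) * h + b * h')) (at (z, s))"
    using angle_derivatives(2)[OF sz] by blast
  have "((\<lambda>z. (z, s)) has_derivative (\<lambda>h. (h, 0))) (at z)"
    by (auto intro!: derivative_eq_intros)
  from has_derivative_compose[OF this b]
  have "((\<lambda>z. arrival z s) has_derivative (\<lambda>h. - (sin (departure z s) / cmod (\<gamma> s - \<gamma> z)) * h + b * 0)) (at z)"
    by (simp only: prod.case)
  then have "((\<lambda>z. arrival z s) has_real_derivative - (sin (departure z s) / cmod (\<gamma> s - \<gamma> z))) (at z)"
    unfolding has_field_derivative_def by (simp only: mult_zero_right add_0_right)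
  moreover have "sin (departure z s) / cmod (\<gamma> s - \<gamma> z) > 0"
    using angles_in(1)[OF sz] chord_pos(1)[OF sz] by (simp add: sin_gt_zero)
  ultimately show "\<exists>d. ((\<lambda>z. arrival z s) has_real_derivative d) (at z) \<and> d < 0"
    by (metis neg_less_0_iff_less)
qed

lemma departure_limits:
  shows "((\<lambda>x. cos (departure s x)) \<longlongrightarrow> 1) (at_right s)"
    "((\<lambda>x. cos (departure s x)) \<longlongrightarrow> -1) (at_left (s + l))"
proof -
  define q where "q D = Re (cnj (T s) * D) / cmod D" for D
  have q: "cos (departure s x) = q (\<gamma> x - \<gamma> s)" if "s < x" "x < s + l" for x
  proof -
    have "cnj (T s) * (\<gamma> x - \<gamma> s) \<noteq> 0"
      using chord_pos(2)[OF that] by (metis less_irrefl zero_complex.sel(2))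
    then have "cos (departure s x) = Re (sgn (cnj (T s) * (\<gamma> x - \<gamma> s)))"
      unfolding departure_def by (metis cis_Arg cis.sel(1))
    then show ?thesis by (simp add: sgn_div_norm norm_mult norm_T q_def inverse_eq_divide)
  qed
  have q_scale: "q (c *\<^sub>R D) = q D" if "c > 0" for c D
    using that unfolding q_def mult_scaleR_right norm_scaleR scaleR_complex.sel by simp
  have q_minus: "q (- D) = - q D" for D
    unfolding q_def mult_minus_right norm_minus_cancel uminus_complex.sel minus_divide_left by (rule refl)
  have tend: "((\<lambda>x. q (D x)) \<longlongrightarrow> 1) F" if "(D \<longlongrightarrow> T s) F" for D and F :: "real filter"
  proof -
    have "((\<lambda>x. q (D x)) \<longlongrightarrow> Re (cnj (T s) * T s) / cmod (T s)) F"
      unfolding q_def using norm_T[of s] by (intro tendsto_intros that) auto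
    moreover have "Re (cnj (T s) * T s) / cmod (T s) = 1"
      using T_cnj[of s] norm_T[of s] by (simp add: mult.commute)
    ultimately show ?thesis by (simp only:)
  qed
  have slope: "((\<lambda>x. (1 / (x - a)) *\<^sub>R (\<gamma> x - \<gamma> a)) \<longlongrightarrow> T a) (at a)" for a
  proof -
    have "((\<lambda>x. norm (\<gamma> x - \<gamma> a - (x - a) *\<^sub>R T a) / norm (x - a)) \<longlongrightarrow> 0) (at a)"
      using curve_deriv[of a] unfolding has_vector_derivative_def has_derivative_iff_norm by blast
    moreover have "\<forall>\<^sub>F x in at a. norm (\<gamma> x - \<gamma> a - (x - a) *\<^sub>R T a) / norm (x - a)
        = norm ((1 / (x - a)) *\<^sub>R (\<gamma> x - \<gamma> a) - T a)"
      unfolding eventually_at_filter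
    proof (intro always_eventually allI impI)
      fix x assume "x \<noteq> a"
      then have "(1 / (x - a)) *\<^sub>R (\<gamma> x - \<gamma> a) - T a = (1 / (x - a)) *\<^sub>R (\<gamma> x - \<gamma> a - (x - a) *\<^sub>R T a)"
        by (simp add: scaleR_right_diff_distrib)
      then show "norm (\<gamma> x - \<gamma> a - (x - a) *\<^sub>R T a) / norm (x - a) = norm ((1 / (x - a)) *\<^sub>R (\<gamma> x - \<gamma> a) - T a)"
        by simp
    qed
    ultimately have "((\<lambda>x. norm ((1 / (x - a)) *\<^sub>R (\<gamma> x - \<gamma> a) - T a)) \<longlongrightarrow> 0) (at a)"
      by (rule Lim_transform_eventually)
    then show ?thesis by (simp add: LIM_zero_iff tendsto_norm_zero_iff)
  qed
  have ev1: "\<forall>\<^sub>F x in at_right s. s < x \<and> x < s + l"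
    using l_pos by (auto simp: eventually_at_right_field intro!: exI[of _ "s + l"])
  have ev2: "\<forall>\<^sub>F x in at_left (s + l). s < x \<and> x < s + l"
    using l_pos by (auto simp: eventually_at_left_field intro!: exI[of _ s])
  show "((\<lambda>x. cos (departure s x)) \<longlongrightarrow> 1) (at_right s)"
  proof (rule Lim_transform_eventually)
    show "((\<lambda>x. q ((1 / (x - s)) *\<^sub>R (\<gamma> x - \<gamma> s))) \<longlongrightarrow> 1) (at_right s)"
      by (intro tend tendsto_within_subset[OF slope]) auto
    show "\<forall>\<^sub>F x in at_right s. q ((1 / (x - s)) *\<^sub>R (\<gamma> x - \<gamma> s)) = cos (departure s x)"
      using ev1 by eventually_elim (simp add: q q_scale)
  qed
  have Tl: "T (s + l) = T s" "\<gamma> (s + l) = \<gamma> s" using T_periodic_int[of s 1] periodic by simp_all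
  show "((\<lambda>x. cos (departure s x)) \<longlongrightarrow> -1) (at_left (s + l))"
  proof (rule Lim_transform_eventually)
    show "((\<lambda>x. - q ((1 / (x - (s + l))) *\<^sub>R (\<gamma> x - \<gamma> (s + l)))) \<longlongrightarrow> - 1) (at_left (s + l))"
      by (intro tendsto_minus tend) (use slope[of "s + l"] Tl in \<open>auto intro: tendsto_within_subset\<close>)
    show "\<forall>\<^sub>F x in at_left (s + l). - q ((1 / (x - (s + l))) *\<^sub>R (\<gamma> x - \<gamma> (s + l))) = cos (departure s x)"
      using ev2
    proof eventually_elim
      case (elim x)
      have "(1 / (x - (s + l))) *\<^sub>R (\<gamma> x - \<gamma> (s + l)) = - ((1 / (s + l - x)) *\<^sub>R (\<gamma> x - \<gamma> s))"
        unfolding Tl(2) by (metis minus_diff_eq minus_divide_right scaleR_minus_left)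
      then show ?case using q q_scale[of "1 / (s + l - x)"] elim by (simp add: q_minus)
    qed
  qed
qed

lemma continuous_departure: "continuous_on {s<..<s + l} (departure s)"
proof (rule continuous_at_imp_continuous_on, rule ballI)
  fix z assume "z \<in> {s<..<s + l}"
  then have sz: "s < z" "z < s + l" by auto
  obtain a where a: "((\<lambda>(s, s'). departure s s') has_derivative
           (\<lambda>(h, h'). a * h + sin (arrival s z) / cmod (\<gamma> z - \<gamma> s) * h')) (at (s, z))"
    using angle_derivatives(1)[OF sz] by blast
  have "((\<lambda>z. (s, z)) has_derivative (\<lambda>h. (0, h))) (at z)"
    by (auto intro!: derivative_eq_intros)
  from has_derivative_continuous[OF has_derivative_compose[OF this a]]
  show "isCont (departure s) z" by simp
qed

text \<open>
  Close to \<open>s\<close> the chord points along the tangent, and close to \<open>s + l\<close> against it; monotonicity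
  in between gives uniqueness.
\<close>

lemma departure_onto:
  assumes "\<alpha> \<in> {0<..<pi}"
  shows "\<exists>!s'. s < s' \<and> s' < s + l \<and> departure s s' = \<alpha>"
proof -
  have "cos \<alpha> < 1" "-1 < cos \<alpha>"
    using assms cos_monotone_0_pi[of 0 \<alpha>] cos_monotone_0_pi[of \<alpha> pi] by auto
  then have "\<forall>\<^sub>F x in at_right s. cos \<alpha> < cos (departure s x)" "\<forall>\<^sub>F x in at_left (s + l). cos (departure s x) < cos \<alpha>"
    using departure_limits[of s] by (auto intro: order_tendstoD)
  then obtain b b' where b: "s < b" "\<And>x. s < x \<Longrightarrow> x < b \<Longrightarrow> cos \<alpha> < cos (departure s x)"
    and b': "b' < s + l" "\<And>x. b' < x \<Longrightarrow> x < s + l \<Longrightarrow> cos (departure s x) < cos \<alpha>"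
    unfolding eventually_at_right_field eventually_at_left_field by blast
  obtain x1 where x1: "s < x1" "x1 < min b (s + l / 2)" using b(1) l_pos
    by (metis dense half_gt_zero less_add_same_cancel1 min_less_iff_conj)
  obtain x2 where x2: "max b' (s + l / 2) < x2" "x2 < s + l" using b'(1) l_pos
    by (metis add_less_cancel_left dense field_sum_of_halves less_add_same_cancel1 half_gt_zero max_less_iff_conj)
  have 1: "departure s x1 < \<alpha>"
    using b(2)[of x1] x1 angles_in(1)[of s x1] assms l_pos cos_mono_less_eq[of \<alpha> "departure s x1"] by simp
  have 2: "\<alpha> < departure s x2"
    using b'(2)[of x2] x2 angles_in(1)[of s x2] assms l_pos cos_mono_less_eq[of "departure s x2" \<alpha>] by simp
  have "continuous_on {x1..x2} (departure s)"
    by (rule continuous_on_subset[OF continuous_departure]) (use x1 x2 in auto)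
  then obtain x where "x1 \<le> x" "x \<le> x2" "departure s x = \<alpha>"
    using IVT'[of "departure s" x1 \<alpha> x2] 1 2 x1 x2 by auto
  then have "s < x \<and> x < s + l \<and> departure s x = \<alpha>" using x1 x2 by auto
  moreover have "x = y" if "s < x \<and> x < s + l \<and> departure s x = \<alpha>" "s < y \<and> y < s + l \<and> departure s y = \<alpha>" for x y
    using departure_mono[of s x y] departure_mono[of s y x] that by (metis less_irrefl linorder_neqE_linordered_idom)
  ultimately show ?thesis by blast
qed

section \<open>The lifted billiard map\<close>

definition strip :: "(real \<times> real) set" where
  "strip = UNIV \<times> {0<..<pi}"

definition impact :: "real \<times> real \<Rightarrow> real" where
  "impact z = (THE s'. fst z < s' \<and> s' < fst z + l \<and> departure (fst z) s' = snd z)"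

definition step :: "real \<times> real \<Rightarrow> real \<times> real" where
  "step z = (impact z, arrival (fst z) (impact z))"

lemma impact:
  assumes "z \<in> strip"
  shows "fst z < impact z" "impact z < fst z + l" "departure (fst z) (impact z) = snd z"
  using theI'[OF departure_onto[of "snd z" "fst z"]] assms unfolding strip_def impact_def by auto

lemma impact_eqI:
  assumes "s < s'" "s' < s + l"
  shows "impact (s, departure s s') = s'"
proof -
  have "(s, departure s s') \<in> strip" using angles_in(1)[OF assms] by (simp add: strip_def)
  from impact[OF this] show ?thesis using departure_onto[OF angles_in(1)[OF assms], of s] assms by auto
qed

lemma fst_step: "fst (step z) = impact z" and snd_step: "snd (step z) = arrival (fst z) (impact z)"
  by (simp_all add: step_def)

lemma step_in_strip: "z \<in> strip \<Longrightarrow> step z \<in> strip"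
  using impact[of z] angles_in(2)[of "fst z" "impact z"] by (simp add: step_def strip_def)

definition proj :: "real \<times> real \<Rightarrow> complex \<times> real" where
  "proj z = (\<gamma> (fst z), snd z)"

text \<open>
  Two parameters of the same point of the curve differ by a multiple of \<open>l\<close>, so the end of the chord
  can be moved into the interval where \<open>departure\<close> is injective.
\<close>

lemma billiard_step_iff:
  assumes "z \<in> strip"
  shows "billiard_step \<gamma> (proj z) y \<longleftrightarrow> y = proj (step z)"
proof
  let ?s = "fst z" and ?s' = "impact z"
  note i = impact[OF assms]
  show "billiard_step \<gamma> (proj z) y" if "y = proj (step z)"
    unfolding billiard_step_def
  proof (intro exI conjI)
    show "y = (\<gamma> ?s', arrival ?s ?s')" using that by (simp add: proj_def step_def)
    show "\<gamma> ?s' = \<gamma> ?s + cmod (\<gamma> ?s' - \<gamma> ?s) *\<^sub>R (T ?s * cis (snd z))"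
      using chord_cis(1)[OF i(1,2)] i(3) by (simp add: algebra_simps)
    show "0 < cmod (\<gamma> ?s' - \<gamma> ?s)" using chord_pos(1)[OF i(1,2)] by simp
    have "cmod (\<gamma> ?s' - \<gamma> ?s) *\<^sub>R (T ?s * cis (snd z)) = cmod (\<gamma> ?s' - \<gamma> ?s) *\<^sub>R (T ?s' * cis (- arrival ?s ?s'))"
      using chord_cis[OF i(1,2)] unfolding i(3) by (rule subst)
    then show "T ?s * cis (snd z) = T ?s' * cis (- arrival ?s ?s')"
      using chord_pos(1)[OF i(1,2)] by simp
    show "proj z = (\<gamma> ?s, snd z)" by (simp add: proj_def)
    show "snd z \<in> {0<..<pi}" using assms by (auto simp: strip_def)
    show "arrival ?s ?s' \<in> {0<..<pi}" using angles_in[OF i(1,2)] by simp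
  qed simp
  assume "billiard_step \<gamma> (proj z) y"
  then obtain s \<alpha> x' \<alpha>' t where st: "proj z = (\<gamma> s, \<alpha>)" "y = (\<gamma> x', \<alpha>')" "\<alpha> \<in> {0<..<pi}" "\<alpha>' \<in> {0<..<pi}"
    "0 < t" "\<gamma> x' = \<gamma> s + t *\<^sub>R (T s * cis \<alpha>)" "T s * cis \<alpha> = T x' * cis (- \<alpha>')"
    unfolding billiard_step_def by blast
  then have \<alpha>: "\<alpha> = snd z" "\<gamma> s = \<gamma> ?s" by (auto simp: proj_def)
  then have Ts: "T s = T ?s" using curve_eq_iff T_periodic_int by metis
  obtain n where n: "?s \<le> x' + of_int n * l" "x' + of_int n * l < ?s + l" by (rule reduce_mod)
  define x where "x = x' + of_int n * l"
  have x: "\<gamma> x = \<gamma> x'" "T x = T x'" by (simp_all add: x_def periodic_int T_periodic_int)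
  have eq: "\<gamma> x = \<gamma> ?s + t *\<^sub>R (T ?s * cis (snd z))" "T ?s * cis (snd z) = T x * cis (- \<alpha>')"
    using st(6,7) \<alpha> Ts x by simp_all
  have Tnz: "T u \<noteq> 0" for u using norm_T[of u] by auto
  have "\<gamma> x \<noteq> \<gamma> ?s" using eq(1) st(5) Tnz by simp
  then have xs: "?s < x" "x < ?s + l" using n unfolding x_def[symmetric] by (auto simp: order.order_iff_strict)
  have pos: "cmod (\<gamma> x - \<gamma> ?s) > 0" using chord_pos(1)[OF xs] by simp
  have "t *\<^sub>R (T ?s * cis (snd z)) = cmod (\<gamma> x - \<gamma> ?s) *\<^sub>R (T ?s * cis (departure ?s x))"
    by (rule trans[OF _ chord_cis(1)[OF xs]]) (simp add: eq(1))
  then have "snd z = departure ?s x"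
    using polar_unique[OF st(5) pos] st(3) \<alpha>(1) angles_in(1)[OF xs] Tnz by blast
  then have xi: "x = ?s'" using impact_eqI[OF xs] by (metis prod.collapse)
  have "t *\<^sub>R (T x * cis (- \<alpha>')) = cmod (\<gamma> x - \<gamma> ?s) *\<^sub>R (T x * cis (- arrival ?s x))"
    by (rule trans[OF _ chord_cis(2)[OF xs]]) (simp add: eq(1) flip: eq(2))
  then have "cnj (t *\<^sub>R (T x * cis (- \<alpha>'))) = cnj (cmod (\<gamma> x - \<gamma> ?s) *\<^sub>R (T x * cis (- arrival ?s x)))"
    by simp
  then have "t *\<^sub>R (cnj (T x) * cis \<alpha>') = cmod (\<gamma> x - \<gamma> ?s) *\<^sub>R (cnj (T x) * cis (arrival ?s x))"
    by (simp add: cis_cnj del: complex_cnj_diff)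
  then have "\<alpha>' = arrival ?s x"
    using polar_unique[OF st(5) pos st(4) angles_in(2)[OF xs], of "cnj (T x)"] Tnz by simp
  then show "y = proj (step z)" using st(2) x(1) xi by (simp add: proj_def step_def)
qed

lemma billiard_map_proj: "z \<in> strip \<Longrightarrow> billiard_map \<gamma> (proj z) = proj (step z)"
  unfolding billiard_map_def by (rule the_equality) (simp_all add: billiard_step_iff)

lemma step_pow_in_strip: "z \<in> strip \<Longrightarrow> (step ^^ n) z \<in> strip"
  by (induction n) (auto simp: step_in_strip)

lemma billiard_map_pow_proj: "z \<in> strip \<Longrightarrow> (billiard_map \<gamma> ^^ n) (proj z) = proj ((step ^^ n) z)"
  by (induction n) (auto simp: billiard_map_proj step_pow_in_strip)

lemma proj_eq_iff: "proj z = proj w \<longleftrightarrow> (\<exists>n::int. w = z + (of_int n * l, 0))"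
  using curve_eq_iff[of "fst z" "fst w"] by (auto simp: proj_def prod_eq_iff)

lemma proj_strip: "proj ` strip = phase_cylinder \<gamma>"
  unfolding proj_def strip_def phase_cylinder_def by (force simp: image_iff)

lemma step_shift:
  assumes a: "\<And>x. \<gamma> (x + a) = \<zeta> * \<gamma> x" "cmod \<zeta> = 1" and z: "z \<in> strip"
  shows "step (z + (a, 0)) = step z + (a, 0)"
proof -
  have \<zeta>: "\<zeta> * cnj \<zeta> = 1" using a(2) by (simp add: complex_norm_square[symmetric])
  have 1: "departure (s + a) (s' + a) = departure s s'" for s s'
  proof -
    have "cnj (\<zeta> * T s) * (\<zeta> * \<gamma> s' - \<zeta> * \<gamma> s) = (\<zeta> * cnj \<zeta>) * (cnj (T s) * (\<gamma> s' - \<gamma> s))"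
      by (simp add: algebra_simps)
    then have "cnj (\<zeta> * T s) * (\<zeta> * \<gamma> s' - \<zeta> * \<gamma> s) = cnj (T s) * (\<gamma> s' - \<gamma> s)" unfolding \<zeta> mult_1 .
    then show ?thesis unfolding departure_def a(1) T_shift[OF a(1)] by (rule arg_cong)
  qed
  have 2: "arrival (s + a) (s' + a) = arrival s s'" for s s'
  proof -
    have "\<zeta> * T s' * cnj (\<zeta> * \<gamma> s' - \<zeta> * \<gamma> s) = (\<zeta> * cnj \<zeta>) * (T s' * cnj (\<gamma> s' - \<gamma> s))"
      by (simp add: algebra_simps)
    then have "\<zeta> * T s' * cnj (\<zeta> * \<gamma> s' - \<zeta> * \<gamma> s) = T s' * cnj (\<gamma> s' - \<gamma> s)" unfolding \<zeta> mult_1 .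
    then show ?thesis unfolding arrival_def a(1) T_shift[OF a(1)] by (rule arg_cong)
  qed
  have "impact (fst z + a, departure (fst z + a) (impact z + a)) = impact z + a"
    using impact[OF z] by (intro impact_eqI) auto
  then have "impact (z + (a, 0)) = impact z + a"
    unfolding 1 impact(3)[OF z] by (simp add: plus_prod_def)
  then show ?thesis by (simp add: step_def 2 plus_prod_def)
qed

lemma shift_in_strip: "z + (a, 0) \<in> strip \<longleftrightarrow> z \<in> strip"
  by (simp add: strip_def plus_prod_def mem_Times_iff)

lemma step_pow_shift:
  assumes a: "\<And>x. \<gamma> (x + a) = \<zeta> * \<gamma> x" "cmod \<zeta> = 1" and z: "z \<in> strip"
  shows "(step ^^ n) (z + (a, 0)) = (step ^^ n) z + (a, 0)"
  by (induction n) (simp_all add: step_shift[OF a] step_pow_in_strip z)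

lemma step_pow_period: "z \<in> strip \<Longrightarrow> (step ^^ n) (z + (of_int m * l, 0)) = (step ^^ n) z + (of_int m * l, 0)"
  by (rule step_pow_shift[where \<zeta> = 1]) (simp_all add: periodic_int)

lemma open_strip: "open strip"
  unfolding strip_def by (intro open_Times) auto

text \<open>
  The map is \<open>(s, s') \<mapsto> (s', arrival s s')\<close> after the inverse of
  \<open>(s, s') \<mapsto> (s, departure s s')\<close>. With \<open>d\<close> the length of the chord, these two have determinants
  \<open>sin \<alpha> / d\<close> and \<open>sin \<alpha>' / d\<close>. Hence the quotient, and the area
  \<open>sin \<alpha> d\<alpha> ds\<close> is invariant.
\<close>

lemma step_deriv:
  assumes z: "z \<in> strip"
  shows "\<exists>D. (step has_derivative D) (at z) \<and> det2 D = sin (snd z) / sin (snd (step z))"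
proof -
  define s s' where "s = fst z" and "s' = impact z"
  have ss: "s < s'" "s' < s + l" "departure s s' = snd z" using impact[OF z] by (auto simp: s_def s'_def)
  let ?c = "cmod (\<gamma> s' - \<gamma> s)"
  have c: "?c > 0" using chord_pos(1)[OF ss(1,2)] by simp
  define p where "p = sin (arrival s s') / ?c"
  have sn: "sin (arrival s s') > 0" "sin (departure s s') > 0"
     using angles_in[OF ss(1,2)] by (auto simp: sin_gt_zero)
  have p: "p > 0" using sn c by (simp add: p_def)
  obtain a where a: "((\<lambda>(s, s'). departure s s') has_derivative (\<lambda>(h, h'). a * h + p * h')) (at (s, s'))"
    using angle_derivatives(1)[OF ss(1,2)] unfolding p_def by blast
  obtain b where b: "((\<lambda>(s, s'). arrival s s') has_derivative (\<lambda>(h, h'). - (sin (departure s s') / ?c) * h + b * h')) (at (s, s'))"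
    using angle_derivatives(2)[OF ss(1,2)] by blast
  define S where "S = {q :: real \<times> real. fst q < snd q \<and> snd q < fst q + l}"
  define \<Psi> where "\<Psi> q = (fst q, departure (fst q) (snd q))" for q
  have "open S" unfolding S_def
    by (intro open_Collect_conj open_Collect_less continuous_intros)
  have cont: "continuous_on S \<Psi>"
  proof (rule continuous_at_imp_continuous_on, rule ballI)
    fix q assume "q \<in> S"
    then have q: "fst q < snd q" "snd q < fst q + l" by (auto simp: S_def)
    then have "isCont (\<lambda>(s, s'). departure s s') (fst q, snd q)"
      using angle_derivatives(1) has_derivative_continuous by blast
    then show "isCont \<Psi> q" unfolding \<Psi>_def case_prod_beta' by (auto intro!: continuous_intros)
  qed
  have inv: "(fst (\<Psi> q), impact (\<Psi> q)) = q" if "q \<in> S" for q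
    using impact_eqI[of "fst q" "snd q"] that by (auto simp: S_def \<Psi>_def)
  have "(\<Psi> has_derivative (\<lambda>h. (fst h, a * fst h + p * snd h))) (at (s, s'))"
    using a unfolding \<Psi>_def case_prod_beta' by (auto intro!: has_derivative_Pair derivative_eq_intros)
  moreover have "(\<lambda>h. (fst h, a * fst h + p * snd h)) \<circ> (\<lambda>h. (fst h, (snd h - a * fst h) / p)) = id"
    using p by (auto simp: fun_eq_iff)
  ultimately have "((\<lambda>q. (fst q, impact q)) has_derivative (\<lambda>h. (fst h, (snd h - a * fst h) / p))) (at (\<Psi> (s, s')))"
    using has_derivative_inverse_strong[OF \<open>open S\<close> _ cont inv, of "(s, s')"] ss by (auto simp: S_def)
  moreover have "\<Psi> (s, s') = z" using ss by (simp add: \<Psi>_def s_def)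
  ultimately have i: "((\<lambda>q. (fst q, impact q)) has_derivative (\<lambda>h. (fst h, (snd h - a * fst h) / p))) (at z)" by simp
  have r: "((\<lambda>q. (snd q, arrival (fst q) (snd q))) has_derivative (\<lambda>h. (snd h, - (sin (departure s s') / ?c) * fst h + b * snd h))) (at (s, s'))"
    using b unfolding case_prod_beta' by (auto intro!: has_derivative_Pair derivative_eq_intros)
  have "(fst z, impact z) = (s, s')" by (simp add: s_def s'_def)
  from has_derivative_compose[OF i r[folded this]]
  have "(step has_derivative (\<lambda>h. ((snd h - a * fst h) / p, - (sin (departure s s') / ?c) * fst h + b * ((snd h - a * fst h) / p)))) (at z)"
    unfolding step_def[abs_def] fst_conv snd_conv .
  moreover have "det2 (\<lambda>h. ((snd h - a * fst h) / p, - (sin (departure s s') / ?c) * fst h + b * ((snd h - a * fst h) / p)))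
      = sin (departure s s') / ?c / p"
    using p c by (simp add: det2_def field_simps)
  moreover have "sin (departure s s') / ?c / p = sin (snd z) / sin (snd (step z))"
    using c ss(3) sn by (simp add: p_def snd_step s_def[symmetric] s'_def[symmetric])
  ultimately show ?thesis by (intro exI conjI) (assumption, simp only:)
qed

section \<open>Lifting essential curves\<close>

lemma circle_coordinate:
  obtains E where "continuous_on (range \<gamma>) E" "\<And>s. E (\<gamma> s) = cis (2 * pi * s / l)"
proof -
  define E where "E z = cis (2 * pi * (SOME s. \<gamma> s = z) / l)" for z
  have E: "E (\<gamma> s) = cis (2 * pi * s / l)" for s
  proof -
    define s0 where "s0 = (SOME s'. \<gamma> s' = \<gamma> s)"
    have "\<gamma> s0 = \<gamma> s" unfolding s0_def by (rule someI[of _ s]) simp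
    then obtain n :: int where "s = s0 + of_int n * l"
      using curve_eq_iff by blast
    then have "2 * pi * s0 / l = 2 * pi * s / l + 2 * pi * of_int (- n)"
      using l_pos by (simp add: field_simps)
    then show ?thesis unfolding E_def s0_def[symmetric] cis_eq_cis_iff by blast
  qed
  have range: "range \<gamma> = \<gamma> ` {0..l}"
  proof -
    have "\<gamma> s \<in> \<gamma> ` {0..l}" for s
    proof -
      obtain n where "0 \<le> s + of_int n * l" "s + of_int n * l < 0 + l" by (rule reduce_mod)
      then have "\<gamma> (s + of_int n * l) \<in> \<gamma> ` {0..l}" by auto
      then show ?thesis by (simp add: periodic_int)
    qed
    then show ?thesis by auto
  qed
  have "compact (range \<gamma>)" unfolding range by (intro compact_continuous_image continuous_curve) auto
  have "closed (E -` C \<inter> range \<gamma>)" if "closed C" for C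
  proof -
    have "E -` C \<inter> range \<gamma> = \<gamma> ` ((\<lambda>s. cis (2 * pi * s / l)) -` C \<inter> {0..l})"
      unfolding range using E by auto
    moreover have "compact ((\<lambda>s. cis (2 * pi * s / l)) -` C \<inter> {0..l})"
      by (intro closed_Int_compact closed_vimage[OF that] continuous_intros) (use l_pos in auto)
    ultimately show ?thesis by (metis compact_continuous_image compact_imp_closed continuous_curve)
  qed
  then have "continuous_on (range \<gamma>) E"
    using continuous_on_closed_vimage[OF compact_imp_closed[OF \<open>compact (range \<gamma>)\<close>]] by blast
  then show ?thesis using E that by blast
qed

text \<open>
  The circle coordinate turns the problem into lifting a map to the unit circle, that is, into
  finding a continuous logarithm on the line.
\<close>

lemma curve_lift:
  fixes p :: "real \<Rightarrow> complex"
  assumes "continuous_on UNIV p" "range p \<subseteq> range \<gamma>"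
  obtains X where "continuous_on UNIV X" "\<And>t. \<gamma> (X t) = p t"
proof -
  obtain E where E: "continuous_on (range \<gamma>) E" "\<And>s. E (\<gamma> s) = cis (2 * pi * s / l)"
    by (rule circle_coordinate) blast
  have nE: "norm (E (p t)) = 1" for t using assms(2) E(2) by (metis norm_cis rangeE rangeI subsetD)
  have "continuous_on UNIV (\<lambda>t. E (p t))"
    by (rule continuous_on_compose2[OF E(1) assms])
  moreover have "contractible (UNIV :: real set)" by (simp add: convex_imp_contractible)
  ultimately obtain g where g: "continuous_on UNIV g" "\<And>t. E (p t) = exp (g t)"
    using continuous_logarithm_on_contractible[of UNIV "\<lambda>t. E (p t)"] nE
    by (metis UNIV_I norm_zero zero_neq_one)
  show ?thesis
  proof
    show "continuous_on UNIV (\<lambda>t. l * Im (g t) / (2 * pi))" by (intro continuous_intros g(1)) auto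
    fix t
    have "Re (g t) = 0" using nE[of t] by (simp add: g(2))
    then have "exp (g t) = cis (Im (g t))" by (simp add: exp_eq_polar)
    moreover obtain s where s: "p t = \<gamma> s" using assms(2) by blast
    ultimately have "cis (Im (g t)) = cis (2 * pi * s / l)" using E(2) g(2) by metis
    then obtain n :: int where "Im (g t) = 2 * pi * s / l + 2 * pi * of_int n"
      using cis_eq_cis_iff by blast
    then have "l * Im (g t) / (2 * pi) = s + of_int n * l" using l_pos by (simp add: field_simps)
    then show "\<gamma> (l * Im (g t) / (2 * pi)) = p t" using s by (simp add: periodic_int)
  qed
qed

text \<open>
  The line \<open>c\<close> covers the closed curve \<open>L\<close>. The condition on \<open>c (t + 1)\<close> says that \<open>L\<close> winds once
  around the cylinder and fixes the direction in which it is traversed.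
\<close>

definition lifts :: "(real \<Rightarrow> real \<times> real) \<Rightarrow> (complex \<times> real) set \<Rightarrow> bool" where
  "lifts c L \<longleftrightarrow> continuous_on UNIV c \<and> (\<forall>t. c (t + 1) = c t + (l, 0)) \<and> inj c \<and>
     range c \<subseteq> strip \<and> proj ` range c = L"

lemma continuous_proj: "continuous_on S proj"
  unfolding proj_def by (intro continuous_intros continuous_on_compose2[OF continuous_curve[of UNIV]]) auto

lemma integer_multiple_constant:
  fixes f :: "real \<Rightarrow> real"
  assumes "continuous_on UNIV f" "\<And>t. \<exists>n::int. f t = of_int n * l"
  obtains n :: int where "\<And>t. f t = of_int n * l"
proof -
  have "f constant_on UNIV"
  proof (rule continuous_discrete_range_constant)
    fix x :: real
    have "l \<le> norm (f y - f x)" if ne: "f y \<noteq> f x" for y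
    proof -
      obtain n m :: int where "f x = of_int n * l" "f y = of_int m * l" using assms(2) by metis
      then have "f y - f x = of_int (m - n) * l" "m - n \<noteq> 0" using ne by (auto simp: algebra_simps)
      then show ?thesis using l_pos by (simp add: abs_mult)
    qed
    then show "\<exists>e>0. \<forall>y. y \<in> UNIV \<and> f y \<noteq> f x \<longrightarrow> e \<le> norm (f y - f x)" using l_pos by blast
  qed (use assms in auto)
  then show ?thesis using assms(2) that unfolding constant_on_def by (metis UNIV_I)
qed

text \<open>
  The map \<open>(\<gamma> s, \<alpha>) \<mapsto> exp (\<alpha> + 2 * pi * \<i> * s / l)\<close> embeds the cylinder in the punctured plane. There
  a simple closed curve has winding number \<open>-1\<close>, \<open>0\<close> or \<open>1\<close> around the puncture, and this number is
  the degree \<open>n\<close> of its lift. Degree \<open>0\<close> is impossible because the lift would be a loop in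
  the strip, which is convex. Degree \<open>-1\<close> is turned into degree \<open>1\<close> by reversal.
\<close>

lemma essential_curve_lifts:
  assumes "rotational_invariant_curve \<gamma> L"
  obtains c where "lifts c L"
proof -
  obtain c where c: "simple_path c" "pathfinish c = pathstart c" "path_image c = L" "L \<subseteq> phase_cylinder \<gamma>"
    "\<And>a. \<not> homotopic_loops (phase_cylinder \<gamma>) c (\<lambda>t. a)"
    using assms unfolding rotational_invariant_curve_def by auto
  obtain p where p: "continuous_on UNIV p" "\<And>t. p (t + 1) = p t" "\<And>t. t \<in> {0..1} \<Longrightarrow> p t = c t"
    using loop_periodic_extension[OF simple_path_imp_path[OF c(1)] c(2)] by metis
  have p_reduce: "\<exists>u\<in>{0..<1}. \<exists>n::int. t = u + of_int n" for t :: real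
    by (rule bexI[of _ "frac t"], rule exI[of _ "\<lfloor>t\<rfloor>"]) (auto simp: frac_def frac_lt_1, linarith+)
  have p_int: "p (t + of_int n) = p t" for t and n :: int
    using int_translates[of p 1 0 t n] p(2) by simp
  have range_p: "range p = L"
  proof -
    have "p t \<in> L" for t
    proof -
      obtain u n where "u \<in> {0..<1}" "t = u + of_int n" using p_reduce by blast
      then have "p t = c u" "u \<in> {0..1}" using p_int p(3) by auto
      then show ?thesis using c(3) by (auto simp: path_image_def)
    qed
    moreover have "L \<subseteq> range p" unfolding c(3)[symmetric] path_image_def using p(3) by (metis image_subset_iff rangeI)
    ultimately show ?thesis by blast
  qed
  have p_inj: "\<exists>n::int. t' = t + of_int n" if eq: "p t = p t'" for t t'
  proof -
    obtain u n where u: "u \<in> {0..<1}" "t = u + of_int n" using p_reduce by blast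
    obtain v m where v: "v \<in> {0..<1}" "t' = v + of_int m" using p_reduce by blast
    have "c u = c v" using eq u v p_int p(3) by simp
    then have "u = v" using c(1) u v unfolding simple_path_def loop_free_def by fastforce
    then show ?thesis using u v by (intro exI[of _ "m - n"]) simp
  qed
  have "continuous_on UNIV (\<lambda>t. fst (p t))" by (intro continuous_intros p(1))
  moreover have pc: "p t \<in> phase_cylinder \<gamma>" for t using range_p c(4) by blast
  moreover have "range (\<lambda>t. fst (p t)) \<subseteq> range \<gamma>" using pc unfolding phase_cylinder_def by (auto simp: mem_Times_iff)
  ultimately obtain X where X: "continuous_on UNIV X" "\<And>t. \<gamma> (X t) = fst (p t)"
    using curve_lift[of "\<lambda>t. fst (p t)"] by metis
  define b where "b t = (X t, snd (p t))" for t
  have b: "continuous_on UNIV b" "\<And>t. proj (b t) = p t" "\<And>t. b t \<in> strip"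
    using pc X p(1) by (auto simp: b_def proj_def strip_def phase_cylinder_def mem_Times_iff intro!: continuous_intros)
  have "\<exists>n::int. X (t + 1) - X t = of_int n * l" for t
  proof -
    have "\<gamma> (X t) = \<gamma> (X (t + 1))" using X(2) p(2) by simp
    then show ?thesis by (auto simp: curve_eq_iff)
  qed
  moreover have "continuous_on UNIV (\<lambda>t. X (t + 1) - X t)"
    by (intro continuous_intros X(1) continuous_on_compose2[OF X(1)]) auto
  ultimately obtain n where n: "\<And>t. X (t + 1) - X t = of_int n * l"
    using integer_multiple_constant[of "\<lambda>t. X (t + 1) - X t"] by blast
  \<comment> \<open>A logarithm of the loop seen in the punctured plane.\<close>
  define q where "q t = Complex (snd (p t)) (2 * pi * X t / l)" for t
  have q_inj: "\<exists>n::int. t' = t + of_int n" if "exp (q t) = exp (q t')" for t t'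
  proof -
    have "norm (exp (q t)) = norm (exp (q t'))" using that by simp
    then have snd: "snd (p t) = snd (p t')" by (simp add: q_def norm_exp_eq_Re)
    then have "cis (2 * pi * X t / l) = cis (2 * pi * X t' / l)"
      using that by (simp add: q_def exp_eq_polar)
    then obtain m :: int where "2 * pi * X t / l = 2 * pi * X t' / l + 2 * pi * of_int m"
      using cis_eq_cis_iff by blast
    then have "2 * pi * X t = 2 * pi * (X t' + of_int m * l)" using l_pos by (simp add: field_simps)
    then have "X t = X t' + of_int m * l" by simp
    then have "\<gamma> (X t') = \<gamma> (X t)" by (simp add: periodic_int)
    then have "p t = p t'" using snd X(2) by (simp add: prod_eq_iff)
    then show ?thesis by (rule p_inj)
  qed
  have q_cont: "continuous_on S q" for S
    unfolding q_def by (intro continuous_intros continuous_on_subset[OF X(1)] continuous_on_subset[OF p(1)]) (use l_pos in auto)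
  have "n \<in> {-1, 0, 1}"
  proof -
    have path: "path q" using q_cont by (simp add: path_def)
    have "loop_free (exp \<circ> q)"
      unfolding loop_free_def
    proof (intro ballI impI)
      fix x y :: real assume xy: "x \<in> {0..1}" "y \<in> {0..1}" "(exp \<circ> q) x = (exp \<circ> q) y"
      then obtain m :: int where "y = x + of_int m" using q_inj by auto
      moreover from this have "m \<in> {-1, 0, 1}" using xy by auto
      ultimately show "x = y \<or> x = 0 \<and> y = 1 \<or> x = 1 \<and> y = 0" using xy by auto
    qed
    then have sp: "simple_path (exp \<circ> q)"
      using path by (simp add: simple_path_def path_continuous_image continuous_on_exp)
    have q01: "q 1 - q 0 = of_int n * (2 * pi * \<i>)"
      using n[of 0] p(2)[of 0] l_pos by (simp add: q_def complex_eq_iff field_simps)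
    have "exp (q 1) = exp (q 0) * exp (of_int n * (2 * pi * \<i>))"
      unfolding q01[symmetric] by (simp flip: exp_add)
    also have "exp (of_int n * (2 * pi * \<i>)) = 1"
      unfolding exp_eq_1 by auto
    finally have "pathfinish (exp \<circ> q) = pathstart (exp \<circ> q)"
      by (simp add: pathfinish_def pathstart_def)
    then have "winding_number (exp \<circ> q) 0 \<in> {-1, 0, 1}"
      by (intro simple_closed_path_winding_number_cases sp) (auto simp: path_image_def)
    moreover have "winding_number (exp \<circ> q) 0 = of_int n"
      unfolding winding_number_compose_exp[OF path] using q01 by (simp add: pathfinish_def pathstart_def)
    ultimately have "(of_int n :: complex) \<in> {of_int (-1), of_int 0, of_int 1}" by simp
    then show ?thesis unfolding insert_iff of_int_eq_iff by simp
  qed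
  moreover have "n \<noteq> 0"
  proof
    assume "n = 0"
    then have loop: "pathfinish b = pathstart b"
      using n[of 0] p(2)[of 0] by (simp add: pathfinish_def pathstart_def b_def)
    have "path b" using b(1) by (auto simp: path_def intro: continuous_on_subset)
    have "convex strip" unfolding strip_def by (intro convex_Times) auto
    then have "closed_segment (b t) (b 0) \<subseteq> strip" for t
      using b(3) by (simp add: closed_segment_subset)
    then have "homotopic_loops strip b (\<lambda>t. b 0)"
      using \<open>path b\<close> loop by (intro homotopic_loops_linear) (auto simp: path_def pathfinish_def pathstart_def)
    then have "homotopic_loops (phase_cylinder \<gamma>) (proj \<circ> b) (proj \<circ> (\<lambda>t. b 0))"
      using proj_strip by (intro homotopic_loops_continuous_image[where S = strip] continuous_proj) auto
    moreover have "homotopic_loops (phase_cylinder \<gamma>) c (proj \<circ> b)"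
      by (rule homotopic_loops_eq) (use c b p in \<open>auto simp: simple_path_imp_path\<close>)
    ultimately have "homotopic_loops (phase_cylinder \<gamma>) c (\<lambda>t. proj (b 0))"
      using homotopic_loops_trans by (fastforce simp: o_def)
    then show False using c(5) by blast
  qed
  ultimately have n_sq: "of_int n * of_int n = (1 :: real)" by auto
  \<comment> \<open>Now \<open>n\<close> is \<open>1\<close> or \<open>-1\<close>; multiplication by it reverses the curve in the second case.\<close>
  define \<beta> where "\<beta> t = b (of_int n * t)" for t
  have X_int: "X (t + of_int n) = X t + l" for t
  proof -
    have "n = 1 \<or> n = -1" using \<open>n \<in> {-1, 0, 1}\<close> \<open>n \<noteq> 0\<close> by auto
    then show ?thesis using n[of t] n[of "t - 1"] by auto
  qed
  have "lifts \<beta> L"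
    unfolding lifts_def
  proof (intro conjI allI)
    show "continuous_on UNIV \<beta>" unfolding \<beta>_def
      by (rule continuous_on_compose2[OF b(1)]) (auto intro!: continuous_intros)
    show \<beta>1: "\<beta> (t + 1) = \<beta> t + (l, 0)" for t
      by (simp add: \<beta>_def b_def distrib_left X_int p_int)
    have \<beta>_int: "fst (\<beta> (t + of_int m)) = fst (\<beta> t) + of_int m * l" for t and m :: int
      using int_translates[of "\<lambda>t. fst (\<beta> t)" 1 l t m] \<beta>1 by simp
    show "inj \<beta>"
    proof (rule injI)
      fix t t' assume eq: "\<beta> t = \<beta> t'"
      then have "p (of_int n * t) = p (of_int n * t')" using b(2) unfolding \<beta>_def by metis
      then obtain m :: int where "of_int n * t' = of_int n * t + of_int m" using p_inj by blast
      then have "of_int n * (of_int n * t') = of_int n * (of_int n * t + of_int m)" by simp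
      then have t': "t' = t + of_int (n * m)" using n_sq by (simp add: distrib_left mult.assoc[symmetric])
      then have "of_int (n * m) * l = 0" using \<beta>_int[of t "n * m"] eq by simp
      then show "t = t'" using t' l_pos by simp
    qed
    show "range \<beta> \<subseteq> strip" using b(3) by (auto simp: \<beta>_def)
    have "p t = proj (\<beta> (of_int n * t))" for t
      using n_sq b(2) by (simp add: \<beta>_def mult.assoc[symmetric])
    then have "L \<subseteq> proj ` range \<beta>" unfolding range_p[symmetric] by blast
    then show "proj ` range \<beta> = L" unfolding range_p[symmetric] \<beta>_def using b(2) by auto
  qed
  then show ?thesis by (rule that)
qed

lemma continuous_step: "continuous_on strip step"
  using step_deriv by (intro continuous_at_imp_continuous_on) (blast intro: has_derivative_continuous)

lemma continuous_step_pow: "continuous_on strip (step ^^ n)"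
proof (induction n)
  case (Suc n)
  show ?case unfolding funpow.simps
    by (rule continuous_on_compose[OF Suc continuous_on_subset[OF continuous_step]])
       (use step_pow_in_strip in auto)
qed (simp add: id_def)

lemma step_inj:
  assumes "z \<in> strip" "w \<in> strip" "step z = step w"
  shows "z = w"
proof -
  note z = impact[OF assms(1)] and w = impact[OF assms(2)]
  have i: "impact z = impact w" "arrival (fst z) (impact z) = arrival (fst w) (impact z)"
    using assms(3) by (auto simp: step_def)
  have "fst z = fst w"
    using arrival_antimono[of "impact z" "fst z" "fst w"] arrival_antimono[of "impact z" "fst w" "fst z"]
      z w i by (cases "fst z" "fst w" rule: linorder_cases) auto
  then show ?thesis using z(3) w(3) i(1) by (simp add: prod_eq_iff)
qed

lemma step_pow_inj:
  assumes "z \<in> strip" "w \<in> strip" "(step ^^ n) z = (step ^^ n) w"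
  shows "z = w"
  using assms(3) by (induction n) (auto dest: step_inj[OF step_pow_in_strip[OF assms(1)] step_pow_in_strip[OF assms(2)]])

lemma liftsD:
  assumes "lifts c L"
  shows "continuous_on S c" "c (t + 1) = c t + (l, 0)" "inj c" "c t \<in> strip" "proj (c t) \<in> L"
  using assms continuous_on_subset unfolding lifts_def by blast+

lemma lifts_int:
  assumes "lifts c L"
  shows "c (t + of_int n) = c t + (of_int n * l, 0)"
  using int_translates[of c 1 "(l, 0)" t n] liftsD(2)[OF assms] by simp

lemma lifts_range:
  assumes "lifts c L" "z \<in> strip" "proj z \<in> L"
  shows "z \<in> range c"
proof -
  obtain t where "proj (c t) = proj z" using assms unfolding lifts_def by fastforce
  then obtain n :: int where "z = c t + (of_int n * l, 0)" using proj_eq_iff by blast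
  then show ?thesis using lifts_int[OF assms(1)] by (metis rangeI)
qed

text \<open>
  Periodicity bounds the deviation of the lift from uniform motion. It makes the lift proper, and it
  lets the rotation number be computed in the parameter of the lift.
\<close>

lemma lifts_displacement:
  assumes "lifts c L"
  obtains M where "\<And>t. \<bar>fst (c t) - l * t\<bar> \<le> M"
proof -
  have "compact ((\<lambda>t. fst (c t) - l * t) ` {0..1})"
    by (intro compact_continuous_image continuous_intros liftsD(1)[OF assms]) auto
  from compact_imp_bounded[OF this] obtain M
    where "\<forall>y\<in>(\<lambda>t. fst (c t) - l * t) ` {0..1}. norm y \<le> M" unfolding bounded_iff by blast
  then have M: "\<bar>fst (c t) - l * t\<bar> \<le> M" if "t \<in> {0..1}" for t using that by auto
  show ?thesis
  proof
    fix t
    have "c t = c (frac t + of_int \<lfloor>t\<rfloor>)" by (simp add: frac_def)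
    then have "fst (c t) = fst (c (frac t)) + of_int \<lfloor>t\<rfloor> * l" using lifts_int[OF assms] by simp
    then have "fst (c t) - l * t = fst (c (frac t)) - l * frac t" by (simp add: frac_def algebra_simps)
    moreover have "frac t \<in> {0..1}" using frac_lt_1[of t] by simp
    ultimately show "\<bar>fst (c t) - l * t\<bar> \<le> M" using M by simp
  qed
qed

lemma lifts_closed:
  assumes c: "lifts c L" and S: "closed S"
  shows "closed (c ` S)"
  unfolding closed_sequential_limits
proof (intro allI impI, elim conjE)
  fix x p assume x: "\<forall>n. x n \<in> c ` S" and lim: "x \<longlonglongrightarrow> p"
  then have "\<forall>n. \<exists>t\<in>S. c t = x n" by (simp add: image_iff) metis
  then obtain t where t: "\<And>n. t n \<in> S" "\<And>n. c (t n) = x n" by metis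
  obtain M where M: "\<And>t. \<bar>fst (c t) - l * t\<bar> \<le> M" using lifts_displacement[OF c] by blast
  have "bounded (range x)" using lim convergent_imp_bounded by blast
  then obtain K where K: "\<And>n. norm (x n) \<le> K" unfolding bounded_iff by auto
  have "\<bar>t n\<bar> \<le> (K + M) / l" for n
  proof -
    have "\<bar>fst (c (t n))\<bar> \<le> K" using K[of n] norm_fst_le[of "fst (x n)" "snd (x n)"] t(2)[of n] by simp
    then have "\<bar>l * t n\<bar> \<le> K + M" using M[of "t n"] by linarith
    then show ?thesis using l_pos by (simp add: pos_le_divide_eq abs_mult mult.commute)
  qed
  then have "bounded (range t)" unfolding bounded_iff by auto
  then obtain u r where r: "strict_mono r" "(t \<circ> r) \<longlonglongrightarrow> u" using bounded_imp_convergent_subsequence by blast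
  have "u \<in> S" using S r(2) t(1) unfolding closed_sequential_limits by (metis comp_apply)
  have "isCont c u" using liftsD(1)[OF c, of UNIV] by (simp add: continuous_on_eq_continuous_at)
  from isCont_tendsto_compose[OF this r(2)]
  have "(x \<circ> r) \<longlonglongrightarrow> c u" using t(2) by (simp add: o_def)
  then have "c u = p" using LIMSEQ_subseq_LIMSEQ[OF lim r(1)] LIMSEQ_unique by blast
  then show "p \<in> c ` S" using \<open>u \<in> S\<close> by blast
qed

lemma lifts_inverse:
  assumes c: "lifts c L"
  shows "continuous_on (range c) (inv c)"
proof (rule continuous_on_inverse_closed_map)
  show "closedin (top_of_set (range c)) (c ` U)" if "closedin (top_of_set UNIV) U" for U
    using lifts_closed[OF c] that by (simp add: closed_subset image_mono)
qed (use liftsD[OF c] in auto)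

text \<open>
  Injective and continuous, the map on parameters is monotone; since it commutes with the translation
  by 1, it is increasing.
\<close>

lemma induced_map:
  assumes c: "lifts c L" and inv: "billiard_map \<gamma> ` L \<subseteq> L"
  obtains \<phi> where "continuous_on UNIV \<phi>" "strict_mono \<phi>" "\<And>t. \<phi> (t + 1) = \<phi> t + 1" "\<And>t. step (c t) = c (\<phi> t)"
proof
  define \<phi> where "\<phi> t = inv c (step (c t))" for t
  have mem: "step (c t) \<in> range c" for t
    using inv billiard_map_proj[OF liftsD(4)[OF c]] liftsD(5)[OF c]
    by (intro lifts_range[OF c] step_in_strip liftsD(4)[OF c]) (metis image_subset_iff)
  then show eq: "step (c t) = c (\<phi> t)" for t by (simp add: \<phi>_def f_inv_into_f)
  show cont: "continuous_on UNIV \<phi>" unfolding \<phi>_def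
    by (rule continuous_on_compose2[OF lifts_inverse[OF c]])
       (use mem in \<open>auto intro!: continuous_on_compose2[OF continuous_step liftsD(1)[OF c]] liftsD(4)[OF c]\<close>)
  show plus1: "\<phi> (t + 1) = \<phi> t + 1" for t
  proof -
    have "c (\<phi> (t + 1)) = step (c t + (of_int 1 * l, 0))" using liftsD(2)[OF c] eq by (metis mult_1 of_int_1)
    also have "\<dots> = c (\<phi> t) + (of_int 1 * l, 0)"
      using step_pow_period[OF liftsD(4)[OF c], of 1 t 1] eq by simp
    also have "\<dots> = c (\<phi> t + 1)" using liftsD(2)[OF c] by simp
    finally show ?thesis using liftsD(3)[OF c] by (simp add: inj_eq)
  qed
  have inj: "inj \<phi>"
    using eq step_inj liftsD(3,4)[OF c] by (metis injI inj_eq)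
  show "strict_mono \<phi>"
  proof (rule strict_monoI)
    fix a b :: real assume "a < b"
    define N where "N = nat \<lceil>b - a\<rceil> + 1"
    have "\<phi> (a + real n) = \<phi> a + real n" for n
      by (induction n) (use plus1 in \<open>simp_all add: add.assoc[symmetric] add.commute[of 1]\<close>)
    from this[of N] have "\<phi> a < \<phi> (a + real N)" unfolding N_def by linarith
    moreover have "b < a + real N" unfolding N_def using \<open>a < b\<close> by linarith
    ultimately show "\<phi> a < \<phi> b"
      using continuous_inj_imp_mono[OF \<open>a < b\<close> _ continuous_on_subset[OF cont subset_UNIV] inj_on_subset[OF inj subset_UNIV], of "a + real N"]
      by auto
  qed
qed

lemma induced_pow:
  assumes "lifts c L" "\<And>t. step (c t) = c (\<phi> t)"
  shows "(step ^^ n) (c t) = c ((\<phi> ^^ n) t)"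
  by (induction n) (simp_all add: assms(2))

text \<open>
  The prescribed lift \<open>\<sigma>\<close> of the orbit agrees with \<open>step\<close> because both advance by less than one
  turn. If \<open>(\<phi> ^^ k) t - t - r\<close> had no zero, it would be bounded away from \<open>0\<close> by periodicity, and the
  average displacement along the orbit would differ from \<open>r / k\<close>.
\<close>

lemma rotation_fixed_point:
  assumes c: "lifts c L" and \<phi>: "continuous_on UNIV \<phi>" "\<And>t. \<phi> (t + 1) = \<phi> t + 1" "\<And>t. step (c t) = c (\<phi> t)"
    and k: "k > 0"
    and \<sigma>: "\<And>n. \<gamma> (\<sigma> n) = fst ((billiard_map \<gamma> ^^ n) (proj (c t0)))" "\<And>n. \<sigma> n < \<sigma> (Suc n)" "\<And>n. \<sigma> (Suc n) < \<sigma> n + l"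
      "(\<lambda>n. (\<sigma> n - \<sigma> 0) / (real n * l)) \<longlonglongrightarrow> of_int r / real k"
  obtains t where "(\<phi> ^^ k) t = t + of_int r"
proof -
  define x where "x n = fst ((step ^^ n) (c t0))" for n
  have \<gamma>x: "\<gamma> (x n) = \<gamma> (\<sigma> n)" for n
    unfolding \<sigma>(1) billiard_map_pow_proj[OF liftsD(4)[OF c]] by (simp add: x_def proj_def)
  have x_step: "x n < x (Suc n)" "x (Suc n) < x n + l" for n
    using impact[OF step_pow_in_strip[OF liftsD(4)[OF c]], of n t0] by (auto simp: x_def fst_step)
  have diff: "\<sigma> n - \<sigma> 0 = x n - x 0" for n
  proof (induction n)
    case (Suc n)
    obtain m :: int where m: "\<sigma> n = x n + of_int m * l" using \<gamma>x curve_eq_iff by blast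
    obtain m' :: int where m': "\<sigma> (Suc n) = x (Suc n) + of_int m' * l" using \<gamma>x curve_eq_iff by blast
    have "\<bar>(\<sigma> (Suc n) - \<sigma> n) - (x (Suc n) - x n)\<bar> < l"
      using x_step[of n] \<sigma>(2,3)[of n] by linarith
    then have "\<bar>of_int (m' - m) * l\<bar> < 1 * l" unfolding m m' by (simp add: algebra_simps)
    then have "m' = m" using l_pos by (simp add: abs_mult)
    then show ?case using Suc m m' by simp
  qed simp
  obtain M where M: "\<And>t. \<bar>fst (c t) - l * t\<bar> \<le> M" using lifts_displacement[OF c] by blast
  have \<phi>k1: "(\<phi> ^^ n) (t + 1) = (\<phi> ^^ n) t + 1" for n t by (induction n) (simp_all add: \<phi>(2))
  have \<phi>kint: "(\<phi> ^^ n) (t + of_int m) = (\<phi> ^^ n) t + of_int m" for n t and m :: int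
    using int_translates[of "\<phi> ^^ n" 1 1 t m] \<phi>k1 by simp
  define g where "g t = (\<phi> ^^ k) t - t - of_int r" for t
  have cont_pow: "continuous_on UNIV (\<phi> ^^ n)" for n
    by (induction n) (auto simp: id_def intro: continuous_on_compose2[OF \<phi>(1)])
  have gcont: "continuous_on S g" for S unfolding g_def
    by (intro continuous_intros continuous_on_subset[OF cont_pow]) auto
  have g_per: "g t = g (frac t)" for t
  proof -
    have "t = frac t + of_int \<lfloor>t\<rfloor>" by (simp add: frac_def)
    then have "g t = g (frac t + of_int \<lfloor>t\<rfloor>)" by metis
    also have "\<dots> = g (frac t)" unfolding g_def \<phi>kint by simp
    finally show ?thesis .
  qed
  \<comment> \<open>The deviation from the rotation after \<open>n\<close> periods grows more slowly than \<open>n\<close>.\<close>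
  define D where "D n = (\<phi> ^^ (n * k)) t0 - t0 - real n * of_int r" for n
  have Dg: "D (Suc n) - D n = g ((\<phi> ^^ (n * k)) t0)" for n
    by (simp add: D_def g_def funpow_add algebra_simps)
  have lim0: "(\<lambda>n. D n / real n) \<longlonglongrightarrow> 0"
  proof -
    have "(\<lambda>n. (\<sigma> (n * k) - \<sigma> 0) / (real (n * k) * l)) \<longlonglongrightarrow> of_int r / real k"
      using filterlim_compose[OF \<sigma>(4), of "\<lambda>n. n * k"] mult_nat_right_at_top[OF k] by simp
    then have "(\<lambda>n. real k * ((\<sigma> (n * k) - \<sigma> 0) / (real (n * k) * l)) - of_int r) \<longlonglongrightarrow> real k * (of_int r / real k) - of_int r"
      by (rule tendsto_diff[OF tendsto_mult[OF tendsto_const] tendsto_const])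
    then have 1: "(\<lambda>n. real k * ((\<sigma> (n * k) - \<sigma> 0) / (real (n * k) * l)) - of_int r) \<longlonglongrightarrow> 0" using k by simp
    have "(\<lambda>n. D n / real n - (real k * ((\<sigma> (n * k) - \<sigma> 0) / (real (n * k) * l)) - of_int r)) \<longlonglongrightarrow> 0"
    proof (rule Lim_null_comparison)
      show "\<forall>\<^sub>F n in sequentially. norm (D n / real n - (real k * ((\<sigma> (n * k) - \<sigma> 0) / (real (n * k) * l)) - of_int r)) \<le> (2 * M / l) / real n"
        using eventually_gt_at_top[of 0]
      proof eventually_elim
        case (elim n)
        have "D n / real n - (real k * ((\<sigma> (n * k) - \<sigma> 0) / (real (n * k) * l)) - of_int r)
           = (l * ((\<phi> ^^ (n * k)) t0 - t0) - (x (n * k) - x 0)) / (l * real n)"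
          using elim k l_pos unfolding D_def diff by (simp add: field_simps)
        moreover have "\<bar>l * ((\<phi> ^^ (n * k)) t0 - t0) - (x (n * k) - x 0)\<bar> \<le> 2 * M"
          using M[of "(\<phi> ^^ (n * k)) t0"] M[of t0] unfolding x_def induced_pow[OF c \<phi>(3)]
          by (simp add: algebra_simps)
        ultimately show ?case using elim l_pos by (simp add: abs_mult divide_right_mono)
      qed
      show "(\<lambda>n. 2 * M / l / real n) \<longlonglongrightarrow> 0" by (rule lim_const_over_n)
    qed
    from tendsto_add[OF this 1] show ?thesis by simp
  qed
  have "\<exists>t. g t = 0"
  proof (rule ccontr)
    assume no: "\<nexists>t. g t = 0"
    have int: "connected (range g)" using gcont connected_continuous_image by blast
    have cpt: "compact (g ` {0..1})" by (intro compact_continuous_image gcont) auto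
    have frac: "g t \<in> g ` {0..1}" for t
      using g_per[of t] frac_lt_1[of t] by (intro image_eqI[of _ _ "frac t"]) auto
    have "(\<forall>t. 0 < g t) \<or> (\<forall>t. g t < 0)"
    proof (rule ccontr)
      assume "\<not> ?thesis"
      then obtain a b where "g a \<le> 0" "0 \<le> g b" by (meson not_less)
      then have "0 \<in> range g" using int unfolding connected_iff_interval by blast
      then show False using no by (metis rangeE)
    qed
    then consider "\<forall>t. 0 < g t" | "\<forall>t. g t < 0" by blast
    then show False
    proof cases
      case 1
      then obtain \<delta> where \<delta>: "\<delta> > 0" "\<And>t. \<delta> \<le> g t"
        using compact_attains_inf[OF cpt] frac by (metis (no_types, lifting) atLeastAtMost_iff empty_iff image_iff image_is_empty zero_less_one_class.zero_le_one)
      have "D n \<ge> real n * \<delta>" for n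
      proof (induction n)
        case (Suc n)
        then show ?case using Dg[of n] \<delta>(2)[of "(\<phi> ^^ (n * k)) t0"] by (simp add: algebra_simps)
      qed (simp add: D_def)
      then have "\<forall>n\<ge>1. \<delta> \<le> D n / real n" by (simp add: field_simps)
      then show False using LIMSEQ_le_const[OF lim0, of \<delta>] \<delta>(1) by auto
    next
      case 2
      then obtain \<delta> where \<delta>: "\<delta> < 0" "\<And>t. g t \<le> \<delta>"
        using compact_attains_sup[OF cpt] frac by (metis (no_types, lifting) atLeastAtMost_iff empty_iff image_iff image_is_empty zero_less_one_class.zero_le_one)
      have "D n \<le> real n * \<delta>" for n
      proof (induction n)
        case (Suc n)
        then show ?case using Dg[of n] \<delta>(2)[of "(\<phi> ^^ (n * k)) t0"] by (simp add: algebra_simps)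
      qed (simp add: D_def)
      then have "\<forall>n\<ge>1. D n / real n \<le> \<delta>" by (simp add: field_simps)
      then show False using LIMSEQ_le_const2[OF lim0, of \<delta>] \<delta>(1) by auto
    qed
  qed
  then obtain t where "g t = 0" by blast
  then show ?thesis by (intro that[of t]) (simp add: g_def algebra_simps)
qed

section \<open>Leaves consist of periodic points\<close>

text \<open>
  The component of \<open>L \<inter> V\<close> through a point is the full level set of \<open>snd \<circ> \<phi>\<close> through this point, because
  it is some level set and contains the point.
\<close>

lemma leaf_plaques:
  assumes V: "V \<subseteq> \<Union>F" "\<forall>L\<in>F. \<forall>P\<in>components (L \<inter> V). \<exists>c. P = {z\<in>V. snd (\<phi> z) = c}"
    and L: "L \<in> F"
  shows "connected S \<Longrightarrow> S \<subseteq> L \<inter> V \<Longrightarrow> x \<in> S \<Longrightarrow> y \<in> S \<Longrightarrow> snd (\<phi> x) = snd (\<phi> y)"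
    "x \<in> L \<inter> V \<Longrightarrow> y \<in> V \<Longrightarrow> snd (\<phi> x) = snd (\<phi> y) \<Longrightarrow> y \<in> L"
proof -
  have comp: "connected_component_set (L \<inter> V) x = {z \<in> V. snd (\<phi> z) = snd (\<phi> x)}" if x: "x \<in> L \<inter> V" for x
  proof -
    obtain c where c: "connected_component_set (L \<inter> V) x = {z \<in> V. snd (\<phi> z) = c}"
      using V(2)[rule_format, OF L componentsI[OF x]] by blast
    moreover have "x \<in> connected_component_set (L \<inter> V) x" using x by simp
    ultimately show ?thesis by auto
  qed
  show "snd (\<phi> x) = snd (\<phi> y)" if "connected S" "S \<subseteq> L \<inter> V" "x \<in> S" "y \<in> S"
  proof -
    have "x \<in> L \<inter> V" using that(2,3) by blast
    from connected_component_maximal[OF that(3,1,2), unfolded comp[OF this]] show ?thesis using that(4) by auto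
  qed
  show "y \<in> L" if "x \<in> L \<inter> V" "y \<in> V" "snd (\<phi> x) = snd (\<phi> y)"
    using comp[OF that(1)] that(2,3) connected_component_subset[of "L \<inter> V" x] by auto
qed

lemma step_pow_deriv:
  assumes z: "z \<in> strip"
  shows "\<exists>D. (step ^^ n has_derivative D) (at z) \<and> det2 D = sin (snd z) / sin (snd ((step ^^ n) z))"
proof (induction n)
  case 0
  have "sin (snd z) \<noteq> 0" using z sin_gt_zero[of "snd z"] by (auto simp: strip_def)
  then show ?case by (intro exI[of _ id]) (auto simp: det2_def id_def intro!: has_derivative_ident)
next
  case (Suc n)
  then obtain D where D: "(step ^^ n has_derivative D) (at z)" "det2 D = sin (snd z) / sin (snd ((step ^^ n) z))" by blast
  obtain E where E: "(step has_derivative E) (at ((step ^^ n) z))"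
    "det2 E = sin (snd ((step ^^ n) z)) / sin (snd (step ((step ^^ n) z)))"
    using step_deriv[OF step_pow_in_strip[OF z]] by blast
  have "(step ^^ Suc n has_derivative E \<circ> D) (at z)"
    using diff_chain_at[OF D(1) E(1)] by simp
  moreover have "det2 (E \<circ> D) = det2 E * det2 D"
    using D(1) E(1) has_derivative_linear by (intro det2_compose) blast+
  moreover have "sin (snd ((step ^^ n) z)) \<noteq> 0"
    using step_pow_in_strip[OF z, of n] sin_gt_zero[of "snd ((step ^^ n) z)"] by (auto simp: strip_def)
  ultimately show ?case using D(2) E(2) by (intro exI[of _ "E \<circ> D"]) (simp add: o_def)
qed

text \<open>
  At an accumulation point \<open>w\<close> of the intersection, closedness puts the point \<open>(u0, w)\<close> on the leaf.
  Its parameter is the limit of the parameters of nearby intersections, because the inverse of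
  the lift is continuous. So those lie in one plaque with it and have the same height.
\<close>

lemma leaf_meets_transversal_finitely:
  fixes a b u0 :: real
  assumes c: "lifts c L"
    and U': "open U'" "U' \<subseteq> strip" and hom: "homeomorphism U' V' \<Phi> G"
    and plaque: "\<And>S x y. connected S \<Longrightarrow> S \<subseteq> range c \<inter> U' \<Longrightarrow> x \<in> S \<Longrightarrow> y \<in> S \<Longrightarrow> snd (\<Phi> x) = snd (\<Phi> y)"
    and seg: "{u0} \<times> {a..b} \<subseteq> V'"
  shows "finite {v \<in> {a..b}. proj (G (u0, v)) \<in> L}" (is "finite ?S")
proof (rule ccontr)
  assume inf: "infinite ?S"
  have "\<exists>w\<in>{a..b}. w islimpt ?S"
    by (rule Heine_Borel_imp_Bolzano_Weierstrass[OF compact_Icc inf]) blast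
  then obtain w where w: "w \<in> {a..b}" "w islimpt ?S" by blast
  then obtain v where v: "\<And>n. v n \<in> ?S - {w}" "v \<longlonglongrightarrow> w" unfolding islimpt_sequential by blast
  have GU: "G (u0, x) \<in> U'" "\<Phi> (G (u0, x)) = (u0, x)" if "x \<in> {a..b}" for x
  proof -
    have "(u0, x) \<in> V'" using that seg by auto
    then show "G (u0, x) \<in> U'" "\<Phi> (G (u0, x)) = (u0, x)"
      using homeomorphism_image2[OF hom] homeomorphism_apply2[OF hom] by auto
  qed
  define y where "y n = G (u0, v n)" for n
  have y: "y n \<in> range c" for n
    using v(1)[of n] GU(1)[of "v n"] U'(2) by (intro lifts_range[OF c]) (auto simp: y_def)
  have cont: "continuous_on {a..b} (\<lambda>x. G (u0, x))"
    by (rule continuous_on_compose2[of V' G])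
       (use homeomorphism_cont2[OF hom] seg in \<open>auto intro!: continuous_intros\<close>)
  have y_lim: "y \<longlonglongrightarrow> G (u0, w)" unfolding y_def
    by (rule continuous_on_tendsto_compose[OF cont v(2) w(1)]) (use v(1) in auto)
  have "closed (range c)" by (rule lifts_closed[OF c closed_UNIV])
  then have Gw: "G (u0, w) \<in> range c" using y y_lim unfolding closed_sequential_limits by blast
  define t where "t = inv c (G (u0, w))"
  have ct: "c t = G (u0, w)" using Gw by (simp add: t_def f_inv_into_f)
  have "(\<lambda>n. inv c (y n)) \<longlonglongrightarrow> t" unfolding t_def
    by (rule continuous_on_tendsto_compose[OF lifts_inverse[OF c] y_lim Gw]) (use y in auto)
  moreover have "open (c -` U')" using U'(1) liftsD(1)[OF c, of UNIV] by (simp add: open_vimage)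
  then obtain \<eta> where \<eta>: "\<eta> > 0" "ball t \<eta> \<subseteq> c -` U'"
    using ct GU(1)[OF w(1)] open_contains_ball by (metis vimageI2)
  ultimately have "\<forall>\<^sub>F n in sequentially. inv c (y n) \<in> ball t \<eta>"
    by (intro topological_tendstoD) auto
  then obtain n where n: "inv c (y n) \<in> ball t \<eta>" using eventually_happens by fastforce
  have "snd (\<Phi> (c (inv c (y n)))) = snd (\<Phi> (c t))"
  proof (rule plaque)
    show "connected (c ` ball t \<eta>)" by (intro connected_continuous_image liftsD(1)[OF c]) simp
    show "c ` ball t \<eta> \<subseteq> range c \<inter> U'" using \<eta>(2) by auto
  qed (use n \<eta>(1) in auto)
  then have "v n = w" using y[of n] v(1)[of n] GU(2) w(1) ct by (simp add: f_inv_into_f y_def)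
  then show False using v(1)[of n] by simp
qed

text \<open>
  In a chart at a fixed point of \<open>f z = (step ^^ k) z - (r * l, 0)\<close>, this map satisfies the assumptions
  of \<open>leafwise_area_preserving_fixed\<close>: leaves are invariant, they meet the transversal \<open>u = u0\<close>
  finitely often, and the area is preserved. The orientation of the leaf is preserved since \<open>\<psi>\<close> is
  increasing.
\<close>

lemma fixed_leaf_points_open:
  assumes F: "C1_foliation \<gamma> U F" and ric: "\<And>L. L \<in> F \<Longrightarrow> rotational_invariant_curve \<gamma> L"
    and L0: "L0 \<in> F" and c: "lifts c L0"
    and \<psi>: "continuous_on UNIV \<psi>" "strict_mono \<psi>" "\<And>t. (step ^^ k) (c t) = c (\<psi> t) + (of_int r * l, 0)"
  shows "open {t. \<psi> t = t}"
  unfolding open_contains_ball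
proof (rule ballI)
  fix t1 assume "t1 \<in> {t. \<psi> t = t}"
  then have t1: "\<psi> t1 = t1" by simp
  define q where "q = c t1"
  have q: "q \<in> strip" "proj q \<in> L0" using liftsD(4,5)[OF c] by (auto simp: q_def)
  have U: "\<Union>F = U" and disj: "pairwise disjnt F"
    and charts: "\<And>x. x \<in> U \<Longrightarrow> \<exists>V \<phi>. x \<in> V \<and> V \<subseteq> U \<and> C1_chart \<gamma> V \<phi> \<and>
        (\<forall>L\<in>F. \<forall>P\<in>components (L \<inter> V). \<exists>c. P = {z\<in>V. snd (\<phi> z) = c})"
    using F unfolding C1_foliation_def by blast+
  have "proj q \<in> U" using q(2) L0 U by blast
  from charts[OF this] obtain V \<phi> where V: "proj q \<in> V" "V \<subseteq> U" "C1_chart \<gamma> V \<phi>"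
    and pl: "\<forall>L\<in>F. \<forall>P\<in>components (L \<inter> V). \<exists>c. P = {z\<in>V. snd (\<phi> z) = c}"
    by (elim exE conjE)
  note plaques = leaf_plaques[OF V(2)[folded U] pl]
  define O' where "O' = {z. proj z \<in> V}"
  define \<Phi> where "\<Phi> z = \<phi> (proj z)" for z
  have Oeq: "{(s, \<alpha>). (\<gamma> s, \<alpha>) \<in> V} = O'" by (auto simp: O'_def proj_def)
  have \<Phi>eq: "(\<lambda>(s, \<alpha>). \<phi> (\<gamma> s, \<alpha>)) = \<Phi>" by (auto simp: \<Phi>_def proj_def)
  obtain D where D: "continuous_on O' D" "\<And>p. p \<in> O' \<Longrightarrow> (\<Phi> has_derivative blinfun_apply (D p)) (at p)"
     "\<And>p. p \<in> O' \<Longrightarrow> bij (blinfun_apply (D p))"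
    and Vop: "openin (top_of_set (phase_cylinder \<gamma>)) V"
    using V(3) unfolding C1_chart_def Oeq \<Phi>eq by blast
  have Ostrip: "O' \<subseteq> strip"
    using openin_imp_subset[OF Vop] unfolding O'_def proj_def phase_cylinder_def strip_def by auto
  have "open O'"
  proof -
    obtain W where W: "open W" "V = phase_cylinder \<gamma> \<inter> W" using Vop unfolding openin_open by blast
    have "O' = strip \<inter> proj -` W"
      using Ostrip proj_strip unfolding O'_def W(2) by auto
    then show ?thesis using open_strip W(1) continuous_proj by (simp add: open_Int open_vimage)
  qed
  have qO: "q \<in> O'" using V(1) by (simp add: O'_def)
  have linD: "linear (blinfun_apply (D p))" for p
    by (rule bounded_linear.linear[OF blinfun.bounded_linear_right])
  define invf where "invf = Blinfun (inv (blinfun_apply (D q)))"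
  have "linear (inv (blinfun_apply (D q)))"
    using inj_linear_imp_inv_linear[OF linD] D(3)[OF qO] bij_is_inj by blast
  then have "blinfun_apply invf = inv (blinfun_apply (D q))"
    unfolding invf_def by (intro bounded_linear_Blinfun_apply) (simp add: linear_conv_bounded_linear)
  then have "invf o\<^sub>L D q = id_blinfun"
    using D(3)[OF qO] by (intro blinfun_eqI) (simp add: bij_is_inj)
  then obtain U' V' G g' where UV: "open U'" "U' \<subseteq> O'" "q \<in> U'" "open V'" "\<Phi> q \<in> V'" "homeomorphism U' V' \<Phi> G"
    and g': "\<And>y. y \<in> V' \<Longrightarrow> (G has_derivative g' y) (at y)" "\<And>y. y \<in> V' \<Longrightarrow> g' y = inv (blinfun_apply (D (G y)))"
    using inverse_function_theorem[OF \<open>open O'\<close> D(2,1) qO] by metis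
  have GU: "G y \<in> U'" "\<Phi> (G y) = y" if "y \<in> V'" for y
    using that homeomorphism_image2[OF UV(6)] homeomorphism_apply2[OF UV(6)] by auto
  have \<Phi>V: "\<Phi> z \<in> V'" "G (\<Phi> z) = z" if "z \<in> U'" for z
    using that homeomorphism_image1[OF UV(6)] homeomorphism_apply1[OF UV(6)] by auto
  have US: "U' \<subseteq> strip" using UV(2) Ostrip by blast
  define f where "f z = (step ^^ k) z + (of_int (- r) * l, 0)" for z
  have fc: "f (c t) = c (\<psi> t)" for t unfolding f_def \<psi>(3) by (simp add: prod_eq_iff)
  have fq: "f q = q" using fc[of t1] by (simp add: q_def t1)
  have f_proj: "proj (f z) = (billiard_map \<gamma> ^^ k) (proj z)" if "z \<in> strip" for z
  proof -
    have "proj ((step ^^ k) z) = proj (f z)" unfolding proj_eq_iff f_def by blast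
    then show ?thesis using billiard_map_pow_proj[OF that] by simp
  qed
  have f_leaf: "proj (f z) \<in> L" if L: "L \<in> F" "proj z \<in> L" "z \<in> strip" for z L
  proof -
    have "billiard_map \<gamma> ` L = L" using ric[OF L(1)] unfolding rotational_invariant_curve_def by blast
    then have "(billiard_map \<gamma> ^^ n) (proj z) \<in> L" for n by (induction n) (use L(2) in auto)
    then show ?thesis unfolding f_proj[OF L(3)] .
  qed
  have f_deriv: "\<exists>E. (f has_derivative E) (at z) \<and> det2 E = sin (snd z) / sin (snd (f z))" if z: "z \<in> strip" for z
  proof -
    obtain E where E: "(step ^^ k has_derivative E) (at z)" "det2 E = sin (snd z) / sin (snd ((step ^^ k) z))"
      using step_pow_deriv[OF z] by blast
    have "(f has_derivative E) (at z)" unfolding f_def using has_derivative_add_const[OF E(1)] by simp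
    then show ?thesis using E(2) by (auto simp: f_def)
  qed
  have f_cont: "continuous_on strip f" unfolding f_def by (intro continuous_intros continuous_step_pow)
  have G_cont: "continuous_on V' G" and \<Phi>_cont: "continuous_on U' \<Phi>" using homeomorphism_cont1[OF UV(6)] homeomorphism_cont2[OF UV(6)] by auto
  obtain u0 v0 where uv0: "\<Phi> q = (u0, v0)" by fastforce
  have fG_cont: "continuous_on V' (\<lambda>y. f (G y))"
    by (rule continuous_on_compose2[OF f_cont G_cont]) (use GU(1) US in blast)
  then have "open ((\<lambda>y. f (G y)) -` U' \<inter> V')" using UV(1,4) continuous_on_open_vimage by blast
  moreover have "(u0, v0) \<in> (\<lambda>y. f (G y)) -` U' \<inter> V'"
    using UV(3,5) uv0 \<Phi>V(2)[OF UV(3)] fq by auto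
  ultimately obtain e0 where e0: "e0 > 0" "ball (u0, v0) e0 \<subseteq> (\<lambda>y. f (G y)) -` U' \<inter> V'"
    using open_contains_ball by blast
  \<comment> \<open>Half the radius, as a square of half-width \<open>e\<close> has to fit into the ball.\<close>
  define e where "e = e0 / 2"
  have e: "e > 0" using e0(1) by (simp add: e_def)
  have box: "(u, v) \<in> V'" "f (G (u, v)) \<in> U'" if "\<bar>u - u0\<bar> < e" "\<bar>v - v0\<bar> < e" for u v
  proof -
    have "dist (u0, v0) (u, v) \<le> \<bar>u - u0\<bar> + \<bar>v - v0\<bar>"
      unfolding dist_Pair_Pair dist_real_def using sqrt_sum_squares_le_sum_abs[of "u0 - u" "v0 - v"]
      by (simp add: abs_minus_commute)
    then have "(u, v) \<in> ball (u0, v0) e0" using that by (simp add: e_def)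
    then show "(u, v) \<in> V'" "f (G (u, v)) \<in> U'" using e0(2) by auto
  qed
  define H where "H y = \<Phi> (f (G y))" for y
  \<comment> \<open>The density of the invariant area in the chart; its sign is that of the chart's orientation.\<close>
  define \<rho> where "\<rho> y = sin (snd (G y)) / det2 (blinfun_apply (D (G y)))" for y
  have sin_pos: "sin (snd z) > 0" if "z \<in> strip" for z using that by (auto simp: strip_def sin_gt_zero)
  have jD: "det2 (blinfun_apply (D (G y))) \<noteq> 0" if "y \<in> V'" for y
    using det2_inverse(2)[OF linD] D(3) GU(1)[OF that] UV(2) by blast
  have \<rho>0: "\<rho> y \<noteq> 0" if "y \<in> V'" for y
    using sin_pos[of "G y"] jD[OF that] GU(1)[OF that] US by (auto simp: \<rho>_def)
  define lab where "lab v = {L \<in> F. proj (G (u0, v)) \<in> L}" for v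
  have lab_unique: "L = M" if "L \<in> F" "M \<in> F" "x \<in> L" "x \<in> M" for L M x
    using disj that unfolding pairwise_def disjnt_def by blast
  have in_leaf: "\<exists>L\<in>F. proj z \<in> L" if "z \<in> O'" for z
    using that V(2) U unfolding O'_def by blast
  have horizontal: "snd (H (u, v)) = snd (H (u0, v))" "\<And>L. L \<in> F \<Longrightarrow> proj (G (u0, v)) \<in> L \<Longrightarrow> proj (f (G (u0, v))) \<in> L"
    if uv: "\<bar>u - u0\<bar> < e" "\<bar>v - v0\<bar> < e" for u v
  proof -
    show 2: "proj (f (G (u0, v))) \<in> L" if "L \<in> F" "proj (G (u0, v)) \<in> L" for L
      using f_leaf[OF that] GU(1)[OF box(1)[of u0 v]] uv e US by auto
    obtain L where L: "L \<in> F" "proj (G (u0, v)) \<in> L"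
      using in_leaf[of "G (u0, v)"] GU(1)[OF box(1)[of u0 v]] uv e UV(2) by auto
    let ?I = "{u0 - e<..<u0 + e}"
    let ?S = "(\<lambda>u. proj (f (G (u, v)))) ` ?I"
    have Ib: "(x, v) \<in> V'" "f (G (x, v)) \<in> U'" if "x \<in> ?I" for x using box[of x v] that uv(2) by auto
    have "connected ?S"
      by (intro connected_continuous_image continuous_on_compose2[OF continuous_proj[of UNIV]] continuous_on_compose2[OF fG_cont])
         (use Ib in \<open>auto intro!: continuous_intros\<close>)
    moreover have "?S \<subseteq> L \<inter> V"
    proof (rule image_subsetI)
      fix x assume x: "x \<in> ?I"
      have "proj (G (x, v)) \<in> L"
      proof (rule plaques(2)[OF L(1)])
        show "proj (G (u0, v)) \<in> L \<inter> V" "proj (G (x, v)) \<in> V"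
          using L(2) GU(1)[OF Ib(1)[of u0]] GU(1)[OF Ib(1)[OF x]] UV(2) e by (auto simp: O'_def)
        show "snd (\<phi> (proj (G (u0, v)))) = snd (\<phi> (proj (G (x, v))))"
          using GU(2)[OF Ib(1)[of u0]] GU(2)[OF Ib(1)[OF x]] e by (simp add: \<Phi>_def)
      qed
      then have "proj (f (G (x, v))) \<in> L" using f_leaf[OF L(1)] GU(1)[OF Ib(1)[OF x]] US by blast
      moreover have "proj (f (G (x, v))) \<in> V" using Ib(2)[OF x] UV(2) by (auto simp: O'_def)
      ultimately show "proj (f (G (x, v))) \<in> L \<inter> V" by blast
    qed
    moreover have "u \<in> ?I" "u0 \<in> ?I" using uv(1) e by auto
    ultimately have "snd (\<phi> (proj (f (G (u, v))))) = snd (\<phi> (proj (f (G (u0, v)))))"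
      using plaques(1)[OF L(1), of ?S] by blast
    then show "snd (H (u, v)) = snd (H (u0, v))" by (simp add: H_def \<Phi>_def)
  qed
  have "open (c -` U')" using UV(1) liftsD(1)[OF c, of UNIV] by (simp add: open_vimage)
  moreover have "t1 \<in> c -` U'" using UV(3) by (simp add: q_def)
  ultimately obtain \<eta> where \<eta>: "\<eta> > 0" "ball t1 \<eta> \<subseteq> c -` U'" using open_contains_ball by blast
  have "open (\<psi> -` ball t1 \<eta> \<inter> ball t1 \<eta>)" using \<psi>(1) by (simp add: open_Int open_vimage)
  moreover have "t1 \<in> \<psi> -` ball t1 \<eta> \<inter> ball t1 \<eta>" using \<eta>(1) t1 by simp
  ultimately obtain \<eta>' where \<eta>': "\<eta>' > 0" "ball t1 \<eta>' \<subseteq> \<psi> -` ball t1 \<eta> \<inter> ball t1 \<eta>"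
    using open_contains_ball by blast
  define w where "w t = fst (\<Phi> (c t))" for t
  have cU: "c t \<in> U'" if "t \<in> ball t1 \<eta>" for t using that \<eta>(2) by blast
  have level: "\<Phi> (c t) = (w t, v0)" if t: "t \<in> ball t1 \<eta>" for t
  proof -
    have "snd (\<phi> (proj (c t))) = snd (\<phi> (proj (c t1)))"
    proof (rule plaques(1)[OF L0, of "(\<lambda>t. proj (c t)) ` ball t1 \<eta>"])
      show "connected ((\<lambda>t. proj (c t)) ` ball t1 \<eta>)"
        by (intro connected_continuous_image continuous_on_compose2[OF continuous_proj[of UNIV] liftsD(1)[OF c]]) auto
      show "(\<lambda>t. proj (c t)) ` ball t1 \<eta> \<subseteq> L0 \<inter> V"
        using liftsD(5)[OF c] cU UV(2) unfolding O'_def by blast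
    qed (use t \<eta>(1) in auto)
    then have "snd (\<Phi> (c t)) = v0" using uv0 by (simp add: \<Phi>_def q_def)
    then show ?thesis by (simp add: w_def prod_eq_iff)
  qed
  have w1: "w t1 = u0" using uv0 by (simp add: w_def q_def)
  have w_cont: "continuous_on (ball t1 \<eta>) w" unfolding w_def
    by (intro continuous_intros continuous_on_compose2[OF \<Phi>_cont liftsD(1)[OF c]]) (use cU in auto)
  have w_inj: "inj_on w (ball t1 \<eta>)"
  proof (rule inj_onI)
    fix t t' assume t: "t \<in> ball t1 \<eta>" "t' \<in> ball t1 \<eta>" "w t = w t'"
    then have "\<Phi> (c t) = \<Phi> (c t')" using level by simp
    then have "c t = c t'" using \<Phi>V(2) cU t by metis
    then show "t = t'" using liftsD(3)[OF c] by (simp add: inj_eq)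
  qed
  have Hw: "H (w t, v0) = (w (\<psi> t), v0)" if t: "t \<in> ball t1 \<eta>'" for t
  proof -
    have tt: "t \<in> ball t1 \<eta>" "\<psi> t \<in> ball t1 \<eta>" using t \<eta>'(2) by blast+
    have "H (w t, v0) = \<Phi> (f (c t))" unfolding H_def level[OF tt(1), symmetric] \<Phi>V(2)[OF cU[OF tt(1)]] ..
    then show ?thesis unfolding fc level[OF tt(2)] .
  qed
  have close: "\<exists>\<epsilon>>0. \<epsilon> \<le> \<eta>' \<and> (\<forall>t\<in>ball t1 \<epsilon>. \<bar>w t - u0\<bar> < d)" if dpos: "d > 0" for d
  proof -
    have "isCont w t1" using w_cont \<eta>(1) by (simp add: continuous_on_eq_continuous_at)
    then have "\<exists>\<epsilon>>0. \<forall>t. dist t t1 < \<epsilon> \<longrightarrow> dist (w t) (w t1) < d"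
      unfolding continuous_at_eps_delta using dpos by (elim allE impE)
    then obtain \<epsilon> where "\<epsilon> > 0" "\<forall>t. dist t t1 < \<epsilon> \<longrightarrow> dist (w t) (w t1) < d" by blast
    then show ?thesis using \<eta>'(1) w1
      by (intro exI[of _ "min \<epsilon> \<eta>'"]) (auto simp: dist_real_def abs_minus_commute)
  qed
  obtain d where d: "d > 0" "\<And>u. \<bar>u - u0\<bar> < d \<Longrightarrow> H (u, v0) = (u, v0)"
  proof (rule leafwise_area_preserving_fixed[OF e, of u0 v0 H \<rho> "\<lambda>v. snd (H (u0, v))" lab])
    fix u v assume uv: "\<bar>u - u0\<bar> < e" "\<bar>v - v0\<bar> < e"
    note y = box[OF uv]
    define z where "z = G (u, v)"
    have z: "z \<in> U'" "f z \<in> U'" "z \<in> strip" using GU(1)[OF y(1)] y(2) US by (auto simp: z_def)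
    obtain E where E: "(f has_derivative E) (at z)" "det2 E = sin (snd z) / sin (snd (f z))"
      using f_deriv[OF z(3)] by blast
    have DG: "(G has_derivative inv (blinfun_apply (D z))) (at (u, v))"
      using g'[OF y(1)] by (simp add: z_def)
    have "(f \<circ> G has_derivative E \<circ> inv (blinfun_apply (D z))) (at (u, v))"
      by (rule diff_chain_at[OF DG]) (use E(1) in \<open>simp add: z_def\<close>)
    moreover have "(\<Phi> has_derivative blinfun_apply (D (f z))) (at ((f \<circ> G) (u, v)))"
      using D(2)[of "f z"] z(2) UV(2) by (auto simp: z_def)
    ultimately have "(\<Phi> \<circ> (f \<circ> G) has_derivative blinfun_apply (D (f z)) \<circ> (E \<circ> inv (blinfun_apply (D z)))) (at (u, v))"
      by (rule diff_chain_at)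
    moreover have "\<Phi> \<circ> (f \<circ> G) = H" by (simp add: H_def fun_eq_iff)
    moreover have "det2 (blinfun_apply (D (f z)) \<circ> (E \<circ> inv (blinfun_apply (D z)))) = \<rho> (u, v) / \<rho> (H (u, v))"
    proof -
      have lin: "linear E" "linear (inv (blinfun_apply (D z)))"
        using E(1) DG has_derivative_linear by blast+
      have "bij (blinfun_apply (D z))" using D(3) z(1) UV(2) by blast
      then have "det2 (blinfun_apply (D (f z)) \<circ> (E \<circ> inv (blinfun_apply (D z))))
        = det2 (blinfun_apply (D (f z))) * (det2 E * (1 / det2 (blinfun_apply (D z))))"
        using det2_inverse(1)[OF linD] by (simp add: det2_compose lin linD linear_compose)
      also have "\<dots> = \<rho> (u, v) / \<rho> (H (u, v))"
      proof -
        have "G (H (u, v)) = f z" using \<Phi>V(2)[OF z(2)] by (simp add: H_def z_def)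
        then show ?thesis unfolding \<rho>_def E(2) z_def[symmetric] by (simp add: mult.commute)
      qed
      finally show ?thesis .
    qed
    moreover have "\<rho> (u, v) \<noteq> 0" "\<rho> (H (u, v)) \<noteq> 0"
      using \<rho>0 y(1) \<Phi>V(1)[OF y(2)] by (auto simp: H_def)
    ultimately show "\<exists>D. (H has_derivative D) (at (u, v)) \<and> det2 D = \<rho> (u, v) / \<rho> (H (u, v)) \<and> det2 D \<noteq> 0"
      by auto
    show "snd (H (u, v)) = snd (H (u0, v))" by (rule horizontal(1)[OF uv])
  next
    show "\<rho> (u, v0) \<noteq> 0" if "\<bar>u - u0\<bar> < e" for u using \<rho>0 box(1)[of u v0] that e by simp
    have "continuous_on {u0 - e<..<u0 + e} (\<lambda>u. G (u, v0))"
      by (rule continuous_on_compose2[OF G_cont]) (use box(1) e in \<open>auto intro!: continuous_intros\<close>)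
    moreover from this have "continuous_on {u0 - e<..<u0 + e} (\<lambda>u. D (G (u, v0)))"
      by (rule continuous_on_compose2[OF D(1)]) (use GU(1) box(1) e UV(2) in fastforce)
    moreover have "det2 (blinfun_apply (D (G (u, v0)))) \<noteq> 0" if "u \<in> {u0 - e<..<u0 + e}" for u
      using jD box(1)[of u v0] that e by auto
    ultimately show "continuous_on {u0 - e<..<u0 + e} (\<lambda>u. \<rho> (u, v0))"
      unfolding \<rho>_def det2_def by (intro continuous_intros bounded_bilinear.continuous_on[OF bounded_bilinear_blinfun_apply]) auto
  next
    show "H (u0, v0) = (u0, v0)" unfolding H_def uv0[symmetric] \<Phi>V(2)[OF UV(3)] fq ..
  next
    fix v assume v: "\<bar>v - v0\<bar> < e" "\<bar>snd (H (u0, v)) - v0\<bar> < e"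
    let ?w = "snd (H (u0, v))"
    have V1: "(u0, v) \<in> V'" "f (G (u0, v)) \<in> U'" "(u0, ?w) \<in> V'" using box[of u0 v] box(1)[of u0 ?w] v e by auto
    obtain L where L: "L \<in> F" "proj (G (u0, v)) \<in> L"
      using in_leaf[of "G (u0, v)"] GU(1)[OF V1(1)] UV(2) by auto
    have "proj (f (G (u0, v))) \<in> L" using horizontal(2)[of u0 v L] L v(1) e by simp
    moreover have "proj (f (G (u0, v))) \<in> V" "proj (G (u0, ?w)) \<in> V"
      using V1(2) GU(1)[OF V1(3)] UV(2) by (auto simp: O'_def)
    moreover have "snd (\<phi> (proj (f (G (u0, v))))) = snd (\<phi> (proj (G (u0, ?w))))"
      using GU(2)[OF V1(3)] by (simp add: H_def \<Phi>_def)
    ultimately have "proj (G (u0, ?w)) \<in> L" using plaques(2)[OF L(1)] by blast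
    then show "lab ?w = lab v" unfolding lab_def using L lab_unique by blast
  next
    fix b x assume b: "b < v0 + e"
    show "finite {v \<in> {v0..b}. lab v = x}"
    proof (cases "{v \<in> {v0..b}. lab v = x} = {}")
      case False
      then obtain v where v: "v \<in> {v0..b}" "lab v = x" by blast
      then have V1: "(u0, v) \<in> V'" using box(1)[of u0 v] b e by auto
      obtain L where L: "L \<in> F" "proj (G (u0, v)) \<in> L"
        using in_leaf[of "G (u0, v)"] GU(1)[OF V1] UV(2) by auto
      have lx: "L \<in> x" using L v(2) by (auto simp: lab_def)
      obtain cL where cL: "lifts cL L" using essential_curve_lifts[OF ric[OF L(1)]] by blast
      have "finite {v \<in> {v0..b}. proj (G (u0, v)) \<in> L}"
      proof (rule leaf_meets_transversal_finitely[OF cL UV(1) US UV(6)])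
        show "{u0} \<times> {v0..b} \<subseteq> V'" using box(1)[of u0] b e by auto
        fix S x y assume S: "connected S" "S \<subseteq> range cL \<inter> U'" "x \<in> S" "y \<in> S"
        have "connected (proj ` S)" by (intro connected_continuous_image continuous_proj S(1))
        moreover have "proj ` S \<subseteq> L \<inter> V" using S(2) cL UV(2) unfolding lifts_def O'_def by blast
        ultimately show "snd (\<Phi> x) = snd (\<Phi> y)"
          unfolding \<Phi>_def using plaques(1)[OF L(1), of "proj ` S"] S(3,4) by blast
      qed
      then show ?thesis by (rule finite_subset[rotated]) (use lx in \<open>auto simp: lab_def\<close>)
    qed (simp only: finite.emptyI)
  next
    fix d :: real assume "d > 0"
    then obtain \<epsilon> where \<epsilon>: "\<epsilon> > 0" "\<epsilon> \<le> \<eta>'" "\<And>t. t \<in> ball t1 \<epsilon> \<Longrightarrow> \<bar>w t - u0\<bar> < d" using close by blast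
    define t where "t = t1 + \<epsilon> / 2"
    have t: "t1 < t" "t \<in> ball t1 \<epsilon>" using \<epsilon>(1) by (auto simp: t_def dist_real_def)
    then have t': "t \<in> ball t1 \<eta>'" using \<epsilon>(2) by auto
    then have tb: "t \<in> ball t1 \<eta>" "\<psi> t \<in> ball t1 \<eta>" using \<eta>'(2) by blast+
    have "t1 < \<psi> t" using strict_monoD[OF \<psi>(2) t(1)] t1 by simp
    define m where "m = max t (\<psi> t)"
    have sub: "{t1..m} \<subseteq> ball t1 \<eta>" using tb by (auto simp: m_def dist_real_def)
    have "0 < (w (\<psi> t) - w t1) * (w t - w t1)"
      by (rule monotone_side[OF continuous_on_subset[OF w_cont sub] inj_on_subset[OF w_inj sub]])
         (use t(1) \<open>t1 < \<psi> t\<close> in \<open>auto simp: m_def\<close>)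
    then have "w t \<noteq> u0" "0 < (fst (H (w t, v0)) - u0) * (w t - u0)" unfolding Hw[OF t'] w1 by auto
    then show "\<exists>u. u \<noteq> u0 \<and> \<bar>u - u0\<bar> < d \<and> 0 < (fst (H (u, v0)) - u0) * (u - u0)"
      using \<epsilon>(3)[OF t(2)] by blast
  qed blast
  obtain \<epsilon> where \<epsilon>: "\<epsilon> > 0" "\<epsilon> \<le> \<eta>'" "\<And>t. t \<in> ball t1 \<epsilon> \<Longrightarrow> \<bar>w t - u0\<bar> < d" using close[OF d(1)] by blast
  have "\<psi> t = t" if t: "t \<in> ball t1 \<epsilon>" for t
  proof -
    have t': "t \<in> ball t1 \<eta>'" using t \<epsilon>(2) by auto
    then have tb: "t \<in> ball t1 \<eta>" "\<psi> t \<in> ball t1 \<eta>" using \<eta>'(2) by blast+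
    have "w (\<psi> t) = w t" using d(2)[OF \<epsilon>(3)[OF t]] Hw[OF t'] by simp
    then show ?thesis using inj_onD[OF w_inj] tb by blast
  qed
  then show "\<exists>\<epsilon>>0. ball t1 \<epsilon> \<subseteq> {t. \<psi> t = t}" using \<epsilon>(1) by blast
qed

text \<open>
  The parameters fixed by \<open>\<psi> t = (\<phi> ^^ k) t - r\<close> form an open and closed subset of the line, and it
  is nonempty because of the rotation number; so \<open>\<psi>\<close> is the identity.
\<close>

lemma leaf_periodic:
  assumes F: "C1_foliation \<gamma> U F" and ric: "\<And>L. L \<in> F \<Longrightarrow> rotational_invariant_curve \<gamma> L"
    and L: "L \<in> F" and k: "k > 0" and x: "x \<in> L"
    and \<sigma>: "\<And>n. \<gamma> (\<sigma> n) = fst ((billiard_map \<gamma> ^^ n) x)" "\<And>n. \<sigma> n < \<sigma> (Suc n)" "\<And>n. \<sigma> (Suc n) < \<sigma> n + l"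
      "(\<lambda>n. (\<sigma> n - \<sigma> 0) / (real n * l)) \<longlonglongrightarrow> of_int r / real k"
    and z: "z \<in> strip" "proj z = x"
  shows "(step ^^ k) z = z + (of_int r * l, 0)"
proof -
  obtain c where c: "lifts c L" using essential_curve_lifts[OF ric[OF L]] by blast
  have "billiard_map \<gamma> ` L = L" using ric[OF L] unfolding rotational_invariant_curve_def by blast
  then obtain \<phi> where \<phi>: "continuous_on UNIV \<phi>" "strict_mono \<phi>" "\<And>t. \<phi> (t + 1) = \<phi> t + 1" "\<And>t. step (c t) = c (\<phi> t)"
    using induced_map[OF c] by (metis order_refl)
  obtain t0 where t0: "c t0 = z" using lifts_range[OF c z(1)] z(2) x by (metis rangeE)
  obtain t1 where t1: "(\<phi> ^^ k) t1 = t1 + of_int r"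
    using rotation_fixed_point[OF c \<phi>(1,3,4) k, of \<sigma> t0] \<sigma> unfolding t0 z(2) by blast
  define \<psi> where "\<psi> t = (\<phi> ^^ k) t + - of_int r" for t
  have pow_cont: "continuous_on UNIV (\<phi> ^^ n)" and pow_mono: "strict_mono (\<phi> ^^ n)" for n
    by (induction n) (auto simp: id_def strict_mono_def intro: continuous_on_compose2[OF \<phi>(1)] strict_monoD[OF \<phi>(2)])
  have \<psi>_cont: "continuous_on UNIV \<psi>" unfolding \<psi>_def[abs_def] by (intro continuous_intros pow_cont)
  have \<psi>_mono: "strict_mono \<psi>" using pow_mono[of k] by (simp add: strict_mono_def \<psi>_def)
  have \<psi>_step: "(step ^^ k) (c t) = c (\<psi> t) + (of_int r * l, 0)" for t
    using lifts_int[OF c, of "\<psi> t" r] by (simp add: induced_pow[OF c \<phi>(4)] \<psi>_def)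
  define S where "S = {t. \<psi> t = t}"
  have "open S" unfolding S_def by (rule fixed_leaf_points_open[OF F ric L c \<psi>_cont \<psi>_mono \<psi>_step])
  moreover have "closed S" unfolding S_def by (rule closed_Collect_eq[OF \<psi>_cont continuous_on_id])
  moreover have "t1 \<in> S" using t1 by (simp add: \<psi>_def S_def)
  ultimately have "S = UNIV" using clopen[of S] by auto
  then have "t0 \<in> S" by simp
  then have "\<psi> t0 = t0" by (simp add: S_def)
  then show ?thesis using \<psi>_step[of t0] t0 by simp
qed

section \<open>Ordering of periodic orbits\<close>

text \<open>
  A smaller base point before the common one means a larger arrival angle there, and a smaller base
  point after it means a smaller departure angle. Both are the angle at the common base point.
\<close>

lemma tangent_orbits_coincide:
  assumes "z \<in> strip" "w \<in> strip"
    and "fst z \<le> fst w" "fst (step z) = fst (step w)" "fst (step (step z)) \<le> fst (step (step w))"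
  shows "z = w"
proof -
  note z = impact[OF assms(1)] and w = impact[OF assms(2)]
  note z' = impact[OF step_in_strip[OF assms(1)]] and w' = impact[OF step_in_strip[OF assms(2)]]
  have i: "impact z = impact w" using assms(4) by (simp add: fst_step)
  have "snd (step w) \<le> snd (step z)"
    using assms(3) arrival_antimono[of "impact z" "fst z" "fst w"] z w i
    by (cases "fst z = fst w") (auto simp: snd_step)
  moreover have "snd (step z) \<le> snd (step w)"
    using assms(5) departure_mono[of "fst (step z)" "impact (step z)" "impact (step w)"] z' w' i
    by (cases "impact (step z) = impact (step w)") (auto simp: fst_step)
  ultimately have "step z = step w" using assms(4) by (simp add: prod_eq_iff)
  then show ?thesis using step_inj assms by blast
qed

lemma fst_step_pow_mono: "z \<in> strip \<Longrightarrow> m \<le> n \<Longrightarrow> fst ((step ^^ m) z) \<le> fst ((step ^^ n) z)"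
proof (induction n)
  case (Suc n)
  then show ?case
    using impact(1)[OF step_pow_in_strip[OF Suc.prems(1)], of n]
    by (cases "m = Suc n") (auto simp: fst_step)
qed auto

text \<open>
  The parameters \<open>u\<close> for which the orbit of \<open>c u\<close> is strictly ahead of the orbit of \<open>z\<close> at all times
  form an open set, since by periodicity only \<open>k\<close> times matter. It contains all large \<open>u\<close>
  and no very negative ones. At the supremum of its complement the two orbits are still weakly ordered, and
  they share a base point; so they coincide.
\<close>

lemma periodic_orbit_meets_periodic_curve:
  assumes c: "lifts c L" and k: "k > 0"
    and per_c: "\<And>t. (step ^^ k) (c t) = c t + (of_int r * l, 0)"
    and z: "z \<in> strip" and per_z: "(step ^^ k) z = z + (of_int r * l, 0)"
  obtains t where "c t = z" "\<And>u n. t < u \<Longrightarrow> fst ((step ^^ n) z) < fst ((step ^^ n) (c u))"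
proof -
  define x where "x n t = fst ((step ^^ n) (c t))" for n t
  define y where "y n = fst ((step ^^ n) z)" for n
  have x_per: "x (n + k) t = x n t + of_int r * l" for n t
    unfolding x_def funpow_add o_apply per_c using step_pow_period[OF liftsD(4)[OF c], of n t r] by simp
  have y_per: "y (n + k) = y n + of_int r * l" for n
    unfolding y_def funpow_add o_apply per_z using step_pow_period[OF z, of n r] by simp
  define W where "W = {t. \<forall>n<k. y n < x n t}"
  have W_all: "y n < x n t" if "t \<in> W" for n t
  proof (induction n rule: less_induct)
    case (less n)
    show ?case
    proof (cases "n < k")
      case True
      then show ?thesis using that by (simp add: W_def)
    next
      case False
      then have "y (n - k) < x (n - k) t" using k by (intro less) simp
      then show ?thesis using x_per[of "n - k" t] y_per[of "n - k"] False by simp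
    qed
  qed
  have cont: "continuous_on UNIV (x n)" for n
    unfolding x_def by (intro continuous_intros continuous_on_compose2[OF continuous_step_pow liftsD(1)[OF c]])
      (use liftsD(4)[OF c] in auto)
  have "W = (\<Inter>n\<in>{..<k}. {t. y n < x n t})" by (auto simp: W_def)
  then have "open W" using cont by (auto intro!: open_INT open_Collect_less continuous_on_const)
  then have cl: "closed (- W)" by auto
  obtain M where M: "\<And>t. \<bar>fst (c t) - l * t\<bar> \<le> M" using lifts_displacement[OF c] by blast
  have "t < (y k + M) / l + 1" if "t \<in> - W" for t
  proof (rule ccontr)
    assume "\<not> ?thesis"
    then have "(y k + M) / l < t" by linarith
    then have "y k < fst (c t)" using M[of t] l_pos by (simp add: pos_divide_less_eq mult.commute)
    then have "y n < x n t" if "n < k" for n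
      using fst_step_pow_mono[OF liftsD(4)[OF c], of 0 n t] fst_step_pow_mono[OF z, of n k] that
      by (simp add: x_def y_def)
    then show False using \<open>t \<in> - W\<close> by (simp add: W_def)
  qed
  then have bdd: "bdd_above (- W)" by (meson bdd_aboveI less_imp_le)
  have "(y 0 - M) / l - 1 \<in> - W"
  proof -
    let ?t = "(y 0 - M) / l - 1"
    have "l * ?t = y 0 - M - l" using l_pos by (simp add: field_simps)
    then have "fst (c ?t) < y 0" using M[of ?t] l_pos by linarith
    then show ?thesis using k by (auto simp: W_def x_def not_less less_imp_le)
  qed
  then have ne: "- W \<noteq> {}" by blast
  define t where "t = Sup (- W)"
  have t: "t \<notin> W" using closed_contains_Sup[OF ne bdd cl] by (simp add: t_def)
  have above: "u \<in> W" if "t < u" for u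
    using cSup_upper[OF _ bdd, of u] that unfolding t_def by fastforce
  have le: "y n \<le> x n t" for n
  proof (rule tendsto_lowerbound)
    show "(x n \<longlongrightarrow> x n t) (at_right t)"
      using cont[of n] by (simp add: continuous_on_eq_continuous_at isCont_def filterlim_at_split)
    show "\<forall>\<^sub>F u in at_right t. y n \<le> x n u"
      using eventually_at_right_less[of t] by eventually_elim (use above W_all in \<open>auto intro: less_imp_le\<close>)
  qed simp
  obtain n where "y n = x n t" using t le by (auto simp: W_def order.order_iff_strict)
  \<comment> \<open>Adding a period provides a time before the common one.\<close>
  then have eq: "y (Suc (n + k - 1)) = x (Suc (n + k - 1)) t" using k x_per y_per by simp
  have "(step ^^ (n + k - 1)) z = (step ^^ (n + k - 1)) (c t)"
    using le[of "n + k - 1"] le[of "Suc (Suc (n + k - 1))"] eq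
    by (intro tangent_orbits_coincide step_pow_in_strip z liftsD(4)[OF c]) (simp_all add: x_def y_def)
  then have "c t = z" using step_pow_inj[OF z liftsD(4)[OF c]] by metis
  then show ?thesis using that above W_all by (auto simp: x_def y_def)
qed

text \<open>
  The point \<open>z = step (c t) - (a, 0)\<close> has again a periodic orbit of the same type, so it lies on the
  lift, at a parameter \<open>u\<close>. If \<open>u \<noteq> t\<close>, the orbits of \<open>z\<close> and \<open>c t\<close> are strictly ordered at all
  times. But the \<open>n\<close>-th base points differ by the \<open>n\<close>-th step length minus \<open>a\<close>, and the step lengths
  over one period have sum \<open>k * a\<close>.
\<close>

lemma periodic_curve_orbits_regular:
  assumes c: "lifts c L" and k: "k > 0"
    and per_c: "\<And>t. (step ^^ k) (c t) = c t + (of_int r * l, 0)"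
    and \<zeta>: "\<And>x. \<gamma> (x + of_int r * l / real k) = \<zeta> * \<gamma> x" "cmod \<zeta> = 1"
  shows "step (c t) = c t + (of_int r * l / real k, 0)"
proof -
  define a where "a = of_int r * l / real k"
  have ka: "real k * a = of_int r * l" using k by (simp add: a_def)
  have \<zeta>': "\<gamma> (x + - a) = cnj \<zeta> * \<gamma> x" "cmod (cnj \<zeta>) = 1" for x
  proof -
    have "cnj \<zeta> * \<zeta> = 1" using \<zeta>(2) by (metis complex_norm_square mult.commute of_real_1 one_power2)
    then show "\<gamma> (x + - a) = cnj \<zeta> * \<gamma> x"
      using \<zeta>(1)[of "x + - a"] by (simp add: a_def mult.assoc[symmetric])
  qed (use \<zeta>(2) in simp)
  \<comment> \<open>If the orbit of \<open>c t\<close> is a regular polygon, this is \<open>c t\<close> itself.\<close>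
  define z where "z = step (c t) + (- a, 0)"
  note ct = liftsD(4)[OF c, of t]
  have z: "z \<in> strip" unfolding z_def shift_in_strip by (rule step_in_strip[OF ct])
  have z_pow: "(step ^^ n) z = (step ^^ Suc n) (c t) + (- a, 0)" for n
    unfolding z_def by (simp add: step_pow_shift[OF \<zeta>' step_in_strip[OF ct]] funpow_swap1)
  have step_k: "(step ^^ Suc k) (c t) = step (c t) + (of_int r * l, 0)"
    using step_pow_period[OF ct, of 1 r] by (simp add: per_c)
  have per_z: "(step ^^ k) z = z + (of_int r * l, 0)"
    unfolding z_pow step_k by (simp add: z_def)
  obtain u where u: "c u = z" "\<And>v n. u < v \<Longrightarrow> fst ((step ^^ n) z) < fst ((step ^^ n) (c v))"
    using periodic_orbit_meets_periodic_curve[OF c k per_c z per_z] by blast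
  obtain t' where t': "c t' = c t" "\<And>v n. t' < v \<Longrightarrow> fst ((step ^^ n) (c t)) < fst ((step ^^ n) (c v))"
    using periodic_orbit_meets_periodic_curve[OF c k per_c ct per_c] by blast
  then have "t' = t" using liftsD(3)[OF c] by (simp add: inj_eq)
  define x where "x n = fst ((step ^^ n) (c t))" for n
  have sum: "x k - x 0 = (\<Sum>n<k. x (Suc n) - x n)" by (simp add: sum_lessThan_telescope)
  have xk: "x k - x 0 = (\<Sum>n<k. a)" by (simp add: x_def per_c ka)
  have fz: "fst ((step ^^ n) z) = x (Suc n) - a" for n unfolding z_pow by (simp add: x_def)
  have "\<not> u < t"
  proof
    assume "u < t"
    then have "(\<Sum>n<k. x (Suc n) - x n) < (\<Sum>n<k. a)"
      using k u(2)[of t] fz by (intro sum_strict_mono) (auto simp: x_def algebra_simps)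
    then show False using sum xk by simp
  qed
  moreover have "\<not> t < u"
  proof
    assume "t < u"
    then have "(\<Sum>n<k. a) < (\<Sum>n<k. x (Suc n) - x n)"
      using k t'(2)[of u] fz u(1) \<open>t' = t\<close> by (intro sum_strict_mono) (auto simp: x_def algebra_simps)
    then show False using sum xk by simp
  qed
  ultimately have "z = c t" using u(1) by (metis linorder_neqE_linordered_idom)
  then show ?thesis unfolding z_def a_def by (metis (no_types) add.assoc add.right_neutral add_Pair ab_left_minus zero_prod_def)
qed

section \<open>Regular polygons\<close>

text \<open>
  Let \<open>w = cnj (T s) * \<gamma> s\<close>. The chord is \<open>(\<zeta> - 1) * \<gamma> s\<close>, and its angles with the tangents
  \<open>T s\<close> and \<open>\<zeta> * T s\<close> are opposite, which says that \<open>cnj \<zeta> * (\<zeta> - 1) * w\<close> is conjugate to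
  \<open>(\<zeta> - 1) * w\<close>. Hence \<open>w\<close> is imaginary: the tangent is perpendicular to the radius. Then the radius
  is constant, and \<open>\<gamma>\<close> solves the linear equation of uniform rotation, so it runs through
  the whole circle.
\<close>

lemma regular_orbits_imp_circle:
  assumes c: "lifts c L" and \<zeta>: "\<And>x. \<gamma> (x + a) = \<zeta> * \<gamma> x" "cmod \<zeta> = 1"
    and reg: "\<And>t. step (c t) = c t + (a, 0)"
  shows "\<exists>\<rho>>0. range \<gamma> = sphere 0 \<rho>"
proof -
  have onto: "\<exists>t. fst (c t) = s" for s
  proof -
    obtain M where M: "\<And>t. \<bar>fst (c t) - l * t\<bar> \<le> M" using lifts_displacement[OF c] by blast
    have "fst (c ((s - M) / l)) \<le> s" "s \<le> fst (c ((s + M) / l))"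
      using M[of "(s - M) / l"] M[of "(s + M) / l"] l_pos by (simp_all add: abs_le_iff)
    moreover have "connected (range (\<lambda>t. fst (c t)))"
      by (intro connected_continuous_image continuous_intros liftsD(1)[OF c]) auto
    ultimately have "s \<in> range (\<lambda>t. fst (c t))" unfolding connected_iff_interval by blast
    then show ?thesis by auto
  qed
  have key: "0 < Im ((\<zeta> - 1) * (cnj (T s) * \<gamma> s)) \<and> Re (cnj (T s) * \<gamma> s) = 0" for s
  proof -
    obtain t where t: "fst (c t) = s" using onto by blast
    note i = impact[OF liftsD(4)[OF c], of t]
    have imp: "impact (c t) = s + a" and arr: "arrival s (s + a) = snd (c t)"
      using reg[of t] t by (auto simp: step_def prod_eq_iff)
    have ss: "s < s + a" "s + a < s + l" using i(1,2) unfolding imp t by auto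
    have dep: "departure s (s + a) = snd (c t)" using i(3) by (simp add: imp t)
    define w where "w = cnj (T s) * \<gamma> s"
    define \<delta> where "\<delta> = cmod (\<gamma> (s + a) - \<gamma> s)"
    have chord: "\<gamma> (s + a) - \<gamma> s = (\<zeta> - 1) * \<gamma> s" unfolding \<zeta>(1) by (simp add: algebra_simps)
    have \<zeta>1: "\<zeta> * cnj \<zeta> = 1" using \<zeta>(2) by (simp add: complex_norm_square[symmetric])
    have 1: "(\<zeta> - 1) * w = of_real \<delta> * cis (snd (c t))"
    proof -
      have "(\<zeta> - 1) * w = cnj (T s) * (\<gamma> (s + a) - \<gamma> s)" unfolding chord w_def by (simp add: mult_ac)
      also have "\<dots> = cnj (T s) * (\<delta> *\<^sub>R (T s * cis (snd (c t))))"
        using chord_cis(1)[OF ss] unfolding dep \<delta>_def by (rule arg_cong)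
      also have "\<dots> = (T s * cnj (T s)) * (of_real \<delta> * cis (snd (c t)))" by (simp add: scaleR_conv_of_real mult_ac)
      finally show ?thesis unfolding T_cnj by simp
    qed
    have 2: "(\<zeta> - 1) * w = \<zeta> * (of_real \<delta> * cis (- snd (c t)))"
    proof -
      have "(\<zeta> - 1) * w = cnj (T s) * (\<gamma> (s + a) - \<gamma> s)" unfolding chord w_def by (simp add: mult_ac)
      also have "\<dots> = cnj (T s) * (\<delta> *\<^sub>R (T (s + a) * cis (- snd (c t))))"
        using chord_cis(2)[OF ss] unfolding arr \<delta>_def by (rule arg_cong)
      also have "\<dots> = (T s * cnj (T s)) * (\<zeta> * (of_real \<delta> * cis (- snd (c t))))"
        unfolding T_shift[OF \<zeta>(1)] by (simp add: scaleR_conv_of_real mult_ac)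
      finally show ?thesis unfolding T_cnj by simp
    qed
    have "cnj \<zeta> * ((\<zeta> - 1) * w) = cnj ((\<zeta> - 1) * w)"
    proof -
      have "cnj \<zeta> * ((\<zeta> - 1) * w) = (\<zeta> * cnj \<zeta>) * (of_real \<delta> * cis (- snd (c t)))" unfolding 2 by (simp add: mult_ac)
      also have "\<dots> = cnj ((\<zeta> - 1) * w)" unfolding \<zeta>1 1 by (simp add: cis_cnj)
      finally show ?thesis .
    qed
    moreover have "cnj \<zeta> * ((\<zeta> - 1) * w) = (\<zeta> * cnj \<zeta>) * w - cnj \<zeta> * w" by (simp add: algebra_simps)
    moreover have "cnj ((\<zeta> - 1) * w) = cnj \<zeta> * cnj w - cnj w" by (simp add: algebra_simps)
    ultimately have "w - cnj \<zeta> * w = cnj \<zeta> * cnj w - cnj w" unfolding \<zeta>1 by simp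
    moreover have "(1 - cnj \<zeta>) * (w + cnj w) = (w - cnj \<zeta> * w) - (cnj \<zeta> * cnj w - cnj w)"
      by (simp add: algebra_simps)
    ultimately have "(1 - cnj \<zeta>) * (w + cnj w) = 0" by simp
    moreover have "1 - cnj \<zeta> \<noteq> 0"
    proof
      assume "1 - cnj \<zeta> = 0"
      then have "\<zeta> = 1" by (metis complex_cnj_cnj complex_cnj_one eq_iff_diff_eq_0)
      then show False using chord_pos(1)[OF ss] chord by simp
    qed
    ultimately have "w + cnj w = 0" by simp
    then have "Re w = 0" by (simp add: complex_eq_iff)
    moreover have "0 < Im ((\<zeta> - 1) * w)"
      using chord_pos(2)[OF ss] unfolding chord w_def by (simp add: mult_ac)
    ultimately show ?thesis unfolding w_def by blast
  qed
  define \<rho> where "\<rho> = cmod (\<gamma> 0)"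
  have nsq: "((\<lambda>s. \<gamma> s \<bullet> \<gamma> s) has_real_derivative 0) (at s)" for s
  proof -
    have "((\<lambda>s. \<gamma> s \<bullet> \<gamma> s) has_derivative (\<lambda>h. \<gamma> s \<bullet> (h *\<^sub>R T s) + (h *\<^sub>R T s) \<bullet> \<gamma> s)) (at s)"
      using curve_deriv[of s] unfolding has_vector_derivative_def by (rule has_derivative_inner) (use curve_deriv[of s] in \<open>simp add: has_vector_derivative_def\<close>)
    moreover have "\<gamma> s \<bullet> T s = 0" using key[of s] by (simp add: inner_complex_def mult.commute)
    ultimately show ?thesis by (simp add: has_field_derivative_def inner_commute flip: lambda_zero)
  qed
  have norm: "cmod (\<gamma> s) = \<rho>" for s
  proof -
    have "\<gamma> s \<bullet> \<gamma> s = \<gamma> 0 \<bullet> \<gamma> 0" using DERIV_isconst_all[of "\<lambda>s. \<gamma> s \<bullet> \<gamma> s" s 0] nsq by blast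
    then show ?thesis unfolding \<rho>_def norm_eq_sqrt_inner by simp
  qed
  have \<gamma>_eq: "\<gamma> s = - (of_real \<rho> * \<i>) * T s \<and> \<rho> > 0" for s
  proof -
    define w where "w = cnj (T s) * \<gamma> s"
    have w: "Re w = 0" "0 < Im ((\<zeta> - 1) * w)" using key[of s] by (auto simp: w_def)
    have "cmod w = \<rho>" by (simp add: w_def norm_mult norm_T norm)
    then have "\<bar>Im w\<bar> = \<rho>" using w(1) by (simp add: cmod_eq_Im)
    moreover have "Im w < 0"
    proof -
      have "0 < (Re \<zeta> - 1) * Im w" using w by simp
      moreover have "Re \<zeta> \<le> 1" using \<zeta>(2) complex_Re_le_cmod by metis
      ultimately show ?thesis by (simp add: zero_less_mult_iff)
    qed
    ultimately have "\<rho> > 0" "w = - (of_real \<rho> * \<i>)" using w(1) by (auto simp: complex_eq_iff)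
    moreover have "\<gamma> s = (T s * cnj (T s)) * \<gamma> s" unfolding T_cnj by simp
    then have "\<gamma> s = T s * w" by (simp add: w_def mult.assoc)
    ultimately show ?thesis by (simp add: mult.commute)
  qed
  then have \<rho>: "\<rho> > 0" by blast
  \<comment> \<open>Constant exactly when \<open>\<gamma>\<close> runs along the circle at unit speed.\<close>
  define h where "h s = \<gamma> s * cis (- s / \<rho>)" for s
  have "(h has_vector_derivative 0) (at s)" for s
  proof -
    have "((\<lambda>s. cis (- s / \<rho>)) has_vector_derivative (- 1 / \<rho>) *\<^sub>R (\<i> * cis (- s / \<rho>))) (at s)"
      unfolding has_vector_derivative_def using \<rho>
      by (auto intro!: derivative_eq_intros simp: scaleR_conv_of_real)
    from has_vector_derivative_mult[OF curve_deriv this]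
    have "(h has_vector_derivative \<gamma> s * ((- 1 / \<rho>) *\<^sub>R (\<i> * cis (- s / \<rho>))) + T s * cis (- s / \<rho>)) (at s)"
      by (simp add: h_def[abs_def])
    moreover have "\<gamma> s * ((- 1 / \<rho>) *\<^sub>R (\<i> * cis (- s / \<rho>))) + T s * cis (- s / \<rho>) = 0"
    proof -
      have "T s = (\<i> / of_real \<rho>) * \<gamma> s" using \<gamma>_eq[of s] by (simp add: field_simps)
      then show ?thesis by (simp add: scaleR_conv_of_real)
    qed
    ultimately show ?thesis by simp
  qed
  then have "h s = h 0" for s
    using has_vector_derivative_zero_constant[of UNIV h] by (metis UNIV_I convex_UNIV)
  then have form: "\<gamma> s = \<gamma> 0 * cis (s / \<rho>)" for s
  proof -
    have "cis (- s / \<rho>) * cis (s / \<rho>) = 1" by (simp add: cis_mult)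
    then have "\<gamma> s = h s * cis (s / \<rho>)" unfolding h_def mult.assoc by (simp only: mult_1_right)
    moreover have "h 0 = \<gamma> 0" by (simp add: h_def)
    ultimately show ?thesis using \<open>h s = h 0\<close> by (simp only:)
  qed
  have "z \<in> range \<gamma>" if "cmod z = \<rho>" for z
  proof -
    have "cmod (z / \<gamma> 0) = 1" using that norm \<rho> by (simp add: norm_divide)
    then obtain u where "z / \<gamma> 0 = cis u" by (metis complex_norm_eq_1_exp cis_conv_exp)
    then have "z = \<gamma> (u * \<rho>)" unfolding form[of "u * \<rho>"] using \<rho> norm[of 0] by (auto simp: field_simps)
    then show ?thesis by blast
  qed
  then have "range \<gamma> = sphere 0 \<rho>" using norm by auto
  then show ?thesis using \<rho> by blast
qed

section \<open>The symmetry as a shift of arc length\<close>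

text \<open>
  Both unit vectors have the whole curve on their left, and the curve has only one
  tangent line at the point.
\<close>

lemma rotation_preserves_tangents:
  assumes \<omega>: "cmod \<omega> = 1" and onto: "\<And>s. \<exists>s'. \<gamma> s = \<omega> * \<gamma> s'" and x: "\<gamma> x = \<omega> * \<gamma> s"
  shows "T x = \<omega> * T s"
proof -
  define u where "u = \<omega> * T s"
  have \<omega>1: "\<omega> * cnj \<omega> = 1" using \<omega> by (simp add: complex_norm_square[symmetric])
  have nu: "cnj u * u = 1" using \<omega>1 T_cnj[of s] by (simp add: u_def mult_ac)
  have left: "0 < Im (cnj u * (\<gamma> y - \<gamma> x))" if "\<gamma> y \<noteq> \<gamma> x" for y
  proof -
    obtain s' where s': "\<gamma> y = \<omega> * \<gamma> s'" using onto by blast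
    have "cnj u * (\<gamma> y - \<gamma> x) = (\<omega> * cnj \<omega>) * (cnj (T s) * (\<gamma> s' - \<gamma> s))"
      by (simp add: u_def s' x algebra_simps)
    then show ?thesis using support[of s' s] that s' x unfolding \<omega>1 by auto
  qed
  have "((\<lambda>y. Im (cnj u * (\<gamma> y - \<gamma> x))) has_real_derivative Im (cnj u * T x)) (at x)"
  proof -
    have "((\<lambda>y. cnj u * (\<gamma> y - \<gamma> x)) has_vector_derivative cnj u * (T x - 0)) (at x)"
      by (intro has_vector_derivative_mult_right has_vector_derivative_diff curve_deriv has_vector_derivative_const)
    from bounded_linear.has_vector_derivative[OF bounded_linear_Im this]
    show ?thesis by (simp add: has_real_derivative_iff_has_vector_derivative)
  qed
  moreover have "Im (cnj u * (\<gamma> x - \<gamma> x)) \<le> Im (cnj u * (\<gamma> y - \<gamma> x))" for y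
    using left[of y] by (cases "\<gamma> y = \<gamma> x") (auto simp: less_imp_le)
  ultimately have "Im (cnj u * T x) = 0"
    by (intro DERIV_local_min[of "\<lambda>y. Im (cnj u * (\<gamma> y - \<gamma> x))" _ x 1]) auto
  then obtain \<epsilon> :: real where \<epsilon>: "cnj u * T x = of_real \<epsilon>" by (metis complex_is_Real_iff Reals_cases)
  have "T x = u * (cnj u * T x)" using nu by (metis mult.assoc mult.commute mult_1)
  then have Tx: "T x = of_real \<epsilon> * u" unfolding \<epsilon> by simp
  have "\<gamma> (x + l / 2) \<noteq> \<gamma> x" using curve_distinct[of "x + l / 2" x] l_pos by simp
  then have "0 < Im (cnj u * (\<gamma> (x + l / 2) - \<gamma> x))" "0 < Im (cnj (T x) * (\<gamma> (x + l / 2) - \<gamma> x))"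
    using left support by blast+
  moreover have "cnj (T x) * (\<gamma> (x + l / 2) - \<gamma> x) = of_real \<epsilon> * (cnj u * (\<gamma> (x + l / 2) - \<gamma> x))"
    by (simp add: Tx mult_ac)
  ultimately have "\<epsilon> > 0" by (simp add: zero_less_mult_iff)
  moreover have "cmod (of_real \<epsilon> * u) = 1" unfolding Tx[symmetric] by (rule norm_T)
  ultimately have "\<epsilon> = 1" using \<omega> norm_T[of s] by (simp add: norm_mult u_def)
  then show ?thesis using Tx by (simp add: u_def)
qed

text \<open>
  The rotated curve is again parametrized by arc length in the same direction, so the change of
  parameter has derivative 1.
\<close>

lemma rotation_is_shift:
  assumes \<omega>: "cmod \<omega> = 1" and inv: "(\<lambda>z. \<omega> * z) ` range \<gamma> = range \<gamma>"
  obtains d where "\<And>s. \<gamma> (s + d) = \<omega> * \<gamma> s"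
proof -
  have onto: "\<exists>s'. \<gamma> s = \<omega> * \<gamma> s'" for s
    using inv by (metis imageE rangeE rangeI)
  have "range (\<lambda>s. \<omega> * \<gamma> s) \<subseteq> range \<gamma>" using inv by blast
  moreover have "continuous_on UNIV (\<lambda>s. \<omega> * \<gamma> s)" by (intro continuous_intros continuous_curve)
  ultimately obtain \<delta> where \<delta>: "continuous_on UNIV \<delta>" "\<And>s. \<gamma> (\<delta> s) = \<omega> * \<gamma> s"
    using curve_lift[of "\<lambda>s. \<omega> * \<gamma> s"] by blast
  have T\<delta>: "T (\<delta> s) = \<omega> * T s" for s by (rule rotation_preserves_tangents[OF \<omega> onto \<delta>(2)])
  have "(\<delta> has_real_derivative 1) (at s)" for s
  proof -
    define u where "u = T (\<delta> s)"
    define f where "f y = Re (cnj u * \<gamma> y)" for y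
    define m where "m y = Re (cnj u * (\<omega> * \<gamma> y))" for y
    have u1: "cnj u * u = 1" using T_cnj[of "\<delta> s"] by (simp add: u_def mult.commute)
    have f: "(f has_real_derivative 1) (at (\<delta> s))"
      using bounded_linear.has_vector_derivative[OF bounded_linear_Re has_vector_derivative_mult_right[OF curve_deriv[of "\<delta> s"], of "cnj u"]] u1
      by (simp add: has_real_derivative_iff_has_vector_derivative f_def[abs_def] flip: u_def)
    have "(m has_real_derivative Re (cnj u * (\<omega> * T s))) (at s)"
      unfolding has_real_derivative_iff_has_vector_derivative m_def
      by (intro bounded_linear.has_vector_derivative[OF bounded_linear_Re] has_vector_derivative_mult_right curve_deriv)
    moreover have "cnj u * (\<omega> * T s) = 1" using u1 T\<delta>[of s] unfolding u_def by simp
    ultimately have m: "(m has_real_derivative 1) (at s)" by simp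
    have fm: "f (\<delta> y) = m y" for y by (simp add: f_def m_def \<delta>(2))
    obtain g where g: "\<And>z. f z - f (\<delta> s) = g z * (z - \<delta> s)" "isCont g (\<delta> s)" "g (\<delta> s) = 1"
      using f unfolding CARAT_DERIV by blast
    have "isCont \<delta> s" using \<delta>(1) by (simp add: continuous_on_eq_continuous_at)
    then have g\<delta>: "((\<lambda>y. g (\<delta> y)) \<longlongrightarrow> 1) (at s)"
      using g(2,3) by (metis continuous_within isCont_def isCont_o2)
    have "((\<lambda>y. (m y - m s) / (y - s) / g (\<delta> y)) \<longlongrightarrow> 1 / 1) (at s)"
      using m unfolding has_field_derivative_iff by (intro tendsto_divide g\<delta>) auto
    moreover have "\<forall>\<^sub>F y in at s. g (\<delta> y) \<noteq> 0"
      using order_tendstoD(1)[OF g\<delta>, of 0] by (auto elim: eventually_mono)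
    then have "\<forall>\<^sub>F y in at s. (m y - m s) / (y - s) / g (\<delta> y) = (\<delta> y - \<delta> s) / (y - s)"
    proof eventually_elim
      case (elim y)
      have "m y - m s = g (\<delta> y) * (\<delta> y - \<delta> s)" unfolding fm[symmetric] by (rule g(1))
      then show ?case using elim by simp
    qed
    ultimately have "((\<lambda>y. (\<delta> y - \<delta> s) / (y - s)) \<longlongrightarrow> 1 / 1) (at s)"
      by (rule Lim_transform_eventually)
    then show ?thesis unfolding has_field_derivative_iff by simp
  qed
  then have "((\<lambda>s. \<delta> s - s) has_real_derivative 0) (at s)" for s
    by (auto intro!: derivative_eq_intros)
  then have const: "\<delta> s - s = \<delta> 0 - 0" for s using DERIV_isconst_all[of "\<lambda>s. \<delta> s - s" s 0] by blast
  have "\<gamma> (s + \<delta> 0) = \<omega> * \<gamma> s" for s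
  proof -
    have "s + \<delta> 0 = \<delta> s" using const[of s] by linarith
    then show ?thesis by (simp only: \<delta>(2))
  qed
  then show ?thesis by (rule that)
qed

text \<open>
  The rotation by \<open>2 * pi / k\<close> is the shift by some \<open>d = j * l / k\<close>. Here \<open>j\<close> is coprime to \<open>k\<close>, since
  a smaller power of the rotation would otherwise fix the curve pointwise. So some multiple
  of \<open>d\<close> is \<open>r * l / k\<close> modulo \<open>l\<close>.
\<close>

lemma symmetry_shift:
  assumes k: "k > 0" and sym: "rotation (2 * pi / real k) ` range \<gamma> = range \<gamma>"
  obtains \<zeta> where "cmod \<zeta> = 1" "\<And>s. \<gamma> (s + of_int r * l / real k) = \<zeta> * \<gamma> s"
proof -
  define \<omega> where "\<omega> = cis (2 * pi / real k)"
  have "cmod \<omega> = 1" by (simp add: \<omega>_def)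
  moreover have "(\<lambda>z. \<omega> * z) ` range \<gamma> = range \<gamma>" using sym by (simp only: rotation_def[abs_def] \<omega>_def)
  ultimately obtain d where d: "\<And>s. \<gamma> (s + d) = \<omega> * \<gamma> s" using rotation_is_shift by blast
  have pow: "\<gamma> (s + real n * d) = \<omega> ^ n * \<gamma> s" for n s
  proof (induction n)
    case (Suc n)
    have "s + real (Suc n) * d = (s + real n * d) + d" by (simp add: algebra_simps)
    then show ?case using Suc d by (metis mult.assoc power_Suc)
  qed simp
  have "\<omega> ^ k = 1" using k by (simp add: \<omega>_def Complex.DeMoivre)
  then obtain j :: int where j: "real k * d = of_int j * l"
    using pow[of 0 k] curve_eq_iff[of 0 "0 + real k * d"] by auto
  have "coprime j (int k)"
  proof -
    define g where "g = gcd j (int k)"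
    have g: "g > 0" using k by (simp add: g_def)
    obtain j' where j': "j = g * j'" unfolding g_def using gcd_dvd1[of j "int k"] by (elim dvdE)
    obtain k' where k'_eq: "int k = g * k'" unfolding g_def using gcd_dvd2[of j "int k"] by (elim dvdE)
    note jk = j' k'_eq
    have k': "k' > 0" using k g jk(2) by (metis of_nat_0_less_iff zero_less_mult_pos)
    have "(of_int g * of_int k') * d = (of_int g * of_int j') * l"
      using j unfolding jk(1) by (metis jk(2) of_int_mult of_int_of_nat_eq)
    then have "of_int k' * d = of_int j' * l" using g by simp
    then have "real (nat k') * d = of_int j' * l" using k' by simp
    then have fixes_curve: "\<omega> ^ nat k' * \<gamma> s = \<gamma> s" for s
      using pow[of s "nat k'"] periodic_int by simp
    have "\<gamma> 0 \<noteq> 0 \<or> \<gamma> (l / 2) \<noteq> 0" using curve_distinct[of "l / 2" 0] l_pos by auto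
    then have "\<omega> ^ nat k' = 1" using fixes_curve by (metis mult_cancel_right1)
    then have "cis (real (nat k') * (2 * pi / real k)) = cis 0" by (simp add: \<omega>_def Complex.DeMoivre)
    then obtain n :: int where "real (nat k') * (2 * pi / real k) = 0 + 2 * pi * of_int n"
      using cis_eq_cis_iff by blast
    then have "of_int k' = of_int n * real k" using k k' by (simp add: field_simps)
    then have "k' = n * int k" by (metis of_int_eq_iff of_int_mult of_int_of_nat_eq)
    then have "int k dvd k'" by simp
    then have "int k \<le> k'" using k' zdvd_imp_le by blast
    then have "g * k' \<le> 1 * k'" using jk(2) by simp
    then have "g = 1" using g k' by (simp add: mult_le_cancel_right)
    then show ?thesis by (simp add: g_def coprime_iff_gcd_eq_1)
  qed
  then obtain x y where xy: "x * j + y * int k = 1" using bezout_int[of j "int k"] by (auto simp: coprime_iff_gcd_eq_1)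
  obtain q where q: "j * ((x * r) mod int k) = r + q * int k"
  proof
    have "j * ((x * r) mod int k) = j * (x * r - int k * ((x * r) div int k))"
      by (simp add: minus_mult_div_eq_mod)
    also have "\<dots> = (x * j + y * int k) * r + (- (y * r) - j * ((x * r) div int k)) * int k" by (simp add: algebra_simps)
    finally show "j * ((x * r) mod int k) = r + (- (y * r) - j * ((x * r) div int k)) * int k" unfolding xy by simp
  qed
  define m where "m = nat ((x * r) mod int k)"
  have m: "int m = (x * r) mod int k" using k by (simp add: m_def)
  have "real m * d = of_int r * l / real k + of_int q * l"
  proof -
    have "real k * (real m * d) = real m * of_int j * l" using j by (simp add: mult_ac)
    also have "real m * of_int j = of_int (j * int m)" by simp
    also have "\<dots> = of_int r + of_int q * real k" unfolding m q by simp
    finally show ?thesis using k by (simp add: field_simps)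
  qed
  then have "\<gamma> (s + of_int r * l / real k) = \<omega> ^ m * \<gamma> s" for s
    using pow[of s m] periodic_int[of "s + of_int r * l / real k" q] by (simp add: add.assoc)
  moreover have "cmod (\<omega> ^ m) = 1" by (simp add: \<omega>_def norm_power)
  ultimately show ?thesis using that by blast
qed

end

section \<open>Rigidity\<close>

theorem corollary2:
  fixes \<gamma> :: "real \<Rightarrow> complex" and l :: real and k :: nat and r :: int
    and \<Lambda> U :: "(complex \<times> real) set"
  assumes "k \<ge> 3"
    and "C2_closed_curve \<gamma> l"
    and "strictly_convex_curve \<gamma>"
    and "rotation (2 * pi / real k) ` range \<gamma> = range \<gamma>"
    and "rotational_invariant_curve \<gamma> \<Lambda>"
    and "has_rotation_number \<gamma> l \<Lambda> (real_of_int r / real k)"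
    and "coprime r (int k)"
    and "\<Lambda> \<subseteq> U"
    and "totally_integrable \<gamma> U"
  shows "\<exists>c \<rho>. \<rho> > 0 \<and> range \<gamma> = sphere c \<rho>"
proof -
  interpret billiard_table \<gamma> l using assms(2,3) by unfold_locales
  have k: "k > 0" using assms(1) by simp
  obtain F where F: "C1_foliation \<gamma> U F" and ric: "\<And>L. L \<in> F \<Longrightarrow> rotational_invariant_curve \<gamma> L"
    using assms(9) unfolding totally_integrable_def by blast
  have U: "\<Union>F = U" using F unfolding C1_foliation_def by blast
  obtain c where c: "lifts c \<Lambda>" using essential_curve_lifts[OF assms(5)] by blast
  have per: "(step ^^ k) (c t) = c t + (of_int r * l, 0)" for t
  proof -
    have x: "proj (c t) \<in> \<Lambda>" by (rule liftsD(5)[OF c])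
    then obtain L where L: "L \<in> F" "proj (c t) \<in> L" using assms(8) U by blast
    obtain \<sigma> where \<sigma>: "\<forall>n. \<gamma> (\<sigma> n) = fst ((billiard_map \<gamma> ^^ n) (proj (c t))) \<and> \<sigma> n < \<sigma> (Suc n) \<and> \<sigma> (Suc n) < \<sigma> n + l"
      "(\<lambda>n. (\<sigma> n - \<sigma> 0) / (real n * l)) \<longlonglongrightarrow> of_int r / real k"
      using assms(6) x unfolding has_rotation_number_def by blast
    show ?thesis
      by (rule leaf_periodic[OF F ric L(1) k L(2) _ _ _ \<sigma>(2) liftsD(4)[OF c] refl]) (use \<sigma>(1) in auto)
  qed
  obtain \<zeta> where \<zeta>: "cmod \<zeta> = 1" "\<And>s. \<gamma> (s + of_int r * l / real k) = \<zeta> * \<gamma> s"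
    using symmetry_shift[OF k assms(4), of r] by blast
  have "step (c t) = c t + (of_int r * l / real k, 0)" for t
    by (rule periodic_curve_orbits_regular[OF c k per \<zeta>(2,1)])
  then show ?thesis using regular_orbits_imp_circle[OF c \<zeta>(2,1)] by blast
qed

end
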